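(* Suppose (a) $\mathcal{V}(X\mid Y)$ is bounded away from zero almost surely (there is $c>0$ with $\mathcal{V}(X\mid Y)\ge c$ a.s.), and (b) $\mathcal{T}(X\mid Y)$ is bounded away from infinity almost surely (there is $C<\infty$ with $\mathcal{T}(X\mid Y)\le C$ a.s.). Then for every $0\le\varepsilon\le1$, $$L^*_{\max}(n,\varepsilon,X,Y) = n(1-\varepsilon)H(X\mid Y) - \sqrt{n\,V_{\mathrm c}(X\mid Y)}\,f_{\mathrm G}(\varepsilon) + O(\log n)\quad (n\to\infty).$$
   Context: Setting: $\mathcal{X}=\{1,2,\dots\}$ with its power set, $\mathcal{Y}$ an arbitrary measurable space, $X$ an $\mathcal{X}$-valued and $Y$ a $\mathcal{Y}$-valued random variable. Logarithms are base 2. $P_{X|Y}(x\mid Y)$ is a version of $\mathbb{P}\{X=x\mid Y\}$; $\iota(X\mid Y):=\log(1/P_{X|Y}(X\mid Y))$. Define the $\sigma(Y)$-measurable quantities $\mathcal{H}(X\mid Y):=\mathbb{E}[\iota(X\mid Y)\mid Y]$, $\mathcal{V}(X\mid Y):=\mathbb{E}[(\iota(X\mid Y)-\mathcal{H}(X\mid Y))^2\mid Y]$, $\mathcal{T}(X\mid Y):=\mathbb{E}[|\iota(X\mid Y)-\mathcal{H}(X\mid Y)|^3\mid Y]$, and the numbers $H(X\mid Y):=\mathbb{E}[\mathcal{H}(X\mid Y)]$, $V_{\mathrm c}(X\mid Y):=\mathbb{E}[\mathcal{V}(X\mid Y)]$. $(X_i,Y_i)$, $i=1,\dots,n$, are i.i.d.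 copies of $(X,Y)$, $X^n=(X_1,\dots,X_n)$, $Y^n=(Y_1,\dots,Y_n)$. $\varphi(t)=e^{-t^2/2}/\sqrt{2\pi}$, $\Phi$ the standard Gaussian CDF, $f_{\mathrm G}(s):=\varphi(\Phi^{-1}(s))$ for $0<s<1$ and $f_{\mathrm G}(0)=f_{\mathrm G}(1)=0$. Codes: $\{0,1\}^*$ is the set of finite binary strings including the empty string $\varnothing$, and $\ell(\mathbf b)$ is the length of $\mathbf b$. A variable-length stochastic code is a pair of random (possibly randomized) maps $F_n:\mathcal X^n\times\mathcal Y^n\to\{0,1\}^*$, $G_n:\{0,1\}^*\times\mathcal Y^n\to\mathcal X^n$ such that $F_n(X^n,Y^n)$ and $G_n(F_n(X^n,Y^n),Y^n)$ are random variables. It is an $(n,L,\varepsilon)_{\max}$-code if $\mathbb{E}[\ell(F_n(X^n,Y^n))]\le L$ and $\mathbb{P}\{X^n\ne G_n(F_n(X^n,Y^n),Y^n)\mid Y^n\}\le\varepsilon$ a.s. $L^*_{\max}(n,\varepsilon,X,Y):=\inf\{L>0:\text{an }(n,L,\varepsilon)_{\max}\text{-code exists}\}$. *)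

theory Defs
  imports "HOL-Probability.Probability" "HOL-Library.Landau_Symbols"
begin

definition sigY :: "'a measure \<Rightarrow> ('a \<Rightarrow> 'y) \<Rightarrow> 'y measure \<Rightarrow> 'a measure" where
  "sigY M Y N = vimage_algebra (space M) Y N"

definition condP :: "'a measure \<Rightarrow> ('a \<Rightarrow> nat) \<Rightarrow> ('a \<Rightarrow> 'y) \<Rightarrow> 'y measure \<Rightarrow> nat \<Rightarrow> 'a \<Rightarrow> real" where
  "condP M X Y N x = real_cond_exp M (sigY M Y N) (indicator {\<omega> \<in> space M. X \<omega> = x})"

definition iota :: "'a measure \<Rightarrow> ('a \<Rightarrow> nat) \<Rightarrow> ('a \<Rightarrow> 'y) \<Rightarrow> 'y measure \<Rightarrow> 'a \<Rightarrow> real" where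
  "iota M X Y N \<omega> = log 2 (1 / condP M X Y N (X \<omega>) \<omega>)"

definition calH :: "'a measure \<Rightarrow> ('a \<Rightarrow> nat) \<Rightarrow> ('a \<Rightarrow> 'y) \<Rightarrow> 'y measure \<Rightarrow> 'a \<Rightarrow> real" where
  "calH M X Y N = real_cond_exp M (sigY M Y N) (iota M X Y N)"

definition calV :: "'a measure \<Rightarrow> ('a \<Rightarrow> nat) \<Rightarrow> ('a \<Rightarrow> 'y) \<Rightarrow> 'y measure \<Rightarrow> 'a \<Rightarrow> ennreal" where
  "calV M X Y N = nn_cond_exp M (sigY M Y N)
     (\<lambda>\<omega>. ennreal ((iota M X Y N \<omega> - calH M X Y N \<omega>)\<^sup>2))"

definition calT :: "'a measure \<Rightarrow> ('a \<Rightarrow> nat) \<Rightarrow> ('a \<Rightarrow> 'y) \<Rightarrow> 'y measure \<Rightarrow> 'a \<Rightarrow> ennreal" where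
  "calT M X Y N = nn_cond_exp M (sigY M Y N)
     (\<lambda>\<omega>. ennreal (\<bar>iota M X Y N \<omega> - calH M X Y N \<omega>\<bar> ^ 3))"

definition condH :: "'a measure \<Rightarrow> ('a \<Rightarrow> nat) \<Rightarrow> ('a \<Rightarrow> 'y) \<Rightarrow> 'y measure \<Rightarrow> real" where
  "condH M X Y N = integral\<^sup>L M (calH M X Y N)"

definition condVc :: "'a measure \<Rightarrow> ('a \<Rightarrow> nat) \<Rightarrow> ('a \<Rightarrow> 'y) \<Rightarrow> 'y measure \<Rightarrow> real" where
  "condVc M X Y N = enn2real (\<integral>\<^sup>+ \<omega>. calV M X Y N \<omega> \<partial>M)"

definition Phi :: "real \<Rightarrow> real" where
  "Phi t = measure (density lborel std_normal_density) {..t}"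

definition Phi_inv :: "real \<Rightarrow> real" where
  "Phi_inv s = (THE t. Phi t = s)"

definition fG :: "real \<Rightarrow> real" where
  "fG s = (if 0 < s \<and> s < 1 then std_normal_density (Phi_inv s) else 0)"

definition PXY :: "'a measure \<Rightarrow> ('a \<Rightarrow> nat) \<Rightarrow> ('a \<Rightarrow> 'y) \<Rightarrow> 'y measure \<Rightarrow> (nat \<times> 'y) measure" where
  "PXY M X Y N = distr M (count_space UNIV \<Otimes>\<^sub>M N) (\<lambda>\<omega>. (X \<omega>, Y \<omega>))"

text \<open>Probability space carrying n i.i.d. copies (X_i,Y_i), i < n, together with an independent
  uniform random seed on [0,1] that provides the (shared) randomisation of encoder and decoder.\<close>
definition Qn :: "'a measure \<Rightarrow> ('a \<Rightarrow> nat) \<Rightarrow> ('a \<Rightarrow> 'y) \<Rightarrow> 'y measure \<Rightarrow> nat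
    \<Rightarrow> ((nat \<Rightarrow> nat \<times> 'y) \<times> real) measure" where
  "Qn M X Y N n = (PiM {..<n} (\<lambda>_. PXY M X Y N)) \<Otimes>\<^sub>M uniform_measure lborel {0..1::real}"

definition Yn :: "nat \<Rightarrow> (nat \<Rightarrow> nat \<times> 'y) \<Rightarrow> (nat \<Rightarrow> 'y)" where
  "Yn n \<omega> = (\<lambda>i\<in>{..<n}. snd (\<omega> i))"

text \<open>(n, L, eps)_max code: encoder F (randomised through the seed) and decoder G
  (randomised through the same seed), such that F(X^n,Y^n) and G(F(X^n,Y^n),Y^n)
  are random variables, E[length] <= L and P{error | Y^n} <= eps a.s.\<close>
definition is_code_max :: "'a measure \<Rightarrow> ('a \<Rightarrow> nat) \<Rightarrow> ('a \<Rightarrow> 'y) \<Rightarrow> 'y measure \<Rightarrow> nat \<Rightarrow> real \<Rightarrow> real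
    \<Rightarrow> ((nat \<Rightarrow> nat \<times> 'y) \<times> real \<Rightarrow> bool list)
    \<Rightarrow> (bool list \<Rightarrow> (nat \<Rightarrow> 'y) \<Rightarrow> real \<Rightarrow> (nat \<Rightarrow> nat)) \<Rightarrow> bool" where
  "is_code_max M X Y N n L eps F G \<longleftrightarrow>
     (let Q = Qn M X Y N n;
          dec = (\<lambda>z. G (F z) (Yn n (fst z)) (snd z));
          Err = {z \<in> space Q. \<exists>i<n. dec z i \<noteq> fst (fst z i)}
      in F \<in> Q \<rightarrow>\<^sub>M count_space UNIV
       \<and> (\<lambda>z. restrict (dec z) {..<n}) \<in> Q \<rightarrow>\<^sub>M PiM {..<n} (\<lambda>_. count_space UNIV)
       \<and> (\<integral>\<^sup>+ z. ennreal (real (length (F z))) \<partial>Q) \<le> ennreal L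
       \<and> (AE z in Q. real_cond_exp Q
             (vimage_algebra (space Q) (\<lambda>z. Yn n (fst z)) (PiM {..<n} (\<lambda>_. N)))
             (indicator Err) z \<le> eps))"

definition Lstar_max :: "'a measure \<Rightarrow> ('a \<Rightarrow> nat) \<Rightarrow> ('a \<Rightarrow> 'y) \<Rightarrow> 'y measure \<Rightarrow> nat \<Rightarrow> real \<Rightarrow> real" where
  "Lstar_max M X Y N n eps = Inf {L. L > 0 \<and> (\<exists>F G. is_code_max M X Y N n L eps F G)}"

end

theory Submission
  imports Defs
begin

text \<open>
  Let \<open>S\<close> be the information of \<open>X\<^sup>n\<close> given \<open>Y\<^sup>n\<close>. Up to \<open>O(log n)\<close>, the shortest expected length of a code
  with conditional error \<open>\<epsilon>\<close> is the minimum, given \<open>Y\<^sup>n\<close>, of the mean of \<open>S\<close> over an event of conditional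
  probability \<open>1 - \<epsilon>\<close>. By linear programming duality this minimum is the supremum over \<open>t\<close> of
  \<open>(1 - \<epsilon>) t - E (t - S)\<^sup>+\<close>: any \<open>t\<close> gives a converse, and the threshold of the optimal test attains the
  supremum. So only the hinge loss \<open>E (t - S)\<^sup>+\<close> of a sum of independent variables has to be compared with
  its Gaussian counterpart. Lindeberg's replacement argument does this with error \<open>O(log n)\<close>: the Gaussian
  loss \<open>g(v, u)\<close> of variance \<open>v\<close> solves the heat equation and its third derivative in \<open>u\<close> is \<open>O(1 / v)\<close>, so
  that the errors add up to a harmonic sum. For the Gaussian loss the dual problem has the value
  \<open>- sqrt v f\<^sub>G(\<epsilon>)\<close>, and the conditional variance \<open>v\<close> concentrates around \<open>n V\<^sub>c\<close>.
\<close>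

section \<open>The standard normal distribution\<close>

text \<open>Two obstacles shape the proof. The expansion of the Gaussian loss degenerates at
  variance 0, and the hinge function is not smooth; both are met by starting the replacement at
  variance 1, which moves a hinge loss by at most 1. Hypothesis (a) then makes the variance after
  \<open>k\<close> replacements at least \<open>1 + k * c\<close>, which is the source of the
  harmonic sum, and (b) bounds the remainder of every single replacement. All these bounds are
  uniform in the side information, so the whole comparison is carried out for each fixed value of
  \<open>Y^n\<close>, with a parameter \<open>t\<close> that depends on it, and is averaged only
  afterwards. Codewords have to be distinct but need not form a prefix code. The converse therefore
  compares the source with a probability weight on all strings, at the price of
  \<open>O(log n)\<close>; the achievability numbers the blocks by decreasing conditional
  probability. As \<open>X\<close> is discrete, conditional laws are families of \<open>pmf\<close>s
  with measurable point masses, and \<open>\<Y>\<close>-valued side information never needs a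
  topology.\<close>

lemma DERIV_std_normal_density:
  "(std_normal_density has_real_derivative (- x * std_normal_density x)) (at x)"
  unfolding std_normal_density_def[abs_def]
  by (auto intro!: derivative_eq_intros simp: field_simps)

lemma std_normal_density_le_1: "std_normal_density x \<le> 1"
proof -
  have "1 / sqrt (2 * pi) \<le> 1" using pi_gt3 by (simp add: divide_simps)
  moreover have "exp (- x\<^sup>2 / 2) \<le> 1" by simp
  ultimately show ?thesis unfolding std_normal_density_def
    by (metis exp_ge_zero mult_le_one)
qed

lemma abs_mult_std_normal_density_le_1: "\<bar>x * std_normal_density x\<bar> \<le> 1"
proof -
  have "\<bar>x\<bar> \<le> 1 + x\<^sup>2 / 2"
    using zero_le_power2[of "\<bar>x\<bar> - 1"] by (simp add: power2_eq_square algebra_simps)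
  also have "\<dots> \<le> exp (x\<^sup>2 / 2)" by (rule exp_ge_add_one_self)
  finally have "\<bar>x\<bar> * exp (- x\<^sup>2 / 2) \<le> 1"
    by (simp add: exp_minus divide_simps)
  moreover have "1 / sqrt (2 * pi) \<le> 1" using pi_gt3 by (simp add: divide_simps)
  ultimately have "(1 / sqrt (2 * pi)) * (\<bar>x\<bar> * exp (- x\<^sup>2 / 2)) \<le> 1 * 1"
    by (intro mult_mono) auto
  then show ?thesis unfolding std_normal_density_def by (simp add: abs_mult)
qed

lemma square_mult_std_normal_density_le_1: "\<bar>(x\<^sup>2 - 1) * std_normal_density x\<bar> \<le> 1"
proof -
  have 1: "1 / sqrt (2 * pi) \<le> 1 / 2"
  proof -
    have "sqrt 4 \<le> sqrt (2 * pi)" using pi_gt3 by (intro real_sqrt_le_mono) simp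
    then have "2 \<le> sqrt (2 * pi)" by simp
    then show ?thesis by (simp add: divide_simps)
  qed
  have "\<bar>x\<^sup>2 - 1\<bar> \<le> 2 * (1 + x\<^sup>2 / 2)" by (auto simp: abs_if)
  also have "\<dots> \<le> 2 * exp (x\<^sup>2 / 2)" using exp_ge_add_one_self[of "x\<^sup>2 / 2"] by argo
  finally have "\<bar>x\<^sup>2 - 1\<bar> * exp (- x\<^sup>2 / 2) \<le> 2"
    by (simp add: exp_minus divide_simps)
  then have "(1 / sqrt (2 * pi)) * (\<bar>x\<^sup>2 - 1\<bar> * exp (- x\<^sup>2 / 2)) \<le> 1 / 2 * 2"
    using 1 by (intro mult_mono) auto
  then show ?thesis unfolding std_normal_density_def by (simp add: abs_mult)
qed

interpretation std_normal: real_distribution "density lborel std_normal_density"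
  by (rule real_distribution.intro[OF prob_space_normal_density])
     (simp_all add: real_distribution_axioms_def)

lemma Phi_eq_cdf: "Phi = cdf (density lborel std_normal_density)"
  by (simp add: Phi_def cdf_def fun_eq_iff)

lemma Phi_nonneg: "0 \<le> Phi t" and Phi_le_1: "Phi t \<le> 1"
  unfolding Phi_def by simp_all

lemma Phi_at_top: "(Phi \<longlongrightarrow> 1) at_top"
  unfolding Phi_eq_cdf by (rule std_normal.cdf_lim_at_top_prob)

lemma Phi_at_bot: "(Phi \<longlongrightarrow> 0) at_bot"
  unfolding Phi_eq_cdf by (rule std_normal.cdf_lim_at_bot)

lemma DERIV_Phi: "(Phi has_real_derivative std_normal_density t) (at t)"
proof -
  have cont: "continuous_on S std_normal_density" for S
    by (intro continuous_at_imp_continuous_on ballI DERIV_isCont[OF DERIV_std_normal_density])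
  \<comment> \<open>The fundamental theorem of calculus speaks of compact intervals, so
    \<open>Phi\<close> is split at the auxiliary point \<open>t - 1\<close>, which leaves
    \<open>t\<close> in the interior.\<close>
  have eq: "Phi x = Phi (t - 1) + integral {t - 1..x} std_normal_density" if "t - 1 < x" for x
  proof -
    have "Phi x - Phi (t - 1) = measure (density lborel std_normal_density) {t - 1<..x}"
      unfolding Phi_eq_cdf by (rule std_normal.cdf_diff_eq[OF that])
    also have "\<dots> = enn2real (\<integral>\<^sup>+y. ennreal (indicator {t - 1<..x} y * std_normal_density y) \<partial>lborel)"
      by (auto simp: measure_def emeasure_density intro!: arg_cong[where f = enn2real] nn_integral_cong
          split: split_indicator)
    also have "\<dots> = (LINT y|lborel. indicator {t - 1<..x} y * std_normal_density y)"
      by (rule integral_eq_nn_integral[symmetric]) auto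
    also have "\<dots> = (LINT y|lborel. indicator {t - 1..x} y * std_normal_density y)"
      by (intro integral_cong_AE) (auto intro: AE_mp[OF AE_lborel_singleton[of "t - 1"]] simp: indicator_def)
    also have "\<dots> = integral {t - 1..x} std_normal_density"
      using set_borel_integral_eq_integral(2)[OF borel_integrable_atLeastAtMost'[OF cont, of "t - 1" x]]
      by (simp add: set_lebesgue_integral_def)
    finally show ?thesis by simp
  qed
  have "((\<lambda>x. integral {t - 1..x} std_normal_density) has_real_derivative std_normal_density t)
      (at t within {t - 1..t + 1})"
    by (rule integral_has_real_derivative[OF cont]) auto
  then have "((\<lambda>x. integral {t - 1..x} std_normal_density) has_real_derivative std_normal_density t)
      (at t)"
    by (simp add: at_within_Icc_at)
  then have "((\<lambda>x. Phi (t - 1) + integral {t - 1..x} std_normal_density) has_real_derivative std_normal_density t)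
      (at t)"
    by (auto intro!: derivative_eq_intros)
  then show ?thesis
    by (rule has_field_derivative_transform_within_open[where S = "{t - 1<..}"]) (auto simp: eq)
qed

lemma Phi_strict_mono: "s < t \<Longrightarrow> Phi s < Phi t"
  using DERIV_pos_imp_increasing[of s t Phi] DERIV_Phi normal_density_pos[of 1] by (metis zero_less_one)

text \<open>The density is even, so the sum of the two values has derivative zero; the constant is
  read off at infinity.\<close>

lemma Phi_minus: "Phi (- t) = 1 - Phi t"
proof -
  have "((\<lambda>x. Phi x + Phi (- x)) has_real_derivative 0) (at x)" for x
    using DERIV_add[OF DERIV_Phi[of x] DERIV_chain2[OF DERIV_Phi[of "- x"] DERIV_minus[OF DERIV_ident]]]
    by (simp add: std_normal_density_def)
  then have const: "Phi x + Phi (- x) = Phi t + Phi (- t)" for x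
    using DERIV_isconst_all[of "\<lambda>x. Phi x + Phi (- x)" x t] by blast
  have "((\<lambda>x. Phi x + Phi (- x)) \<longlongrightarrow> 1 + 0) at_top"
    by (intro tendsto_add Phi_at_top filterlim_compose[OF Phi_at_bot] filterlim_uminus_at_bot_at_top)
  then have "((\<lambda>x::real. Phi t + Phi (- t)) \<longlongrightarrow> 1 + 0) at_top"
    by (subst (asm) ext[OF const])
  then have "Phi t + Phi (- t) = 1 + 0" by (subst (asm) tendsto_const_iff) auto
  then show ?thesis by simp
qed

lemma Phi_surj:
  assumes "0 < s" "s < 1"
  obtains t where "Phi t = s"
proof -
  have "eventually (\<lambda>t. Phi t < s) at_bot" using Phi_at_bot assms order_tendstoD(2) by blast
  then obtain a where a: "Phi a < s" by (auto simp: eventually_at_bot_linorder)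
  have "eventually (\<lambda>t. s < Phi t) at_top" using Phi_at_top assms order_tendstoD(1) by blast
  then obtain b where b: "s < Phi b" by (auto simp: eventually_at_top_linorder)
  have "a \<le> b" using a b Phi_strict_mono[of b a] by linarith
  then have "\<exists>x\<ge>a. x \<le> b \<and> Phi x = s"
    using a b by (intro IVT') (auto intro!: continuous_at_imp_continuous_on DERIV_isCont DERIV_Phi)
  then show ?thesis using that by blast
qed

lemma Phi_inv_Phi: "Phi_inv (Phi t) = t"
  unfolding Phi_inv_def
proof (rule the_equality)
  show "u = t" if "Phi u = Phi t" for u
    using that Phi_strict_mono[of u t] Phi_strict_mono[of t u] by linarith
qed simp

lemma Phi_range: "0 < Phi t" "Phi t < 1"
  using Phi_strict_mono[of "t - 1" t] Phi_strict_mono[of t "t + 1"] Phi_nonneg[of "t - 1"] Phi_le_1[of "t + 1"]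
  by linarith+

lemma fG_Phi: "fG (Phi t) = std_normal_density t"
  using Phi_range[of t] by (simp add: fG_def Phi_inv_Phi)

lemma fG_nonneg: "0 \<le> fG s" by (simp add: fG_def)

lemma fG_le_1: "fG s \<le> 1" by (simp add: fG_def std_normal_density_le_1)

lemma fG_one_minus: "fG (1 - s) = fG s"
proof (cases "0 < s \<and> s < 1")
  case True
  then obtain t where "Phi t = s" using Phi_surj by blast
  then show ?thesis using fG_Phi[of "- t"] fG_Phi[of t] by (simp add: Phi_minus std_normal_density_def)
qed (auto simp: fG_def)

text \<open>With \<open>Z\<close> standard normal, this is the closed form of the expected positive
  part of \<open>u + sqrt v * Z\<close>: the hinge function smoothed by a centred Gaussian of
  variance \<open>v\<close>.\<close>

definition gauss_loss :: "real \<Rightarrow> real \<Rightarrow> real" where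
  "gauss_loss v u = u * Phi (u / sqrt v) + sqrt v * std_normal_density (u / sqrt v)"

lemma DERIV_Phi_scaled:
  assumes "v > 0"
  shows "((\<lambda>u. Phi (u / sqrt v)) has_real_derivative std_normal_density (u / sqrt v) / sqrt v) (at u)"
  using DERIV_chain2[OF DERIV_Phi DERIV_cdivide[OF DERIV_ident, where c = "sqrt v"], where x = u] by simp

lemma DERIV_std_normal_density_scaled:
  assumes "v > 0"
  shows "((\<lambda>u. std_normal_density (u / sqrt v)) has_real_derivative
    - (u / sqrt v) * std_normal_density (u / sqrt v) / sqrt v) (at u)"
  using DERIV_chain2[OF DERIV_std_normal_density DERIV_cdivide[OF DERIV_ident, where c = "sqrt v"], where x = u]
  by simp

lemma DERIV_gauss_loss:
  assumes "v > 0"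
  shows "(gauss_loss v has_real_derivative Phi (u / sqrt v)) (at u)"
  unfolding gauss_loss_def[abs_def]
  by (rule derivative_eq_intros DERIV_Phi_scaled[OF assms] DERIV_std_normal_density_scaled[OF assms] refl)+
     (use assms in \<open>simp add: field_simps\<close>)

text \<open>The third derivative in \<open>u\<close> is
  \<open>- x * std_normal_density x / v\<close> with \<open>x = u / sqrt v\<close>. Since
  \<open>x * std_normal_density x\<close> is bounded, it carries the factor
  \<open>1 / v\<close>.\<close>

lemma gauss_loss_Taylor:
  assumes "v > 0"
  shows "\<bar>gauss_loss v (a - d) - (gauss_loss v a - d * Phi (a / sqrt v)
      + d\<^sup>2 * (std_normal_density (a / sqrt v) / (2 * sqrt v)))\<bar> \<le> \<bar>d\<bar> ^ 3 / v"
proof (cases "d = 0")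
  case False
  define D where "D = (\<lambda>m::nat. if m = 0 then gauss_loss v else if m = 1 then (\<lambda>u. Phi (u / sqrt v))
    else if m = 2 then (\<lambda>u. std_normal_density (u / sqrt v) / sqrt v)
    else (\<lambda>u. - (u / sqrt v) * std_normal_density (u / sqrt v) / sqrt v / sqrt v))"
  have deriv: "(D m has_real_derivative D (Suc m) t) (at t)" if m: "m < 3" for m t
  proof -
    consider "m = 0" | "m = 1" | "m = 2" using m by (auto simp: numeral_3_eq_3 less_Suc_eq)
    then show ?thesis
      using DERIV_cdivide[OF DERIV_std_normal_density_scaled[OF assms, of t], of "sqrt v"]
      by cases (auto simp: D_def DERIV_gauss_loss[OF assms] DERIV_Phi_scaled[OF assms])
  qed
  have "\<exists>t. (if a - d < a then a - d < t \<and> t < a else a < t \<and> t < a - d) \<and>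
      gauss_loss v (a - d) = (\<Sum>m<3. D m a / fact m * (a - d - a) ^ m) + D 3 t / fact 3 * (a - d - a) ^ 3"
    by (rule Taylor[where a = "a - \<bar>d\<bar>" and b = "a + \<bar>d\<bar>"])
       (use False deriv in \<open>auto simp: D_def\<close>)
  then obtain t where t: "gauss_loss v (a - d) =
      (\<Sum>m<3. D m a / fact m * (a - d - a) ^ m) + D 3 t / fact 3 * (a - d - a) ^ 3" by blast
  have "\<bar>D 3 t\<bar> = \<bar>(t / sqrt v) * std_normal_density (t / sqrt v)\<bar> / v"
    using assms by (simp add: D_def abs_mult)
  also have "\<dots> \<le> 1 / v"
    using assms by (intro divide_right_mono abs_mult_std_normal_density_le_1) auto
  finally have D3: "\<bar>D 3 t\<bar> \<le> 1 / v" .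
  have "gauss_loss v (a - d) - (gauss_loss v a - d * Phi (a / sqrt v)
      + d\<^sup>2 * (std_normal_density (a / sqrt v) / (2 * sqrt v))) = D 3 t / fact 3 * (- d) ^ 3"
    unfolding t by (simp add: D_def eval_nat_numeral)
  also have "\<bar>\<dots>\<bar> = \<bar>D 3 t\<bar> * \<bar>d\<bar> ^ 3 / 6"
    by (simp add: abs_mult power_abs eval_nat_numeral)
  also have "\<dots> \<le> (1 / v) * \<bar>d\<bar> ^ 3 / 6"
    using D3 by (intro divide_right_mono mult_right_mono) auto
  also have "\<dots> \<le> \<bar>d\<bar> ^ 3 / v" using assms by (simp add: field_simps)
  finally show ?thesis .
qed simp

text \<open>This is the heat equation: the right-hand side is half the second derivative in
  \<open>u\<close>.\<close>

lemma DERIV_gauss_loss_variance: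
  assumes "v > 0"
  shows "((\<lambda>v. gauss_loss v u) has_real_derivative std_normal_density (u / sqrt v) / (2 * sqrt v)) (at v)"
proof -
  have s: "((\<lambda>v. u / sqrt v) has_real_derivative - u / (2 * v * sqrt v)) (at v)"
    using assms by (auto intro!: derivative_eq_intros simp: field_simps)
  have 1: "((\<lambda>v. u * Phi (u / sqrt v) + sqrt v * std_normal_density (u / sqrt v)) has_real_derivative
      u * (std_normal_density (u / sqrt v) * (- u / (2 * v * sqrt v))) +
      (inverse (sqrt v) / 2 * std_normal_density (u / sqrt v) +
       (- (u / sqrt v) * std_normal_density (u / sqrt v) * (- u / (2 * v * sqrt v))) * sqrt v)) (at v)"
    using assms
    by (intro DERIV_add DERIV_cmult DERIV_chain2[OF DERIV_Phi s] DERIV_mult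
        DERIV_chain2[OF DERIV_std_normal_density s] DERIV_real_sqrt) auto
  \<comment> \<open>The two contributions of the inner argument \<open>u / sqrt v\<close> cancel;
    only the derivative of the factor \<open>sqrt v\<close> survives.\<close>
  have eq: "u * (p * (- u / (2 * v * s))) + (inverse s / 2 * p + (- (u / s) * p * (- u / (2 * v * s))) * s)
     = p / (2 * s)" if "s > 0" for p s :: real
    using that assms by (simp add: field_simps)
  show ?thesis
    using 1 assms unfolding gauss_loss_def[abs_def] by (subst (asm) eq) auto
qed

text \<open>The second derivative in the variance is
  \<open>(x\<^sup>2 - 1) * std_normal_density x / (4 * v * sqrt v)\<close> with
  \<open>x = u / sqrt v\<close>. Only the decay \<open>1 / v\<close> is kept, which matches the
  error of \<open>gauss_loss_Taylor\<close>.\<close>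

lemma gauss_loss_heat:
  assumes "v \<ge> 1" "w \<ge> 0"
  shows "\<bar>gauss_loss (v + w) u - (gauss_loss v u + w * (std_normal_density (u / sqrt v) / (2 * sqrt v)))\<bar>
    \<le> w\<^sup>2 / v"
proof (cases "w = 0")
  case False
  then have w: "w > 0" using assms by simp
  define q where "q = (\<lambda>v. std_normal_density (u / sqrt v) / (2 * sqrt v))"
  define q' where "q' = (\<lambda>v. ((u / sqrt v)\<^sup>2 - 1) * std_normal_density (u / sqrt v) / (4 * v * sqrt v))"
  have q: "(q has_real_derivative q' x) (at x)" if "x > 0" for x
  proof -
    have s: "((\<lambda>v. u / sqrt v) has_real_derivative - u / (2 * x * sqrt x)) (at x)"
      using that by (auto intro!: derivative_eq_intros simp: field_simps)
    have "(q has_real_derivative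
       ((- (u / sqrt x) * std_normal_density (u / sqrt x) * (- u / (2 * x * sqrt x))) * (2 * sqrt x)
         - std_normal_density (u / sqrt x) * (2 * (inverse (sqrt x) / 2))) / (2 * sqrt x * (2 * sqrt x))) (at x)"
      unfolding q_def using that
      by (intro DERIV_divide DERIV_chain2[OF DERIV_std_normal_density s] DERIV_cmult DERIV_real_sqrt) auto
    moreover have "((- (u / s) * p * (- u / (2 * x * s))) * (2 * s)
         - p * (2 * (inverse s / 2))) / (2 * s * (2 * s)) = ((u / s)\<^sup>2 - 1) * p / (4 * x * s)"
      if "s > 0" "x = s * s" for p s
      using that by (simp add: field_simps power2_eq_square)
    note this[of "sqrt x" "std_normal_density (u / sqrt x)"]
    ultimately show ?thesis using that unfolding q'_def by simp
  qed
  define D where "D = (\<lambda>m::nat. if m = 0 then (\<lambda>v. gauss_loss v u) else if m = 1 then q else q')"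
  have deriv: "(D m has_real_derivative D (Suc m) t) (at t)" if m: "m < 2" and t: "v \<le> t" for m t
  proof -
    have "t > 0" using t assms by linarith
    consider "m = 0" | "m = 1" using m by (auto simp: numeral_2_eq_2 less_Suc_eq)
    then show ?thesis
      using DERIV_gauss_loss_variance[OF \<open>t > 0\<close>, of u] q[OF \<open>t > 0\<close>]
      by cases (auto simp: D_def q_def)
  qed
  have "\<exists>t. v < t \<and> t < v + w \<and>
      gauss_loss (v + w) u = (\<Sum>m<2. D m v / fact m * (v + w - v) ^ m) + D 2 t / fact 2 * (v + w - v) ^ 2"
    by (rule Taylor_up[where a = v and f = "\<lambda>v. gauss_loss v u"]) (use w deriv in \<open>auto simp: D_def\<close>)
  then obtain t where t: "v < t" "gauss_loss (v + w) u =
      (\<Sum>m<2. D m v / fact m * (v + w - v) ^ m) + D 2 t / fact 2 * (v + w - v) ^ 2" by blast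
  have t1: "t \<ge> 1" "t > 0" "sqrt t \<ge> 1" using t assms by auto
  have "\<bar>q' t\<bar> = \<bar>((u / sqrt t)\<^sup>2 - 1) * std_normal_density (u / sqrt t)\<bar> / (4 * t * sqrt t)"
    unfolding q'_def using t1 by (simp add: abs_mult)
  also have "\<dots> \<le> 1 / (4 * t * sqrt t)"
    using t1 by (intro divide_right_mono square_mult_std_normal_density_le_1) auto
  also have "\<dots> \<le> 1 / v"
  proof (rule divide_left_mono)
    have "v * 1 \<le> t * sqrt t" using t t1 assms by (intro mult_mono) auto
    then show "v \<le> 4 * t * sqrt t" using t1 assms by linarith
  qed (use t1 assms in auto)
  finally have D2: "\<bar>D 2 t\<bar> \<le> 1 / v" by (simp add: D_def)
  have "gauss_loss (v + w) u - (gauss_loss v u + w * (std_normal_density (u / sqrt v) / (2 * sqrt v)))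
    = D 2 t * w\<^sup>2 / 2"
    unfolding t(2) by (simp add: D_def q_def eval_nat_numeral)
  also have "\<bar>\<dots>\<bar> = \<bar>D 2 t\<bar> * w\<^sup>2 / 2" by (simp add: abs_mult)
  also have "\<dots> \<le> (1 / v) * w\<^sup>2 / 2"
    using D2 by (intro divide_right_mono mult_right_mono) auto
  also have "\<dots> \<le> w\<^sup>2 / v" using assms by (simp add: field_simps)
  finally show ?thesis .
qed (use assms in auto)

text \<open>By convexity: the left-hand side is the tangent to \<^term>\<open>gauss_loss v\<close> at \<^term>\<open>sqrt v * b\<close>.\<close>
lemma gauss_loss_ge_tangent:
  assumes "v > 0"
  shows "Phi b * u + sqrt v * std_normal_density b \<le> gauss_loss v u"
proof -
  define h where "h = (\<lambda>u. gauss_loss v u - Phi b * u)"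
  have deriv: "(h has_real_derivative Phi (u / sqrt v) - Phi b) (at u)" for u
    unfolding h_def by (auto intro!: derivative_eq_intros DERIV_gauss_loss assms)
  have mono: "Phi s \<le> Phi t" if "s \<le> t" for s t
    using Phi_strict_mono[of s t] that by (cases "s = t") auto
  define u0 where "u0 = sqrt v * b"
  have u0: "h u0 = sqrt v * std_normal_density b"
    using assms by (simp add: h_def gauss_loss_def u0_def)
  have "h u0 \<le> h u"
  proof (cases "u0 \<le> u")
    case True
    then show ?thesis
    proof (rule DERIV_nonneg_imp_nondecreasing)
      fix x assume "u0 \<le> x" "x \<le> u"
      then have "b \<le> x / sqrt v" using assms by (simp add: u0_def field_simps)
      then show "\<exists>y. DERIV h x :> y \<and> 0 \<le> y" using deriv[of x] mono by fastforce
    qed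
  next
    case False
    then have "u \<le> u0" by simp
    then show ?thesis
    proof (rule DERIV_nonpos_imp_nonincreasing)
      fix x assume "u \<le> x" "x \<le> u0"
      then have "x / sqrt v \<le> b" using assms by (simp add: u0_def field_simps)
      then show "\<exists>y. DERIV h x :> y \<and> y \<le> 0" using deriv[of x] mono by fastforce
    qed
  qed
  then show ?thesis unfolding u0 by (simp add: h_def)
qed

text \<open>The convex conjugate of \<open>gauss_loss v\<close> at slope \<open>s\<close> is
  \<open>- sqrt v * fG s\<close>. An interior slope is some \<open>Phi b\<close> and has a tangent;
  the slopes 0 and 1 are reached by letting \<open>b\<close> tend to minus or plus infinity.\<close>

lemma gauss_loss_dual:
  assumes "v > 0" "0 \<le> s" "s \<le> 1"
  shows "s * u + sqrt v * fG s \<le> gauss_loss v u"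
proof -
  consider "0 < s \<and> s < 1" | "s = 0" | "s = 1" using assms by linarith
  then show ?thesis
  proof cases
    case 1
    then obtain b where "Phi b = s" using Phi_surj by blast
    then show ?thesis using gauss_loss_ge_tangent[OF assms(1), of b u] fG_Phi[of b] by simp
  next
    case 2
    have "((\<lambda>b. Phi b * u) \<longlongrightarrow> 0 * u) at_bot" by (intro tendsto_intros Phi_at_bot)
    then have "0 * u \<le> gauss_loss v u"
    proof (rule tendsto_upperbound)
      show "\<forall>\<^sub>F b in at_bot. Phi b * u \<le> gauss_loss v u"
        using gauss_loss_ge_tangent[OF assms(1), of _ u] assms(1)
        by (intro always_eventually allI) (smt (verit) mult_nonneg_nonneg normal_density_nonneg real_sqrt_ge_zero)
    qed simp
    then show ?thesis using 2 by (simp add: fG_def)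
  next
    case 3
    have "((\<lambda>b. Phi b * u) \<longlongrightarrow> 1 * u) at_top" by (intro tendsto_intros Phi_at_top)
    then have "1 * u \<le> gauss_loss v u"
    proof (rule tendsto_upperbound)
      show "\<forall>\<^sub>F b in at_top. Phi b * u \<le> gauss_loss v u"
        using gauss_loss_ge_tangent[OF assms(1), of _ u] assms(1)
        by (intro always_eventually allI) (smt (verit) mult_nonneg_nonneg normal_density_nonneg real_sqrt_ge_zero)
    qed simp
    then show ?thesis using 3 by (simp add: fG_def)
  qed
qed

lemma gauss_loss_nonneg: "v > 0 \<Longrightarrow> 0 \<le> gauss_loss v u"
  using gauss_loss_dual[of v 0 u] by (simp add: fG_def)

text \<open>This is the price of starting at variance 1. The lower bound is duality at the slopes 0
  and 1.\<close>

lemma gauss_loss_1: "max 0 u \<le> gauss_loss 1 u" "gauss_loss 1 u \<le> max 0 u + 1"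
proof -
  show "max 0 u \<le> gauss_loss 1 u"
    using gauss_loss_dual[of 1 0 u] gauss_loss_dual[of 1 1 u] by (simp add: fG_def)
  have "u * Phi u \<le> max 0 u * Phi u" by (intro mult_right_mono Phi_nonneg) auto
  also have "\<dots> \<le> max 0 u * 1" by (intro mult_left_mono Phi_le_1) auto
  finally show "gauss_loss 1 u \<le> max 0 u + 1"
    using std_normal_density_le_1[of u] by (simp add: gauss_loss_def)
qed

text \<open>For \<open>s \<in> {0, 1}\<close> the supremum in the dual is only approached at infinity, whence the slack \<open>1\<close>.\<close>
lemma gauss_loss_dual_near:
  assumes "0 \<le> s" "s \<le> 1"
  obtains A :: real and t :: "real \<Rightarrow> real" where "t \<in> borel_measurable borel"
    "\<And>v. v \<ge> 1 \<Longrightarrow> \<bar>t v\<bar> \<le> A * v"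
    "\<And>v. v \<ge> 1 \<Longrightarrow> gauss_loss v (t v) \<le> s * t v + sqrt v * fG s + 1"
proof -
  \<comment> \<open>At the endpoints \<open>t v\<close> is \<open>- v\<close> or \<open>v\<close>,
    so the density is evaluated at \<open>sqrt v\<close> up to sign; this term bounds by how much
    the loss can exceed \<open>s * t v\<close>.\<close>
  have tail: "sqrt v * std_normal_density (sqrt v) \<le> 1" for v
    using abs_mult_std_normal_density_le_1[of "sqrt v"] by linarith
  consider "0 < s \<and> s < 1" | "s = 0" | "s = 1" using assms by linarith
  then show ?thesis
  proof cases
    case 1
    then obtain b where b: "Phi b = s" using Phi_surj by blast
    show ?thesis
    proof (rule that[of "\<lambda>v. b * sqrt v" "\<bar>b\<bar>"])
      fix v :: real assume v: "v \<ge> 1"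
      have "sqrt v * 1 \<le> sqrt v * sqrt v" using v by (intro mult_left_mono) auto
      then show "\<bar>b * sqrt v\<bar> \<le> \<bar>b\<bar> * v" using v by (simp add: abs_mult mult_left_mono)
      show "gauss_loss v (b * sqrt v) \<le> s * (b * sqrt v) + sqrt v * fG s + 1"
        using v b by (simp add: gauss_loss_def fG_Phi[symmetric] algebra_simps)
    qed simp
  next
    case 2
    show ?thesis
    proof (rule that[of "\<lambda>v. - v" 1])
      fix v :: real assume v: "v \<ge> 1"
      have e: "- v / sqrt v = - sqrt v" using v by (simp add: real_div_sqrt)
      have "gauss_loss v (- v) \<le> sqrt v * std_normal_density (- sqrt v)"
        unfolding gauss_loss_def e using v Phi_nonneg by (simp add: mult_nonneg_nonneg)
      also have "\<dots> \<le> 1" using tail[of v] by (simp add: std_normal_density_def)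
      finally show "gauss_loss v (- v) \<le> s * (- v) + sqrt v * fG s + 1" using 2 by (simp add: fG_def)
    qed auto
  next
    case 3
    show ?thesis
    proof (rule that[of "\<lambda>v. v" 1])
      fix v :: real assume v: "v \<ge> 1"
      have e: "v / sqrt v = sqrt v" using v by (simp add: real_div_sqrt)
      have "v * Phi (sqrt v) \<le> v * 1" using v by (intro mult_left_mono Phi_le_1) auto
      then show "gauss_loss v v \<le> s * v + sqrt v * fG s + 1"
        unfolding gauss_loss_def e using tail[of v] 3 by (simp add: fG_def)
    qed auto
  qed
qed

section \<open>Information of a discrete distribution and the replacement argument\<close>

text \<open>Off the support the conventions \<open>1 / 0 = 0\<close> and \<open>ln 0 = 0\<close>
  give the value 0, so the information is nonnegative at every point.\<close>

definition info :: "'x pmf \<Rightarrow> 'x \<Rightarrow> real" where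
  "info p x = log 2 (1 / pmf p x)"

definition ent :: "'x pmf \<Rightarrow> real" where
  "ent p = measure_pmf.expectation p (info p)"

definition varent :: "'x pmf \<Rightarrow> real" where
  "varent p = measure_pmf.expectation p (\<lambda>x. (info p x - ent p)\<^sup>2)"

text \<open>These are the hypotheses (a) and (b) for one value of the side information. The third
  moment is a nonnegative integral, so its bound includes finiteness; \<open>ent\<close> is a
  Bochner integral and needs integrability stated separately.\<close>

definition good_pmf :: "real \<Rightarrow> real \<Rightarrow> 'x pmf \<Rightarrow> bool" where
  "good_pmf c C p \<longleftrightarrow> integrable (measure_pmf p) (info p) \<and>
     (\<integral>\<^sup>+x. ennreal (\<bar>info p x - ent p\<bar> ^ 3) \<partial>p) \<le> ennreal C \<and> c \<le> varent p"

lemma info_nonneg: "0 \<le> info p x"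
  unfolding info_def using pmf_le_1[of p x] pmf_nonneg[of p x]
  by (cases "pmf p x = 0") (auto simp: log_def divide_simps intro!: ln_ge_zero)

lemma ent_nonneg: "0 \<le> ent p"
  unfolding ent_def by (intro integral_nonneg_AE) (simp add: info_nonneg)

lemma varent_nonneg: "0 \<le> varent p"
  unfolding varent_def by (intro integral_nonneg_AE) simp

text \<open>Absolute value and square are both dominated by one plus the absolute cube, so a third
  moment alone controls every term of the Taylor expansion.\<close>

lemma cube_moment:
  fixes D :: "'x \<Rightarrow> real" and p :: "'x pmf"
  assumes "(\<integral>\<^sup>+x. ennreal (\<bar>D x\<bar> ^ 3) \<partial>p) \<le> ennreal C" "0 \<le> C"
  shows "integrable (measure_pmf p) D"
    "integrable (measure_pmf p) (\<lambda>x. (D x)\<^sup>2)"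
    "integrable (measure_pmf p) (\<lambda>x. \<bar>D x\<bar> ^ 3)"
    "measure_pmf.expectation p (\<lambda>x. \<bar>D x\<bar> ^ 3) \<le> C"
    "measure_pmf.expectation p (\<lambda>x. (D x)\<^sup>2) \<le> 1 + C"
proof -
  show 3: "integrable (measure_pmf p) (\<lambda>x. \<bar>D x\<bar> ^ 3)"
    using assms(1) by (intro integrableI_bounded) (auto simp: power_abs intro: le_less_trans)
  have sq: "(D x)\<^sup>2 \<le> 1 + \<bar>D x\<bar> ^ 3" for x
  proof (cases "\<bar>D x\<bar> \<le> 1")
    case True
    then have "(D x)\<^sup>2 \<le> 1" by (simp add: abs_square_le_1)
    then show ?thesis by (simp add: add_increasing2)
  next
    case False
    then have "\<bar>D x\<bar> ^ 2 \<le> \<bar>D x\<bar> ^ 3" by (intro power_increasing) auto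
    then show ?thesis by simp
  qed
  have lin: "\<bar>D x\<bar> \<le> 1 + \<bar>D x\<bar> ^ 3" for x
  proof (cases "\<bar>D x\<bar> \<le> 1")
    case True
    then show ?thesis by (simp add: add_increasing2)
  next
    case False
    then have "\<bar>D x\<bar> ^ 1 \<le> \<bar>D x\<bar> ^ 3" by (intro power_increasing) auto
    then show ?thesis by simp
  qed
  have B: "integrable (measure_pmf p) (\<lambda>x. 1 + \<bar>D x\<bar> ^ 3)" using 3 by simp
  show "integrable (measure_pmf p) D"
    by (rule Bochner_Integration.integrable_bound[OF B]) (use lin in \<open>auto intro: order_trans[OF _ abs_ge_self]\<close>)
  show 2: "integrable (measure_pmf p) (\<lambda>x. (D x)\<^sup>2)"
    by (rule Bochner_Integration.integrable_bound[OF B]) (use sq in \<open>auto intro: order_trans[OF _ abs_ge_self]\<close>)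
  have "ennreal (measure_pmf.expectation p (\<lambda>x. \<bar>D x\<bar> ^ 3)) \<le> ennreal C"
    using assms(1) by (subst nn_integral_eq_integral[OF 3, symmetric]) auto
  then show C: "measure_pmf.expectation p (\<lambda>x. \<bar>D x\<bar> ^ 3) \<le> C"
    using assms(2) by simp
  have "measure_pmf.expectation p (\<lambda>x. (D x)\<^sup>2) \<le> measure_pmf.expectation p (\<lambda>x. 1 + \<bar>D x\<bar> ^ 3)"
    by (intro integral_mono 2 B sq)
  also have "\<dots> = 1 + measure_pmf.expectation p (\<lambda>x. \<bar>D x\<bar> ^ 3)"
    using 3 by simp
  finally show "measure_pmf.expectation p (\<lambda>x. (D x)\<^sup>2) \<le> 1 + C" using C by simp
qed

text \<open>One step of Lindeberg's replacement argument. The Gaussian summand is never introduced: by the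
  heat equation for \<^const>\<open>gauss_loss\<close>, adding it amounts to increasing the first parameter.\<close>
lemma Lindeberg_step:
  fixes D :: "'x \<Rightarrow> real" and p :: "'x pmf"
  assumes "(\<integral>\<^sup>+x. ennreal (\<bar>D x\<bar> ^ 3) \<partial>p) \<le> ennreal C" "0 \<le> C"
    and mean: "measure_pmf.expectation p D = 0"
    and v: "v \<ge> 1"
    and V: "V = measure_pmf.expectation p (\<lambda>x. (D x)\<^sup>2)"
  shows "integrable (measure_pmf p) (\<lambda>x. gauss_loss v (a - D x))"
    "\<bar>measure_pmf.expectation p (\<lambda>x. gauss_loss v (a - D x)) - gauss_loss (v + V) a\<bar>
       \<le> (C + (1 + C)\<^sup>2) / v"
proof -
  note m = cube_moment[OF assms(1,2)]
  have V0: "0 \<le> V" unfolding V by (intro integral_nonneg_AE) simp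
  have VC: "V \<le> 1 + C" unfolding V by (rule m(5))
  define b where "b = std_normal_density (a / sqrt v) / (2 * sqrt v)"
  define T where "T = (\<lambda>x. gauss_loss v a - D x * Phi (a / sqrt v) + (D x)\<^sup>2 * b)"
  have T: "integrable (measure_pmf p) T" unfolding T_def using m by simp
  \<comment> \<open>The linear term has mean zero. What is left is also the first-order expansion of
    \<open>gauss_loss (v + V) a\<close> in the variance, because \<open>b\<close> is half the second
    derivative in \<open>a\<close>.\<close>
  have ET: "measure_pmf.expectation p T = gauss_loss v a + V * b"
    unfolding T_def using m by (simp add: mean V)
  have diff: "\<bar>gauss_loss v (a - D x) - T x\<bar> \<le> \<bar>D x\<bar> ^ 3 / v" for x
    unfolding T_def b_def by (rule gauss_loss_Taylor) (use v in simp)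
  have R: "integrable (measure_pmf p) (\<lambda>x. gauss_loss v (a - D x) - T x)"
  proof (rule Bochner_Integration.integrable_bound)
    show "integrable (measure_pmf p) (\<lambda>x. \<bar>D x\<bar> ^ 3 / v)" using m by simp
  qed (use diff v in auto)
  show g: "integrable (measure_pmf p) (\<lambda>x. gauss_loss v (a - D x))"
    using Bochner_Integration.integrable_add[OF R T] by simp
  have "\<bar>measure_pmf.expectation p (\<lambda>x. gauss_loss v (a - D x)) - measure_pmf.expectation p T\<bar>
    = \<bar>measure_pmf.expectation p (\<lambda>x. gauss_loss v (a - D x) - T x)\<bar>"
    using g T by simp
  also have "\<dots> \<le> measure_pmf.expectation p (\<lambda>x. \<bar>gauss_loss v (a - D x) - T x\<bar>)"
    by (rule integral_abs_bound)
  also have "\<dots> \<le> measure_pmf.expectation p (\<lambda>x. \<bar>D x\<bar> ^ 3 / v)"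
    by (intro integral_mono diff integrable_abs R) (use m in simp)
  also have "\<dots> \<le> C / v" using m v by (simp add: divide_right_mono)
  finally have 1: "\<bar>measure_pmf.expectation p (\<lambda>x. gauss_loss v (a - D x)) - (gauss_loss v a + V * b)\<bar> \<le> C / v"
    unfolding ET .
  have "\<bar>gauss_loss (v + V) a - (gauss_loss v a + V * b)\<bar> \<le> V\<^sup>2 / v"
    unfolding b_def by (rule gauss_loss_heat[OF v V0])
  also have "\<dots> \<le> (1 + C)\<^sup>2 / v" using V0 VC v by (intro divide_right_mono power_mono) auto
  finally show "\<bar>measure_pmf.expectation p (\<lambda>x. gauss_loss v (a - D x)) - gauss_loss (v + V) a\<bar>
       \<le> (C + (1 + C)\<^sup>2) / v"
    using 1 by (simp add: add_divide_distrib)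
qed

lemma nn_integral_Pi_pmf_Suc:
  "(\<integral>\<^sup>+x. f x \<partial>Pi_pmf {..<Suc n} d p) =
    (\<integral>\<^sup>+z. (\<integral>\<^sup>+x. f (x(n := z)) \<partial>Pi_pmf {..<n} d p) \<partial>p n)"
  by (simp add: lessThan_Suc Pi_pmf_insert nn_integral_pair_pmf' case_prod_unfold)

text \<open>The last coordinate is integrated outermost: the induction hypothesis, with
  \<open>u\<close> shifted by \<open>D n z\<close>, replaces the first \<open>n\<close> summands,
  and \<open>Lindeberg_step\<close> replaces the last one at the variance accumulated so far. Two
  inequalities between nonnegative integrals express closeness without any joint
  integrability.\<close>

lemma Lindeberg_gauss_loss:
  fixes D :: "nat \<Rightarrow> 'x \<Rightarrow> real" and p :: "nat \<Rightarrow> 'x pmf"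
  assumes "\<And>i. i < n \<Longrightarrow> (\<integral>\<^sup>+x. ennreal (\<bar>D i x\<bar> ^ 3) \<partial>p i) \<le> ennreal C" "0 \<le> C" "0 < c"
    and "\<And>i. i < n \<Longrightarrow> measure_pmf.expectation (p i) (D i) = 0"
    and "\<And>i. i < n \<Longrightarrow> V i = measure_pmf.expectation (p i) (\<lambda>x. (D i x)\<^sup>2)"
    and "\<And>i. i < n \<Longrightarrow> c \<le> V i"
  shows "(\<integral>\<^sup>+x. ennreal (gauss_loss 1 (u - (\<Sum>i<n. D i (x i)))) \<partial>Pi_pmf {..<n} d p)
      \<le> ennreal (gauss_loss (1 + (\<Sum>i<n. V i)) u + (C + (1 + C)\<^sup>2) * (\<Sum>k<n. 1 / (1 + real k * c))) \<and>
    ennreal (gauss_loss (1 + (\<Sum>i<n. V i)) u) \<le>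
      (\<integral>\<^sup>+x. ennreal (gauss_loss 1 (u - (\<Sum>i<n. D i (x i)))) \<partial>Pi_pmf {..<n} d p)
       + ennreal ((C + (1 + C)\<^sup>2) * (\<Sum>k<n. 1 / (1 + real k * c)))"
  using assms
proof (induction n arbitrary: u)
  case 0
  show ?case by simp
next
  case (Suc n)
  define B where "B = C + (1 + C)\<^sup>2"
  define v where "v = 1 + (\<Sum>i<n. V i)"
  define E where "E = B * (\<Sum>k<n. 1 / (1 + real k * c))"
  have B: "0 \<le> B" using Suc.prems(2) by (simp add: B_def)
  have E: "0 \<le> E" unfolding E_def using B Suc.prems(3) by (intro mult_nonneg_nonneg sum_nonneg) auto
  \<comment> \<open>The lower bound on the variances enters here: \<open>v\<close> grows at least
    linearly in \<open>n\<close>, so this step costs at most \<open>B / (1 + n * c)\<close>.\<close>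
  have "(\<Sum>i<n. c) \<le> (\<Sum>i<n. V i)" using Suc.prems(6) by (intro sum_mono) auto
  then have vc: "1 + n * c \<le> v" by (simp add: v_def)
  moreover have nc: "0 \<le> n * c" using Suc.prems(3) by simp
  ultimately have v: "1 \<le> v" by linarith
  define g where "g = measure_pmf.expectation (p n) (\<lambda>z. gauss_loss v (u - D n z))"
  have int: "integrable (measure_pmf (p n)) (\<lambda>z. gauss_loss v (u - D n z))"
    and step: "\<bar>g - gauss_loss (v + V n) u\<bar> \<le> B / v"
    using Lindeberg_step[where D = "D n" and p = "p n" and C = C and v = v and V = "V n" and a = u] Suc.prems v by (auto simp: B_def g_def)
  have Bv: "B / v \<le> B * (1 / (1 + n * c))"
    using B vc v nc by (simp add: frac_le)
  have vpos: "0 \<le> gauss_loss v y" "0 \<le> gauss_loss (v + V n) y" for y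
    using v Suc.prems(3) Suc.prems(6)[of n] by (intro gauss_loss_nonneg; simp)+
  have Er: "B * (\<Sum>k<Suc n. 1 / (1 + real k * c)) = E + B * (1 / (1 + n * c))"
    by (simp add: E_def distrib_left)
  have vV: "1 + (\<Sum>i<Suc n. V i) = v + V n" by (simp add: v_def)
  have nn: "(\<integral>\<^sup>+z. ennreal (gauss_loss v (u - D n z)) \<partial>p n) = ennreal g"
    unfolding g_def by (intro nn_integral_eq_integral int) (simp add: vpos)
  have g: "0 \<le> g" unfolding g_def by (intro integral_nonneg_AE) (simp add: vpos)
  have LHS: "(\<integral>\<^sup>+x. ennreal (gauss_loss 1 (u - (\<Sum>i<Suc n. D i (x i)))) \<partial>Pi_pmf {..<Suc n} d p)
     = (\<integral>\<^sup>+z. (\<integral>\<^sup>+x. ennreal (gauss_loss 1 ((u - D n z) - (\<Sum>i<n. D i (x i)))) \<partial>Pi_pmf {..<n} d p) \<partial>p n)"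
    unfolding nn_integral_Pi_pmf_Suc by (simp add: algebra_simps)
  have IH: "(\<integral>\<^sup>+x. ennreal (gauss_loss 1 (y - (\<Sum>i<n. D i (x i)))) \<partial>Pi_pmf {..<n} d p)
      \<le> ennreal (gauss_loss v y + E)"
    "ennreal (gauss_loss v y) \<le>
      (\<integral>\<^sup>+x. ennreal (gauss_loss 1 (y - (\<Sum>i<n. D i (x i)))) \<partial>Pi_pmf {..<n} d p) + ennreal E"
    for y using Suc.IH[of y, folded B_def, folded v_def E_def] Suc.prems by auto
  show ?case
  proof
    have "(\<integral>\<^sup>+x. ennreal (gauss_loss 1 (u - (\<Sum>i<Suc n. D i (x i)))) \<partial>Pi_pmf {..<Suc n} d p)
      \<le> (\<integral>\<^sup>+z. ennreal (gauss_loss v (u - D n z) + E) \<partial>p n)"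
      unfolding LHS by (intro nn_integral_mono IH(1))
    also have "\<dots> = ennreal g + ennreal E"
      using E by (simp add: vpos nn_integral_add nn)
    also have "\<dots> \<le> ennreal (gauss_loss (v + V n) u + (E + B * (1 / (1 + n * c))))"
    proof -
      have "g + E \<le> gauss_loss (v + V n) u + (E + B * (1 / (1 + real n * c)))"
        using step Bv by linarith
      then show ?thesis using E g by (simp add: ennreal_leI flip: ennreal_plus)
    qed
    finally show "(\<integral>\<^sup>+x. ennreal (gauss_loss 1 (u - (\<Sum>i<Suc n. D i (x i)))) \<partial>Pi_pmf {..<Suc n} d p)
      \<le> ennreal (gauss_loss (1 + (\<Sum>i<Suc n. V i)) u + (C + (1 + C)\<^sup>2) * (\<Sum>k<Suc n. 1 / (1 + real k * c)))"
      unfolding vV B_def[symmetric] Er .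
  next
    have "ennreal (gauss_loss (v + V n) u) \<le> ennreal (g + B * (1 / (1 + n * c)))"
      using step Bv by (intro ennreal_leI) auto
    also have "\<dots> = ennreal g + ennreal (B * (1 / (1 + n * c)))"
      using g B nc by (intro ennreal_plus) auto
    also have "ennreal g = (\<integral>\<^sup>+z. ennreal (gauss_loss v (u - D n z)) \<partial>p n)" by (rule nn[symmetric])
    also have "\<dots> \<le> (\<integral>\<^sup>+z. (\<integral>\<^sup>+x. ennreal (gauss_loss 1 ((u - D n z) - (\<Sum>i<n. D i (x i)))) \<partial>Pi_pmf {..<n} d p)
        + ennreal E \<partial>p n)"
      by (intro nn_integral_mono IH(2))
    also have "\<dots> = (\<integral>\<^sup>+x. ennreal (gauss_loss 1 (u - (\<Sum>i<Suc n. D i (x i)))) \<partial>Pi_pmf {..<Suc n} d p) + ennreal E"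
      unfolding LHS by (simp add: nn_integral_add)
    finally show "ennreal (gauss_loss (1 + (\<Sum>i<Suc n. V i)) u) \<le>
      (\<integral>\<^sup>+x. ennreal (gauss_loss 1 (u - (\<Sum>i<Suc n. D i (x i)))) \<partial>Pi_pmf {..<Suc n} d p)
       + ennreal ((C + (1 + C)\<^sup>2) * (\<Sum>k<Suc n. 1 / (1 + real k * c)))"
      unfolding vV B_def[symmetric] Er
      using E B nc by (subst ennreal_plus) (auto simp: add.assoc add_right_mono)
  qed
qed

text \<open>The leading 1 pays for smoothing the hinge to \<open>gauss_loss 1\<close>; the rest is
  the constant of \<open>Lindeberg_step\<close> times the logarithmic bound of
  \<open>sum_reciprocal_le\<close>.\<close>

definition Lindeberg_error :: "real \<Rightarrow> real \<Rightarrow> nat \<Rightarrow> real" where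
  "Lindeberg_error c C n = 1 + (C + (1 + C)\<^sup>2) / min 1 c * (1 + ln n)"

text \<open>Since \<open>min 1 c * (1 + k) \<le> 1 + k * c\<close>, the sum is at most a harmonic
  number divided by \<open>min 1 c\<close>.\<close>

lemma sum_reciprocal_le:
  assumes "0 < c" "0 < n"
  shows "(\<Sum>k<n. 1 / (1 + real k * c)) \<le> (1 + ln (real n)) / min 1 c"
proof -
  have harm_le: "harm n \<le> 1 + ln (real n)"
    using decseqD[OF decseq_harm_diff_ln, of 0 "n - 1"] assms by (simp add: harm_expand)
  have "(\<Sum>k<n. 1 / (1 + real k * c)) \<le> (\<Sum>k<n. (1 / min 1 c) * inverse (real (Suc k)))"
  proof (rule sum_mono)
    fix k
    have "min 1 c * (1 + real k) \<le> 1 + real k * c"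
    proof -
      have "min 1 c * real k \<le> c * real k" by (intro mult_right_mono) auto
      then show ?thesis by (simp add: algebra_simps)
    qed
    then show "1 / (1 + real k * c) \<le> (1 / min 1 c) * inverse (real (Suc k))"
      using assms by (simp add: divide_simps) (smt (verit) mult_nonneg_nonneg of_nat_0_le_iff)
  qed
  also have "\<dots> = (1 / min 1 c) * harm n"
    by (simp add: harm_altdef sum_distrib_left)
  also have "\<dots> \<le> (1 / min 1 c) * (1 + ln (real n))"
    using assms harm_le by (intro mult_left_mono) auto
  finally show ?thesis by simp
qed

text \<open>Centring gives summands of mean zero, and \<open>gauss_loss_1\<close> passes between the
  hinge and the loss of variance 1. The first bound serves the converse, the second the
  achievability.\<close>

lemma Lindeberg_info:
  fixes p :: "nat \<Rightarrow> 'x pmf"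
  assumes good: "\<And>i. i < n \<Longrightarrow> good_pmf c C (p i)" and "0 \<le> C" "0 < c" "0 < n"
  shows "(\<integral>\<^sup>+x. ennreal (max 0 (t - (\<Sum>i<n. info (p i) (x i)))) \<partial>Pi_pmf {..<n} d p)
      \<le> ennreal (gauss_loss (1 + (\<Sum>i<n. varent (p i))) (t - (\<Sum>i<n. ent (p i))) + Lindeberg_error c C n)"
    and "ennreal (gauss_loss (1 + (\<Sum>i<n. varent (p i))) (t - (\<Sum>i<n. ent (p i)))) \<le>
      (\<integral>\<^sup>+x. ennreal (max 0 (t - (\<Sum>i<n. info (p i) (x i)))) \<partial>Pi_pmf {..<n} d p)
       + ennreal (Lindeberg_error c C n)"
proof -
  define B where "B = C + (1 + C)\<^sup>2"
  define D where "D = (\<lambda>i x. info (p i) x - ent (p i))"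
  define u where "u = t - (\<Sum>i<n. ent (p i))"
  define v where "v = 1 + (\<Sum>i<n. varent (p i))"
  define E where "E = B * (\<Sum>k<n. 1 / (1 + real k * c))"
  have B: "0 \<le> B" using assms by (simp add: B_def)
  have E0: "0 \<le> E" unfolding E_def using B assms by (intro mult_nonneg_nonneg sum_nonneg) auto
  have "E \<le> B * ((1 + ln (real n)) / min 1 c)"
    unfolding E_def using B assms by (intro mult_left_mono sum_reciprocal_le) auto
  then have E: "E + 1 \<le> Lindeberg_error c C n"
    by (simp add: Lindeberg_error_def B_def)
  have "integrable (measure_pmf (p i)) (info (p i))" if "i < n" for i
    using good[OF that] by (simp add: good_pmf_def)
  then have mean: "measure_pmf.expectation (p i) (D i) = 0" if "i < n" for i
    unfolding D_def using that by (simp add: ent_def)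
  have L: "(\<integral>\<^sup>+x. ennreal (gauss_loss 1 (u - (\<Sum>i<n. D i (x i)))) \<partial>Pi_pmf {..<n} d p)
      \<le> ennreal (gauss_loss v u + E)"
    "ennreal (gauss_loss v u) \<le>
      (\<integral>\<^sup>+x. ennreal (gauss_loss 1 (u - (\<Sum>i<n. D i (x i)))) \<partial>Pi_pmf {..<n} d p) + ennreal E"
    unfolding v_def E_def B_def
    using Lindeberg_gauss_loss[where n = n and p = p and D = D and C = C and c = c
      and V = "\<lambda>i. varent (p i)" and u = u and d = d] good mean assms(2,3)
    by (simp_all add: good_pmf_def D_def varent_def)
  have eq: "u - (\<Sum>i<n. D i (x i)) = t - (\<Sum>i<n. info (p i) (x i))" for x :: "nat \<Rightarrow> 'x"
    by (simp add: u_def D_def sum_subtractf)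
  have "(\<integral>\<^sup>+x. ennreal (max 0 (t - (\<Sum>i<n. info (p i) (x i)))) \<partial>Pi_pmf {..<n} d p)
    \<le> (\<integral>\<^sup>+x. ennreal (gauss_loss 1 (u - (\<Sum>i<n. D i (x i)))) \<partial>Pi_pmf {..<n} d p)"
    unfolding eq by (intro nn_integral_mono ennreal_leI gauss_loss_1)
  also note L(1)
  also have "ennreal (gauss_loss v u + E) \<le> ennreal (gauss_loss v u + Lindeberg_error c C n)"
    using E by (intro ennreal_leI) simp
  finally show "(\<integral>\<^sup>+x. ennreal (max 0 (t - (\<Sum>i<n. info (p i) (x i)))) \<partial>Pi_pmf {..<n} d p)
      \<le> ennreal (gauss_loss (1 + (\<Sum>i<n. varent (p i))) (t - (\<Sum>i<n. ent (p i))) + Lindeberg_error c C n)"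
    unfolding v_def u_def .
  have "ennreal (gauss_loss v u) \<le>
      (\<integral>\<^sup>+x. ennreal (max 0 (t - (\<Sum>i<n. info (p i) (x i))) + 1) \<partial>Pi_pmf {..<n} d p) + ennreal E"
    using L(2) unfolding eq
    by (rule order_trans) (intro add_right_mono nn_integral_mono ennreal_leI gauss_loss_1)
  also have "\<dots> = (\<integral>\<^sup>+x. ennreal (max 0 (t - (\<Sum>i<n. info (p i) (x i)))) \<partial>Pi_pmf {..<n} d p) + ennreal (E + 1)"
    using E0 by (simp add: nn_integral_add add.assoc add.commute)
  also have "\<dots> \<le> (\<integral>\<^sup>+x. ennreal (max 0 (t - (\<Sum>i<n. info (p i) (x i)))) \<partial>Pi_pmf {..<n} d p)
       + ennreal (Lindeberg_error c C n)"
    using E by (intro add_left_mono ennreal_leI)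
  finally show "ennreal (gauss_loss (1 + (\<Sum>i<n. varent (p i))) (t - (\<Sum>i<n. ent (p i)))) \<le>
      (\<integral>\<^sup>+x. ennreal (max 0 (t - (\<Sum>i<n. info (p i) (x i)))) \<partial>Pi_pmf {..<n} d p)
       + ennreal (Lindeberg_error c C n)"
    unfolding v_def u_def .
qed

section \<open>Codes and tests\<close>

text \<open>Bijective base-2 numeration: every number is \<open>0\<close> or one of \<open>2 * m + 1\<close>, \<open>2 * m + 2\<close>.\<close>
fun bits :: "nat \<Rightarrow> bool list" where
  "bits k = (if k = 0 then [] else odd k # bits ((k - 1) div 2))"

declare bits.simps [simp del]

lemma bits_eq_Nil_iff: "bits k = [] \<longleftrightarrow> k = 0"
  by (subst bits.simps) simp

lemma bits_inject: "bits j = bits k \<longleftrightarrow> j = k"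
proof (induction j arbitrary: k rule: less_induct)
  case (less j)
  show ?case
  proof (cases "j = 0 \<or> k = 0")
    case True
    then show ?thesis using bits_eq_Nil_iff[of j] bits_eq_Nil_iff[of k] by (metis bits_eq_Nil_iff)
  next
    case False
    then have "bits j = bits k \<longleftrightarrow> odd j = odd k \<and> bits ((j - 1) div 2) = bits ((k - 1) div 2)"
      using bits.simps[of j] bits.simps[of k] by simp
    also have "\<dots> \<longleftrightarrow> odd j = odd k \<and> (j - 1) div 2 = (k - 1) div 2"
    proof -
      have "(j - 1) div 2 < j" using False by presburger
      from less[OF this] show ?thesis by blast
    qed
    also have "\<dots> \<longleftrightarrow> j = k"
    proof
      assume "odd j = odd k \<and> (j - 1) div 2 = (k - 1) div 2"
      \<comment> \<open>A positive number is recovered from its parity, which is the first bit, and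
        the number encoded by the remaining bits.\<close>
      moreover have "i = 2 * ((i - 1) div 2) + (if odd i then 1 else 2)" if "i \<noteq> 0" for i :: nat
        using that by (cases i) (auto simp: even_two_times_div_two odd_two_times_div_two_succ elim!: oddE)
      from this[of j] this[of k] calculation False show "j = k" by (auto split: if_splits)
    qed simp
    finally show ?thesis .
  qed
qed

text \<open>Each bit at least halves the successor: \<open>(k - 1) div 2 + 1\<close> is at most half
  of \<open>k + 1\<close>.\<close>

lemma length_bits: "2 ^ length (bits k) \<le> k + 1"
proof (induction k rule: bits.induct)
  case (1 k)
  show ?case
  proof (cases "k = 0")
    case False
    then have "2 ^ length (bits k) = 2 * 2 ^ length (bits ((k - 1) div 2))"
      by (subst bits.simps) simp
    also have "\<dots> \<le> 2 * ((k - 1) div 2 + 1)" using 1 False by simp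
    also have "\<dots> \<le> k + 1" using False by presburger
    finally show ?thesis .
  qed (simp add: bits.simps)
qed

text \<open>Position in the order of decreasing weight, ties broken by index. An infinite set has
  \<open>card\<close> 0, so the value is meaningful only where \<open>q k > 0\<close>, which makes
  the set finite.\<close>

definition prob_rank :: "(nat \<Rightarrow> real) \<Rightarrow> nat \<Rightarrow> nat" where
  "prob_rank q k = card {j. q k < q j \<or> (q j = q k \<and> j < k)}"

text \<open>The index \<open>k\<close> and all its predecessors have weight at least
  \<open>q k\<close>, while the total weight is at most 1.\<close>

lemma prob_rank_bound:
  fixes q :: "nat \<Rightarrow> real"
  assumes q: "\<And>F. finite F \<Longrightarrow> sum q F \<le> 1" and k: "q k > 0"
  shows "finite {j. q k < q j \<or> (q j = q k \<and> j < k)}" "(prob_rank q k + 1) * q k \<le> 1"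
proof -
  let ?A = "{j. q k < q j \<or> (q j = q k \<and> j < k)}"
  have fin: "card F * q k \<le> 1" if "finite F" "F \<subseteq> insert k ?A" for F
  proof -
    have "card F * q k = (\<Sum>j\<in>F. q k)" by simp
    also have "\<dots> \<le> sum q F" using that by (intro sum_mono) auto
    finally show ?thesis using q[OF that(1)] by simp
  qed
  have "finite (insert k ?A)"
  proof (rule ccontr)
    assume "infinite (insert k ?A)"
    from infinite_arbitrarily_large[OF this, of "nat \<lfloor>1 / q k\<rfloor> + 1"]
    obtain F where F: "F \<subseteq> insert k ?A" "finite F" "card F = nat \<lfloor>1 / q k\<rfloor> + 1"
      by (elim exE conjE)
    have "real (card F) > 1 / q k" unfolding F(3) using k by linarith
    then show False using fin[OF F(2,1)] k by (simp add: field_simps)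
  qed
  then show A: "finite ?A" by simp
  have "card (insert k ?A) = prob_rank q k + 1" using A by (simp add: prob_rank_def)
  then show "(prob_rank q k + 1) * q k \<le> 1" using fin[of "insert k ?A"] A by (metis finite_insert subset_refl)
qed

text \<open>The earlier of two distinct indices is a predecessor of the later one but not of itself,
  so the sets of predecessors are strictly nested.\<close>

lemma prob_rank_inj:
  fixes q :: "nat \<Rightarrow> real"
  assumes q: "\<And>F. finite F \<Longrightarrow> sum q F \<le> 1" and "q k > 0" "q l > 0" "prob_rank q k = prob_rank q l"
  shows "k = l"
proof -
  have less: "prob_rank q i < prob_rank q j" if "q j > 0" "q j < q i \<or> q j = q i \<and> i < j" for i j
    unfolding prob_rank_def
  proof (rule psubset_card_mono)
    show "finite {i. q j < q i \<or> q i = q j \<and> i < j}" by (rule prob_rank_bound(1)[OF q that(1)])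
    show "{j. q i < q j \<or> q j = q i \<and> j < i} \<subset> {i. q j < q i \<or> q i = q j \<and> i < j}"
      using that(2) by (intro psubsetI) (auto simp: set_eq_iff intro!: exI[of _ i])
  qed
  show ?thesis using less[of k l] less[of l k] assms(2-4)
    by (metis less_irrefl linorder_neqE_linordered_idom nat_neq_iff)
qed

text \<open>The factor \<open>(n / (n + 1)) ^ length s\<close> makes the weights \<open>2 ^ (- length s)\<close> summable, at the price of only
  \<open>2 / n\<close> bits per symbol.\<close>
definition string_weight :: "nat \<Rightarrow> bool list \<Rightarrow> real" where
  "string_weight n s = (1 / (n + 1)) * (n / (n + 1)) ^ length s * (1 / 2) ^ length s"

text \<open>There are \<open>2 ^ k\<close> strings of length \<open>k\<close>, so the lengths get a
  geometric distribution. This replaces Kraft's inequality for codes that are merely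
  injective.\<close>

lemma nn_integral_string_weight:
  "(\<integral>\<^sup>+s. ennreal (string_weight n s) \<partial>count_space UNIV) \<le> 1"
proof -
  define w where "w = (\<lambda>k. (1 / (n + 1)) * (n / (n + 1)) ^ k * (1 / 2) ^ k :: real)"
  have w: "0 \<le> w k" for k by (simp add: w_def)
  have "(\<integral>\<^sup>+s. ennreal (string_weight n s) \<partial>count_space UNIV)
      = (\<integral>\<^sup>+s. (\<Sum>k. ennreal (w k) * indicator {s :: bool list. length s = k} s) \<partial>count_space UNIV)"
  proof (rule nn_integral_cong)
    fix s :: "bool list"
    have "(\<Sum>k. ennreal (w k) * indicator {s :: bool list. length s = k} s)
       = (\<Sum>k\<in>{length s}. ennreal (w k) * indicator {s :: bool list. length s = k} s)"
      by (rule suminf_finite) auto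
    then show "ennreal (string_weight n s) = (\<Sum>k. ennreal (w k) * indicator {s :: bool list. length s = k} s)"
      by (simp add: string_weight_def w_def add.commute)
  qed
  also have "\<dots> = (\<Sum>k. \<integral>\<^sup>+s. ennreal (w k) * indicator {s :: bool list. length s = k} s \<partial>count_space UNIV)"
    by (rule nn_integral_suminf) simp
  also have "\<dots> = (\<Sum>k. ennreal (1 / (n + 1) * (n / (n + 1)) ^ k))"
  proof (rule suminf_cong)
    fix k
    have fin: "finite {s :: bool list. length s = k}" and card: "card {s :: bool list. length s = k} = 2 ^ k"
      using finite_lists_length_eq[of "UNIV :: bool set" k] card_lists_length_eq[of "UNIV :: bool set" k] by simp_all
    have "(\<integral>\<^sup>+s. ennreal (w k) * indicator {s :: bool list. length s = k} s \<partial>count_space UNIV) = ennreal (w k) * 2 ^ k"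
      using fin card by (subst nn_integral_cmult_indicator) (auto simp: emeasure_count_space_finite)
    also have "\<dots> = ennreal (w k * 2 ^ k)"
      using w by (simp add: ennreal_mult ennreal_power[symmetric])
    also have "w k * 2 ^ k = 1 / (n + 1) * (n / (n + 1)) ^ k"
      by (simp add: w_def power_divide)
    finally show "(\<integral>\<^sup>+s. ennreal (w k) * indicator {s :: bool list. length s = k} s \<partial>count_space UNIV)
      = ennreal (1 / (n + 1) * (n / (n + 1)) ^ k)" .
  qed
  also have "\<dots> = ennreal 1"
  proof (rule suminf_ennreal_eq)
    have "(\<lambda>k. (real n / (n + 1)) ^ k) sums (1 / (1 - real n / (n + 1)))"
      by (rule geometric_sums) simp
    from sums_mult[OF this, of "1 / (n + 1)"]
    show "(\<lambda>k. 1 / (n + 1) * (real n / (n + 1)) ^ k) sums 1"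
      by (simp add: divide_simps)
  qed simp
  finally show ?thesis by simp
qed

lemma ln_2_ge_half: "1 / 2 \<le> ln (2 :: real)"
  using ln_le_minus_one[of "1 / 2 :: real"] by (simp add: ln_div)

lemma string_weight_pos: "0 < n \<Longrightarrow> 0 < string_weight n s"
  by (simp add: string_weight_def)

lemma log_string_weight:
  assumes "0 < n"
  shows "log 2 (1 / string_weight n s) \<le> log 2 (n + 1) + (1 + 2 / n) * length s"
proof -
  have "log 2 (1 / string_weight n s) = log 2 ((n + 1) * ((n + 1) / n * 2) ^ length s)"
  proof -
    have "1 / ((1 / x) * (y / x) ^ k * (1 / 2) ^ k) = x * (x / y * 2) ^ k" if "x > 0" "y > 0" for x y :: real and k
      using that by (simp add: power_divide power_mult_distrib)
    from this[of "real n + 1" "real n"] show ?thesis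
      using assms by (simp add: string_weight_def add.commute)
  qed
  also have "\<dots> = log 2 (n + 1) + length s * (log 2 ((n + 1) / n) + 1)"
  proof -
    have "log 2 (y * (z * 2) ^ k) = log 2 y + k * (log 2 z + 1)" if "y > 0" "z > 0" for y z :: real and k
      using that by (simp add: log_mult log_nat_power distrib_left)
    from this[of "real n + 1" "(real n + 1) / real n"] show ?thesis using assms by (simp add: add.commute)
  qed
  finally have eq: "log 2 (1 / string_weight n s) = log 2 (n + 1) + length s * (log 2 ((n + 1) / n) + 1)" .
  \<comment> \<open>From \<open>ln (1 + 1 / n) \<le> 1 / n\<close>; the change of base costs at most
    a factor 2 because \<open>ln 2\<close> is at least one half.\<close>
  have "log 2 ((n + 1) / n) \<le> 2 / n"
  proof -
    have "ln ((n + 1) / n) \<le> 1 / n"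
      using assms ln_add_one_self_le_self[of "1 / n"] by (simp add: field_simps)
    then show ?thesis
      using assms ln_2_ge_half by (simp add: log_def field_simps)
  qed
  then have "length s * (log 2 ((n + 1) / n) + 1) \<le> length s * (2 / n + 1)"
    by (intro mult_left_mono) auto
  then show ?thesis unfolding eq by (simp add: algebra_simps)
qed

section \<open>Quantiles and the randomised threshold test\<close>

definition quantile :: "'x pmf \<Rightarrow> ('x \<Rightarrow> real) \<Rightarrow> real \<Rightarrow> real" where
  "quantile p S a = Inf {t. a \<le> measure_pmf.prob p {x. S x \<le> t}}"

text \<open>The first two facts are the left limit and the right continuity of the distribution
  function at the infimum. The third, an adjunction between quantile and distribution function,
  later yields measurability of the quantile in the side information.\<close>

lemma quantile:
  fixes S :: "'x \<Rightarrow> real"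
  assumes "0 < a" "a < 1" and S: "\<And>x. 0 \<le> S x"
  shows "measure_pmf.prob p {x. S x < quantile p S a} \<le> a"
    and "a \<le> measure_pmf.prob p {x. S x \<le> quantile p S a}"
    and "quantile p S a \<le> t \<longleftrightarrow> a \<le> measure_pmf.prob p {x. S x \<le> t}"
    and "0 \<le> quantile p S a"
proof -
  define R where "R = distr (measure_pmf p) borel S"
  interpret R: real_distribution R
    unfolding R_def by (intro prob_space.real_distribution_distr measure_pmf.prob_space_axioms) simp
  have cdf: "cdf R t = measure_pmf.prob p {x. S x \<le> t}" for t
    unfolding cdf_def R_def by (subst measure_distr) (auto simp: vimage_def)
  have lt: "measure R {..<t} = measure_pmf.prob p {x. S x < t}" for t
    unfolding R_def by (subst measure_distr) (auto simp: vimage_def)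
  define A where "A = {t. a \<le> cdf R t}"
  define q where "q = Inf A"
  have q: "quantile p S a = q" by (simp add: quantile_def q_def A_def cdf)
  have nonneg: "0 \<le> t" if "t \<in> A" for t
  proof (rule ccontr)
    assume "\<not> 0 \<le> t"
    then have "{x. S x \<le> t} = {}" using S by (auto simp: not_le intro: less_le_trans)
    then show False using that assms(1) by (simp add: A_def cdf)
  qed
  then have bdd: "bdd_below A" by (intro bdd_belowI)
  have "eventually (\<lambda>t. a < cdf R t) at_top"
    using R.cdf_lim_at_top_prob assms(2) order_tendstoD(1) by blast
  then obtain b where "a < cdf R b" by (auto simp: eventually_at_top_linorder)
  then have ne: "A \<noteq> {}" by (auto simp: A_def intro: less_imp_le)
  show "0 \<le> quantile p S a" unfolding q q_def by (rule cInf_greatest[OF ne nonneg])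
  have "(cdf R \<longlongrightarrow> measure R {..<q}) (at_left q)" by (rule R.cdf_at_left)
  moreover have "\<forall>\<^sub>F t in at_left q. cdf R t \<le> a"
    unfolding eventually_at_filter
  proof (intro always_eventually allI impI)
    fix t assume "t \<noteq> q" "t \<in> {..<q}"
    then have "t \<notin> A" using cInf_lower[OF _ bdd, of t] by (auto simp: q_def)
    then show "cdf R t \<le> a" by (simp add: A_def)
  qed
  ultimately show "measure_pmf.prob p {x. S x < quantile p S a} \<le> a"
    unfolding q lt[symmetric] by (intro tendsto_upperbound) auto
  have "(cdf R \<longlongrightarrow> cdf R q) (at_right q)"
    using R.cdf_is_right_cont[of q] by (simp add: continuous_within)
  moreover have "\<forall>\<^sub>F t in at_right q. a \<le> cdf R t"
    unfolding eventually_at_filter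
  proof (intro always_eventually allI impI)
    fix t assume "t \<noteq> q" "t \<in> {q<..}"
    then have "Inf A < t" by (simp add: q_def)
    then obtain s where "s \<in> A" "s < t" using cInf_lessD[OF ne] by blast
    then show "a \<le> cdf R t" using R.cdf_nondecreasing[of s t] by (simp add: A_def)
  qed
  ultimately have ge: "a \<le> cdf R q" by (intro tendsto_lowerbound) auto
  then show "a \<le> measure_pmf.prob p {x. S x \<le> quantile p S a}" by (simp add: q cdf)
  show "quantile p S a \<le> t \<longleftrightarrow> a \<le> measure_pmf.prob p {x. S x \<le> t}"
  proof
    assume "quantile p S a \<le> t"
    then show "a \<le> measure_pmf.prob p {x. S x \<le> t}"
      using ge R.cdf_nondecreasing[of q t] by (simp add: q cdf)
  next
    assume "a \<le> measure_pmf.prob p {x. S x \<le> t}"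
    then show "quantile p S a \<le> t" unfolding q q_def by (intro cInf_lower bdd) (simp add: A_def cdf)
  qed
qed

text \<open>The randomised Neyman-Pearson test of power \<open>a\<close>, with uniform seed \<open>u\<close>.\<close>
definition np_test :: "'x pmf \<Rightarrow> ('x \<Rightarrow> real) \<Rightarrow> real \<Rightarrow> 'x \<Rightarrow> real \<Rightarrow> bool" where
  "np_test p S a x u \<longleftrightarrow> S x < quantile p S a \<or>
     S x = quantile p S a \<and>
     u * measure_pmf.prob p {x. S x = quantile p S a} \<le> a - measure_pmf.prob p {x. S x < quantile p S a}"

abbreviation seed :: "real measure" where
  "seed \<equiv> uniform_measure lborel {0..1}"

lemma prob_space_seed: "prob_space seed"
  by (rule prob_space_uniform_measure) auto

text \<open>The product form \<open>u * b \<le> r\<close> of the threshold \<open>r / b\<close> also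
  covers an atom of mass \<open>b = 0\<close>, where both sides vanish.\<close>

lemma emeasure_seed_threshold:
  assumes "0 \<le> r" "r \<le> b"
  shows "emeasure seed {u. u * b \<le> r} * ennreal b = ennreal r"
proof (cases "b = 0")
  case False
  then have b: "b > 0" using assms by simp
  have "emeasure seed {u. u * b \<le> r} = emeasure lborel ({0..1} \<inter> {u. u * b \<le> r}) / emeasure lborel {0..1::real}"
    by (rule emeasure_uniform_measure) auto
  also have "{0..1} \<inter> {u. u * b \<le> r} = {0..r / b}"
    using assms b by (auto simp: field_simps) (smt (verit) mult_less_cancel_right1)
  also have "emeasure lborel {0..r / b} / emeasure lborel {0..1::real} = ennreal (r / b)"
    using assms b divide_ennreal[of "r / b" 1] by simp
  finally show ?thesis using assms b by (simp add: ennreal_mult[symmetric])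
qed (use assms in simp)

text \<open>The second fact is complementary slackness. Below the threshold, cost and hinge add up
  to the quantile; at the threshold the hinge vanishes; above it neither contributes. Hence the
  total is the quantile times the power. A sum is stated because subtraction in
  \<open>ennreal\<close> truncates.\<close>

lemma np_test:
  fixes S :: "'x \<Rightarrow> real" and p :: "'x pmf"
  assumes a: "0 < a" "a < 1" and S: "\<And>x. 0 \<le> S x"
  shows "(\<integral>\<^sup>+x. (\<integral>\<^sup>+u. indicator {u. np_test p S a x u} u \<partial>seed) \<partial>p) = ennreal a"
    and "(\<integral>\<^sup>+x. (\<integral>\<^sup>+u. ennreal (S x) * indicator {u. np_test p S a x u} u \<partial>seed) \<partial>p)
       + (\<integral>\<^sup>+x. ennreal (max 0 (quantile p S a - S x)) \<partial>p) = ennreal (a * quantile p S a)"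
proof -
  let ?\<phi> = "\<lambda>x. {u. np_test p S a x u}"
  define q where "q = quantile p S a"
  define b where "b = measure_pmf.prob p {x. S x = q}"
  define c where "c = measure_pmf.prob p {x. S x < q}"
  define m where "m = emeasure seed {u. u * b \<le> a - c}"
  note Q = quantile[where S = S and p = p, OF a S, folded q_def]
  interpret U: prob_space seed by (rule prob_space_seed)
  have "{x. S x \<le> q} = {x. S x < q} \<union> {x. S x = q}" by auto
  then have "measure_pmf.prob p {x. S x \<le> q} = c + b"
    unfolding b_def c_def by (simp add: measure_pmf.finite_measure_Union disjoint_iff)
  \<comment> \<open>The quantile satisfies \<open>c \<le> a \<le> c + b\<close>, so the seed can
    accept exactly the missing mass \<open>a - c\<close> of the atom.\<close>
  then have m: "m * ennreal b = ennreal (a - c)"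
    unfolding m_def using Q(1,2) by (intro emeasure_seed_threshold) (auto simp: c_def)
  have ind: "(\<integral>\<^sup>+u. indicator (?\<phi> x) u \<partial>seed) = indicator {x. S x < q} x + m * indicator {x. S x = q} x" for x
  proof -
    consider "S x < q" | "S x = q" | "S x > q" by linarith
    then show ?thesis
    proof cases
      case 1
      then have "?\<phi> x = UNIV" by (auto simp: np_test_def q_def)
      then show ?thesis using 1 U.emeasure_space_1 by simp
    next
      case 2
      then have "?\<phi> x = {u. u * b \<le> a - c}"
        by (auto simp: np_test_def b_def c_def q_def)
      then show ?thesis using 2 by (simp add: m_def)
    next
      case 3
      then have "?\<phi> x = {}" by (auto simp: np_test_def q_def)
      then show ?thesis using 3 by simp
    qed
  qed
  have em: "emeasure (measure_pmf p) {x. S x = q} = ennreal b" "emeasure (measure_pmf p) {x. S x < q} = ennreal c"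
    by (simp_all add: b_def c_def measure_pmf.emeasure_eq_measure)
  have ca: "0 \<le> c" "c \<le> a" using Q(1) by (simp_all add: c_def)
  have "(\<integral>\<^sup>+x. (\<integral>\<^sup>+u. indicator (?\<phi> x) u \<partial>seed) \<partial>p) = ennreal c + m * ennreal b"
    unfolding ind by (simp add: nn_integral_add nn_integral_cmult em)
  also have "\<dots> = ennreal a" unfolding m using ca by (simp flip: ennreal_plus)
  finally show "(\<integral>\<^sup>+x. (\<integral>\<^sup>+u. indicator (?\<phi> x) u \<partial>seed) \<partial>p) = ennreal a" .
  have set: "?\<phi> x \<in> sets seed" for x
  proof -
    have "?\<phi> x = {u. u * b \<le> a - c} \<or> ?\<phi> x = UNIV \<or> ?\<phi> x = {}"
      by (auto simp: np_test_def b_def c_def q_def)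
    moreover have "{u. u * b \<le> a - c} \<in> sets borel" by measurable
    ultimately show ?thesis by (elim disjE ssubst) auto
  qed
  have "(\<integral>\<^sup>+x. (\<integral>\<^sup>+u. ennreal (S x) * indicator (?\<phi> x) u \<partial>seed) \<partial>p)
     = (\<integral>\<^sup>+x. ennreal (S x) * indicator {x. S x < q} x + ennreal q * m * indicator {x. S x = q} x \<partial>p)"
  proof (rule nn_integral_cong)
    fix x
    have "(\<integral>\<^sup>+u. ennreal (S x) * indicator (?\<phi> x) u \<partial>seed)
        = ennreal (S x) * (\<integral>\<^sup>+u. indicator (?\<phi> x) u \<partial>seed)"
      using set by (intro nn_integral_cmult) simp
    then show "(\<integral>\<^sup>+u. ennreal (S x) * indicator (?\<phi> x) u \<partial>seed)
      = ennreal (S x) * indicator {x. S x < q} x + ennreal q * m * indicator {x. S x = q} x"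
      unfolding ind by (auto simp: indicator_def distrib_left)
  qed
  also have "\<dots> = (\<integral>\<^sup>+x. ennreal (S x) * indicator {x. S x < q} x \<partial>p) + ennreal q * ennreal (a - c)"
    by (simp add: nn_integral_add nn_integral_cmult em mult.assoc m)
  finally have 1: "(\<integral>\<^sup>+x. (\<integral>\<^sup>+u. ennreal (S x) * indicator (?\<phi> x) u \<partial>seed) \<partial>p)
    = (\<integral>\<^sup>+x. ennreal (S x) * indicator {x. S x < q} x \<partial>p) + ennreal q * ennreal (a - c)" .
  have "(\<integral>\<^sup>+x. ennreal (S x) * indicator {x. S x < q} x \<partial>p)
      + (\<integral>\<^sup>+x. ennreal (max 0 (q - S x)) \<partial>p)
    = (\<integral>\<^sup>+x. ennreal (S x) * indicator {x. S x < q} x + ennreal (max 0 (q - S x)) \<partial>p)"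
    by (rule nn_integral_add[symmetric]) auto
  also have "\<dots> = (\<integral>\<^sup>+x. ennreal q * indicator {x. S x < q} x \<partial>p)"
    by (rule nn_integral_cong) (auto simp: indicator_def max_def S simp flip: ennreal_plus)
  also have "\<dots> = ennreal q * ennreal c" by (simp add: nn_integral_cmult em)
  finally have 2: "(\<integral>\<^sup>+x. ennreal (S x) * indicator {x. S x < q} x \<partial>p)
      + (\<integral>\<^sup>+x. ennreal (max 0 (q - S x)) \<partial>p) = ennreal q * ennreal c" .
  have "ennreal c + ennreal (a - c) = ennreal a" using ca by (simp flip: ennreal_plus)
  then have "ennreal q * ennreal c + ennreal q * ennreal (a - c) = ennreal (a * q)"
    using Q(4) a by (metis distrib_left ennreal_mult less_imp_le mult.commute)
  then show "(\<integral>\<^sup>+x. (\<integral>\<^sup>+u. ennreal (S x) * indicator (?\<phi> x) u \<partial>seed) \<partial>p)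
       + (\<integral>\<^sup>+x. ennreal (max 0 (quantile p S a - S x)) \<partial>p) = ennreal (a * quantile p S a)"
    unfolding 1 q_def[symmetric] by (metis (no_types, lifting) 2 add.assoc add.commute)
qed

section \<open>Discrete memoryless sources\<close>

lemma nn_integral_pmf_count_space:
  assumes "set_pmf p \<subseteq> I"
  shows "(\<integral>\<^sup>+x. f x \<partial>p) = (\<integral>\<^sup>+x. ennreal (pmf p x) * f x \<partial>count_space I)"
  unfolding nn_integral_measure_pmf
  using assms by (intro nn_integral_count_space_eq) (auto simp: set_pmf_eq)

text \<open>Integration against a varying \<open>pmf\<close> becomes integration of a density
  against one fixed counting measure, which is sigma-finite for countable \<open>I\<close>. The set
  \<open>I\<close> is a parameter because \<open>blocks n\<close> is countable but its ambient
  function type is not.\<close>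

lemma borel_measurable_nn_integral_pmf:
  assumes I: "countable I" and set: "\<And>z. z \<in> space R \<Longrightarrow> set_pmf (\<kappa> z) \<subseteq> I"
    and [measurable]: "\<And>x. x \<in> I \<Longrightarrow> (\<lambda>z. pmf (\<kappa> z) x) \<in> borel_measurable R"
    and [measurable]: "\<And>x. x \<in> I \<Longrightarrow> f x \<in> borel_measurable R"
  shows "(\<lambda>z. \<integral>\<^sup>+x. f x z \<partial>\<kappa> z) \<in> borel_measurable R"
proof -
  interpret C: sigma_finite_measure "count_space I"
    by (rule sigma_finite_measure_count_space_countable[OF I])
  have "(\<lambda>(x, z). ennreal (pmf (\<kappa> z) x) * f x z) \<in> borel_measurable (count_space I \<Otimes>\<^sub>M R)"
    using I by (rule measurable_pair_measure_countable1) simp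
  from measurable_pair_swap[OF this]
  have "(\<lambda>z. \<integral>\<^sup>+x. ennreal (pmf (\<kappa> z) x) * f x z \<partial>count_space I) \<in> borel_measurable R"
    by (intro C.borel_measurable_nn_integral) (simp add: case_prod_beta')
  then show ?thesis
    by (rule measurable_cong[THEN iffD1, rotated]) (simp add: nn_integral_pmf_count_space[OF set])
qed

lemma nn_integral_density_pmf:
  assumes I: "countable I" and set: "\<And>z. z \<in> space R \<Longrightarrow> set_pmf (\<kappa> z) \<subseteq> I"
    and R: "sigma_finite_measure R"
    and [measurable]: "\<And>x. x \<in> I \<Longrightarrow> (\<lambda>z. pmf (\<kappa> z) x) \<in> borel_measurable R"
    and f: "f \<in> borel_measurable (count_space I \<Otimes>\<^sub>M R)"
  shows "(\<integral>\<^sup>+\<omega>. f \<omega> \<partial>density (count_space I \<Otimes>\<^sub>M R) (\<lambda>(x, z). ennreal (pmf (\<kappa> z) x)))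
    = (\<integral>\<^sup>+z. \<integral>\<^sup>+x. f (x, z) \<partial>\<kappa> z \<partial>R)"
proof -
  interpret pair_sigma_finite "count_space I" R
    by (intro pair_sigma_finite.intro sigma_finite_measure_count_space_countable I R)
  have [measurable]: "(\<lambda>(x, z). ennreal (pmf (\<kappa> z) x)) \<in> borel_measurable (count_space I \<Otimes>\<^sub>M R)"
    using I by (rule measurable_pair_measure_countable1) simp
  note f[measurable]
  have "(\<integral>\<^sup>+\<omega>. f \<omega> \<partial>density (count_space I \<Otimes>\<^sub>M R) (\<lambda>(x, z). ennreal (pmf (\<kappa> z) x)))
    = (\<integral>\<^sup>+\<omega>. (case \<omega> of (x, z) \<Rightarrow> ennreal (pmf (\<kappa> z) x)) * f \<omega> \<partial>(count_space I \<Otimes>\<^sub>M R))"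
    by (rule nn_integral_density) measurable
  also have "\<dots> = (\<integral>\<^sup>+z. \<integral>\<^sup>+x. ennreal (pmf (\<kappa> z) x) * f (x, z) \<partial>count_space I \<partial>R)"
    using nn_integral_snd[of "\<lambda>\<omega>. (case \<omega> of (x, z) \<Rightarrow> ennreal (pmf (\<kappa> z) x)) * f \<omega>"] by simp
  also have "\<dots> = (\<integral>\<^sup>+z. \<integral>\<^sup>+x. f (x, z) \<partial>\<kappa> z \<partial>R)"
    by (intro nn_integral_cong) (simp add: nn_integral_pmf_count_space[OF set])
  finally show ?thesis .
qed

definition joint :: "'y measure \<Rightarrow> ('y \<Rightarrow> nat pmf) \<Rightarrow> (nat \<times> 'y) measure" where
  "joint P K = density (count_space UNIV \<Otimes>\<^sub>M P) (\<lambda>(x, y). ennreal (pmf (K y) x))"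

text \<open>The default \<open>undefined\<close> outside the index set makes the support consist of
  extensional functions, as in \<open>PiM\<close>.\<close>

definition block_pmf :: "nat \<Rightarrow> ('y \<Rightarrow> nat pmf) \<Rightarrow> (nat \<Rightarrow> 'y) \<Rightarrow> (nat \<Rightarrow> nat) pmf" where
  "block_pmf n K y = Pi_pmf {..<n} undefined (\<lambda>i. K (y i))"

definition zip_block :: "nat \<Rightarrow> (nat \<Rightarrow> nat) \<Rightarrow> (nat \<Rightarrow> 'y) \<Rightarrow> nat \<Rightarrow> nat \<times> 'y" where
  "zip_block n x y = (\<lambda>i\<in>{..<n}. (x i, y i))"

abbreviation blocks :: "nat \<Rightarrow> (nat \<Rightarrow> nat) set" where
  "blocks n \<equiv> {..<n} \<rightarrow>\<^sub>E UNIV"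

lemma countable_blocks: "countable (blocks n)"
  by (intro countable_PiE) auto

lemma set_block_pmf: "set_pmf (block_pmf n K y) \<subseteq> blocks n"
  using set_Pi_pmf_subset[of "{..<n}" undefined "\<lambda>i. K (y i)"] unfolding block_pmf_def by fastforce

lemma pmf_block_pmf: "x \<in> blocks n \<Longrightarrow> pmf (block_pmf n K y) x = (\<Prod>i<n. pmf (K (y i)) (x i))"
  unfolding block_pmf_def by (rule pmf_Pi') (auto simp: PiE_def extensional_def)

locale source = prob_space P for P :: "'y measure" +
  fixes K :: "'y \<Rightarrow> nat pmf"
  assumes measurable_K [measurable]: "\<And>x. (\<lambda>y. pmf (K y) x) \<in> borel_measurable P"
begin

lemma nn_integral_joint:
  assumes "f \<in> borel_measurable (count_space UNIV \<Otimes>\<^sub>M P)"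
  shows "(\<integral>\<^sup>+\<omega>. f \<omega> \<partial>joint P K) = (\<integral>\<^sup>+y. \<integral>\<^sup>+x. f (x, y) \<partial>K y \<partial>P)"
  unfolding joint_def using assms
  by (intro nn_integral_density_pmf) (auto intro: sigma_finite_measure_axioms)

lemma sets_joint [measurable_cong]: "sets (joint P K) = sets (count_space UNIV \<Otimes>\<^sub>M P)"
  by (simp add: joint_def)

lemma prob_space_joint: "prob_space (joint P K)"
proof
  have "emeasure (joint P K) (space (joint P K)) = (\<integral>\<^sup>+\<omega>. 1 \<partial>joint P K)" by simp
  also have "\<dots> = (\<integral>\<^sup>+y. \<integral>\<^sup>+x. 1 \<partial>K y \<partial>P)" by (rule nn_integral_joint) simp
  finally show "emeasure (joint P K) (space (joint P K)) = 1"
    by (simp add: emeasure_space_1 measure_pmf.emeasure_space_1[simplified])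
qed

abbreviation "BP n y \<equiv> measure_pmf (block_pmf n K y)"
abbreviation "PN (n :: nat) \<equiv> PiM {..<n} (\<lambda>_. P)"
abbreviation "JN (n :: nat) \<equiv> PiM {..<n} (\<lambda>_. joint P K)"

abbreviation "DN n \<equiv> density (count_space (blocks n) \<Otimes>\<^sub>M PN n) (\<lambda>(x, y). ennreal (pmf (block_pmf n K y) x))"

lemma prob_space_PN: "prob_space (PN n)"
  by (intro prob_space_PiM prob_space_axioms)

lemma prob_space_JN: "prob_space (JN n)"
  by (intro prob_space_PiM prob_space_joint)

lemma measurable_block_pmf [measurable]:
  "(\<lambda>y. pmf (block_pmf n K y) x) \<in> borel_measurable (PN n)"
proof (cases "x \<in> blocks n")
  case True
  then show ?thesis by (simp add: pmf_block_pmf)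
next
  case False
  then have "pmf (block_pmf n K y) x = 0" for y
    using set_block_pmf[of n K y] by (auto simp: set_pmf_eq)
  then show ?thesis by simp
qed

lemma measurable_zip_block:
  "(\<lambda>(x, y). zip_block n x y) \<in> count_space (blocks n) \<Otimes>\<^sub>M PN n \<rightarrow>\<^sub>M JN n"
proof (rule measurable_pair_measure_countable1[OF countable_blocks])
  fix x assume "x \<in> blocks n"
  show "(\<lambda>y. case (x, y) of (x, y) \<Rightarrow> zip_block n x y) \<in> PN n \<rightarrow>\<^sub>M JN n"
    unfolding zip_block_def prod.case by measurable
qed

lemma measurable_zip_block' [measurable]: "(\<lambda>y. zip_block n x y) \<in> PN n \<rightarrow>\<^sub>M JN n"
  unfolding zip_block_def by measurable

text \<open>Independent pairs can be sampled by drawing all side information first and then the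
  block from the conditional product law. Boxes determine the product measure, and on a box both
  sides factorise over the coordinates.\<close>

lemma JN_eq:
  "JN n = distr (DN n)
     (JN n) (\<lambda>(x, y). zip_block n x y)" (is "_ = ?R")
proof -
  interpret J: prob_space "joint P K" by (rule prob_space_joint)
  interpret Js: product_sigma_finite "\<lambda>_::nat. joint P K"
    by standard
  interpret Ps: product_sigma_finite "\<lambda>_::nat. P"
    by standard
  interpret PN: prob_space "PN n" by (rule prob_space_PN)
  have "?R = JN n"
  proof (rule Js.PiM_eqI)
    fix A assume A: "\<And>i. i \<in> {..<n} \<Longrightarrow> A i \<in> sets (joint P K)"
    have box [measurable]: "PiE {..<n} A \<in> sets (JN n)" using A by (intro sets_PiM_I_finite) auto
    note measurable_zip_block[measurable]
    have Am: "(\<lambda>y. indicator (A i) (x, y) :: ennreal) \<in> borel_measurable P" if "i < n" for i x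
    proof -
      have [measurable]: "A i \<in> sets (count_space UNIV \<Otimes>\<^sub>M P)"
        using A that by (simp add: sets_joint)
      show ?thesis by measurable
    qed
    have "emeasure ?R (PiE {..<n} A) = (\<integral>\<^sup>+\<omega>. indicator (PiE {..<n} A) \<omega> \<partial>?R)" by simp
    also have "\<dots> = (\<integral>\<^sup>+\<omega>. indicator (PiE {..<n} A) (case \<omega> of (x, y) \<Rightarrow> zip_block n x y)
       \<partial>DN n)"
      by (rule nn_integral_distr) measurable
    also have "\<dots> = (\<integral>\<^sup>+y. \<integral>\<^sup>+x. indicator (PiE {..<n} A) (zip_block n x y) \<partial>BP n y \<partial>PN n)"
      by (subst nn_integral_density_pmf[OF countable_blocks set_block_pmf PN.sigma_finite_measure_axioms])
        (auto simp: set_block_pmf)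
    also have "\<dots> = (\<integral>\<^sup>+y. \<integral>\<^sup>+x. (\<Prod>i<n. indicator (A i) (x i, y i)) \<partial>BP n y \<partial>PN n)"
    proof (intro nn_integral_cong)
      fix x :: "nat \<Rightarrow> nat" and y :: "nat \<Rightarrow> 'y"
      show "indicator (PiE {..<n} A) (zip_block n x y) = (\<Prod>i<n. indicator (A i) (x i, y i) :: ennreal)"
      proof (cases "\<forall>i<n. (x i, y i) \<in> A i")
        case False
        then have "(\<Prod>i<n. indicator (A i) (x i, y i) :: ennreal) = 0"
          by (intro prod_zero) (auto simp: indicator_def)
        then show ?thesis using False by (auto simp: zip_block_def PiE_iff indicator_def)
      qed (auto simp: zip_block_def PiE_iff)
    qed
    also have "\<dots> = (\<integral>\<^sup>+y. (\<Prod>i<n. \<integral>\<^sup>+x. indicator (A i) (x, y i) \<partial>K (y i)) \<partial>PN n)"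
      unfolding block_pmf_def
      by (intro nn_integral_cong nn_integral_prod_Pi_pmf[where f = "\<lambda>i x. indicator (A i) (x, _ i)"]) simp
    also have "\<dots> = (\<Prod>i<n. \<integral>\<^sup>+y. \<integral>\<^sup>+x. indicator (A i) (x, y) \<partial>K y \<partial>P)"
      by (intro Ps.product_nn_integral_prod[where f = "\<lambda>i y. \<integral>\<^sup>+x. indicator (A i) (x, y) \<partial>K y"]
         borel_measurable_nn_integral_pmf[of UNIV]) (auto intro!: Am)
    also have "\<dots> = (\<Prod>i<n. emeasure (joint P K) (A i))"
      using A by (intro prod.cong refl) (subst nn_integral_joint[symmetric], auto)
    finally show "emeasure ?R (PiE {..<n} A) = (\<Prod>i<n. emeasure (joint P K) (A i))" .
  qed auto
  then show ?thesis by simp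
qed

lemma nn_integral_JN:
  assumes [measurable]: "f \<in> borel_measurable (JN n)"
  shows "(\<integral>\<^sup>+\<omega>. f \<omega> \<partial>JN n) = (\<integral>\<^sup>+y. \<integral>\<^sup>+x. f (zip_block n x y) \<partial>BP n y \<partial>PN n)"
proof -
  interpret PN: prob_space "PN n" by (rule prob_space_PN)
  note measurable_zip_block[measurable]
  have "(\<integral>\<^sup>+\<omega>. f \<omega> \<partial>JN n) = (\<integral>\<^sup>+\<omega>. f (case \<omega> of (x, y) \<Rightarrow> zip_block n x y)
       \<partial>DN n)"
    by (subst JN_eq, rule nn_integral_distr) measurable
  also have "\<dots> = (\<integral>\<^sup>+y. \<integral>\<^sup>+x. f (zip_block n x y) \<partial>BP n y \<partial>PN n)"
    by (subst nn_integral_density_pmf[OF countable_blocks set_block_pmf PN.sigma_finite_measure_axioms])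
      (auto simp: set_block_pmf)
  finally show ?thesis .
qed

lemma measurable_block_integral:
  assumes "\<And>x. x \<in> blocks n \<Longrightarrow> f x \<in> borel_measurable (PN n)"
  shows "(\<lambda>y. \<integral>\<^sup>+x. f x y \<partial>BP n y) \<in> borel_measurable (PN n)"
  using assms by (intro borel_measurable_nn_integral_pmf[OF countable_blocks set_block_pmf]) auto

abbreviation "QN n \<equiv> JN n \<Otimes>\<^sub>M seed"

lemma prob_space_QN: "prob_space (QN n)"
proof -
  interpret J: prob_space "JN n" by (rule prob_space_JN)
  interpret U: prob_space seed by (rule prob_space_seed)
  interpret pair_prob_space "JN n" seed ..
  show ?thesis by (rule prob_space_axioms)
qed

text \<open>With the seed outermost a code becomes deterministic, as the converse wants; with the
  seed innermost the randomised test is averaged for given side information, as the achievability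
  wants.\<close>

lemma nn_integral_QN:
  assumes f [measurable]: "f \<in> borel_measurable (QN n)"
  shows "(\<integral>\<^sup>+z. f z \<partial>QN n) =
      (\<integral>\<^sup>+u. \<integral>\<^sup>+y. \<integral>\<^sup>+x. f (zip_block n x y, u) \<partial>BP n y \<partial>PN n \<partial>seed)"
    and "(\<integral>\<^sup>+z. f z \<partial>QN n) =
      (\<integral>\<^sup>+y. \<integral>\<^sup>+x. \<integral>\<^sup>+u. f (zip_block n x y, u) \<partial>seed \<partial>BP n y \<partial>PN n)"
proof -
  interpret J: prob_space "JN n" by (rule prob_space_JN)
  interpret U: prob_space seed by (rule prob_space_seed)
  interpret pair_sigma_finite "JN n" seed ..
  have "(\<integral>\<^sup>+z. f z \<partial>QN n) = (\<integral>\<^sup>+u. \<integral>\<^sup>+\<omega>. f (\<omega>, u) \<partial>JN n \<partial>seed)"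
    by (rule nn_integral_snd[symmetric]) measurable
  also have "\<dots> = (\<integral>\<^sup>+u. \<integral>\<^sup>+y. \<integral>\<^sup>+x. f (zip_block n x y, u) \<partial>BP n y \<partial>PN n \<partial>seed)"
  proof (rule nn_integral_cong)
    fix u assume "u \<in> space seed"
    then have "(\<lambda>\<omega>. f (\<omega>, u)) \<in> borel_measurable (JN n)" by measurable
    then show "(\<integral>\<^sup>+\<omega>. f (\<omega>, u) \<partial>JN n) =
        (\<integral>\<^sup>+y. \<integral>\<^sup>+x. f (zip_block n x y, u) \<partial>BP n y \<partial>PN n)"
      by (rule nn_integral_JN)
  qed
  finally show "(\<integral>\<^sup>+z. f z \<partial>QN n) =
      (\<integral>\<^sup>+u. \<integral>\<^sup>+y. \<integral>\<^sup>+x. f (zip_block n x y, u) \<partial>BP n y \<partial>PN n \<partial>seed)" .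
  have "(\<integral>\<^sup>+z. f z \<partial>QN n) = (\<integral>\<^sup>+\<omega>. \<integral>\<^sup>+u. f (\<omega>, u) \<partial>seed \<partial>JN n)"
    by (rule U.nn_integral_fst[symmetric]) measurable
  also have "\<dots> = (\<integral>\<^sup>+y. \<integral>\<^sup>+x. \<integral>\<^sup>+u. f (zip_block n x y, u) \<partial>seed \<partial>BP n y \<partial>PN n)"
    by (rule nn_integral_JN) measurable
  finally show "(\<integral>\<^sup>+z. f z \<partial>QN n) =
      (\<integral>\<^sup>+y. \<integral>\<^sup>+x. \<integral>\<^sup>+u. f (zip_block n x y, u) \<partial>seed \<partial>BP n y \<partial>PN n)" .
qed

end

section \<open>Information, entropy and conditional variance of a block\<close>

lemma good_pmf_nn_integral_info:
  assumes "good_pmf c C p"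
  shows "(\<integral>\<^sup>+x. ennreal (info p x) \<partial>p) = ennreal (ent p)"
  unfolding ent_def using assms
  by (intro nn_integral_eq_integral) (auto simp: good_pmf_def info_nonneg)

lemma good_pmf_varent_le:
  assumes "good_pmf c C p" "0 \<le> C"
  shows "varent p \<le> 1 + C"
  unfolding varent_def using assms by (intro cube_moment) (auto simp: good_pmf_def)

lemma good_pmf_nn_integral_square:
  assumes "good_pmf c C p" "0 \<le> C"
  shows "(\<integral>\<^sup>+x. ennreal ((info p x - ent p)\<^sup>2) \<partial>p) = ennreal (varent p)"
  unfolding varent_def using assms
  by (intro nn_integral_eq_integral cube_moment(2)) (auto simp: good_pmf_def)

context source begin

lemma measurable_info [measurable]: "(\<lambda>y. info (K y) x) \<in> borel_measurable P"
  unfolding info_def by measurable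

end

text \<open>The bounds are required for every \<open>y\<close>, so that no exceptional set has to be
  carried through the products; a kernel that is good only almost everywhere is repaired
  beforehand.\<close>

locale good_source = source P K for P :: "'y measure" and K +
  fixes c C :: real
  assumes c: "0 < c" and C: "0 \<le> C" and good: "\<And>y. good_pmf c C (K y)"
    and integrable_ent: "integrable P (\<lambda>y. ent (K y))"
begin

definition "H = expectation (\<lambda>y. ent (K y))"
definition "Vc = expectation (\<lambda>y. varent (K y))"

lemma measurable_ent [measurable]: "(\<lambda>y. ent (K y)) \<in> borel_measurable P"
  using integrable_ent by simp

lemma measurable_varent [measurable]: "(\<lambda>y. varent (K y)) \<in> borel_measurable P"
proof -
  have [measurable]: "(\<lambda>y. \<integral>\<^sup>+x. ennreal ((info (K y) x - ent (K y))\<^sup>2) \<partial>K y) \<in> borel_measurable P"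
    by (intro borel_measurable_nn_integral_pmf[of UNIV]) auto
  have "(\<lambda>y. enn2real (\<integral>\<^sup>+x. ennreal ((info (K y) x - ent (K y))\<^sup>2) \<partial>K y)) \<in> borel_measurable P"
    by measurable
  then show ?thesis by (simp add: good_pmf_nn_integral_square[OF good C] varent_nonneg)
qed

lemma varent_bounds: "c \<le> varent (K y)" "0 \<le> varent (K y)" "varent (K y) \<le> 1 + C"
  using good[of y] good_pmf_varent_le[OF good C] by (auto simp: good_pmf_def varent_nonneg)

lemma integrable_varent: "integrable P (\<lambda>y. varent (K y))"
  by (rule integrable_const_bound[where B = "1 + C"]) (use varent_bounds in auto)

lemma Vc_bounds: "c \<le> Vc" "Vc \<le> 1 + C"
  unfolding Vc_def using integrable_varent varent_bounds
  by (auto intro!: integral_ge_const integral_le_const)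

lemma H_nonneg: "0 \<le> H"
  unfolding H_def by (intro integral_nonneg_AE) (simp add: ent_nonneg)

lemma PN_component:
  fixes f :: "'y \<Rightarrow> real"
  assumes "i < n" and f: "integrable P f"
  shows "integrable (PN n) (\<lambda>y. f (y i))" "integral\<^sup>L (PN n) (\<lambda>y. f (y i)) = expectation f"
proof -
  interpret pps: product_prob_space "\<lambda>_::nat. P" "{..<n}" ..
  have d: "distr (PN n) P (\<lambda>y. y i) = P" using assms(1) by (intro pps.PiM_component) simp
  have [measurable]: "(\<lambda>y. y i) \<in> PN n \<rightarrow>\<^sub>M P" using assms(1) by (intro measurable_component_singleton) simp
  have [measurable]: "f \<in> borel_measurable P" using f by simp
  show "integrable (PN n) (\<lambda>y. f (y i))"
    using f integrable_distr_eq[of "\<lambda>y. y i" "PN n" P f] by (simp add: d)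
  show "integral\<^sup>L (PN n) (\<lambda>y. f (y i)) = expectation f"
    using integral_distr[of "\<lambda>y. y i" "PN n" P f] by (simp add: d)
qed

text \<open>The integrand is a product over all coordinates, with \<open>f\<close> at
  \<open>i\<close> and \<open>j\<close> and 1 elsewhere, so the integral factorises and the factor
  at \<open>i\<close> is zero.\<close>

lemma PN_uncorrelated:
  fixes f :: "'y \<Rightarrow> real"
  assumes "i < n" "j < n" "i \<noteq> j" and f: "integrable P f" "expectation f = 0"
  shows "integral\<^sup>L (PN n) (\<lambda>y. f (y i) * f (y j)) = 0"
proof -
  interpret Ps: product_sigma_finite "\<lambda>_::nat. P" by standard
  have "f (y i) * f (y j) = (\<Prod>k<n. (if k = i \<or> k = j then f else (\<lambda>_. 1)) (y k))" for y
  proof -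
    have "(\<Prod>k<n. (if k = i \<or> k = j then f else (\<lambda>_. 1)) (y k)) = (\<Prod>k\<in>{i, j}. f (y k))"
      using assms(1,2) by (intro prod.mono_neutral_cong_right) (auto simp del: finite_lessThan intro: finite_lessThan)
    then show ?thesis using assms(3) by simp
  qed
  then have "integral\<^sup>L (PN n) (\<lambda>y. f (y i) * f (y j))
     = (\<Prod>k<n. expectation (if k = i \<or> k = j then f else (\<lambda>_. 1)))"
    using f by (simp, subst Ps.product_integral_prod) auto
  also have "\<dots> = 0" using assms by (intro prod_zero) auto
  finally show ?thesis .
qed

definition block_info :: "nat \<Rightarrow> (nat \<Rightarrow> nat) \<Rightarrow> (nat \<Rightarrow> 'y) \<Rightarrow> real" where
  "block_info n x y = (\<Sum>i<n. info (K (y i)) (x i))"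

definition block_ent :: "nat \<Rightarrow> (nat \<Rightarrow> 'y) \<Rightarrow> real" where
  "block_ent n y = (\<Sum>i<n. ent (K (y i)))"

text \<open>The summand \<open>1\<close> is the variance of the Gaussian that regularises the hinge function.\<close>
definition block_var :: "nat \<Rightarrow> (nat \<Rightarrow> 'y) \<Rightarrow> real" where
  "block_var n y = 1 + (\<Sum>i<n. varent (K (y i)))"

lemma measurable_block_info [measurable]: "(\<lambda>y. block_info n x y) \<in> borel_measurable (PN n)"
  unfolding block_info_def by measurable

lemma measurable_block_ent [measurable]: "block_ent n \<in> borel_measurable (PN n)"
  unfolding block_ent_def by measurable

lemma measurable_block_var [measurable]: "block_var n \<in> borel_measurable (PN n)"
  unfolding block_var_def by measurable

lemma block_info_nonneg: "0 \<le> block_info n x y"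
  unfolding block_info_def by (intro sum_nonneg info_nonneg)

lemma block_ent_nonneg: "0 \<le> block_ent n y"
  unfolding block_ent_def by (intro sum_nonneg ent_nonneg)

lemma block_var_bounds: "1 \<le> block_var n y" "block_var n y \<le> 1 + n * (1 + C)"
proof -
  show "1 \<le> block_var n y" unfolding block_var_def using varent_bounds by (simp add: sum_nonneg)
  have "(\<Sum>i<n. varent (K (y i))) \<le> (\<Sum>i<n. 1 + C)" by (intro sum_mono varent_bounds)
  then show "block_var n y \<le> 1 + n * (1 + C)" by (simp add: block_var_def)
qed

text \<open>A positive product has only positive factors, so the logarithm turns it into a
  sum.\<close>

lemma block_info_eq:
  assumes "x \<in> blocks n" "0 < pmf (block_pmf n K y) x"
  shows "block_info n x y = log 2 (1 / pmf (block_pmf n K y) x)"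
proof -
  have pos: "0 < pmf (K (y i)) (x i)" if "i < n" for i
  proof (rule ccontr)
    assume "\<not> ?thesis"
    then have "pmf (K (y i)) (x i) = 0" using pmf_nonneg[of "K (y i)" "x i"] by linarith
    then have "pmf (block_pmf n K y) x = 0"
      unfolding pmf_block_pmf[OF assms(1)] using that by (intro prod_zero) auto
    then show False using assms(2) by simp
  qed
  have "log 2 (\<Prod>i<n. pmf (K (y i)) (x i)) = (\<Sum>i<n. log 2 (pmf (K (y i)) (x i)))"
  proof -
    have "ln (\<Prod>i<n. pmf (K (y i)) (x i)) = (\<Sum>i<n. ln (pmf (K (y i)) (x i)))"
      using pos by (intro ln_prod) (force dest: pos)+
    then show ?thesis by (simp only: log_def sum_divide_distrib)
  qed
  moreover have "log 2 (1 / pmf (K (y i)) (x i)) = - log 2 (pmf (K (y i)) (x i))" if "i < n" for i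
    using pos[OF that] by (simp add: log_divide)
  moreover have "log 2 (1 / (\<Prod>i<n. pmf (K (y i)) (x i))) = - log 2 (\<Prod>i<n. pmf (K (y i)) (x i))"
    unfolding pmf_block_pmf[OF assms(1), symmetric] using assms(2) by (simp add: log_divide)
  ultimately show ?thesis
    unfolding block_info_def info_def pmf_block_pmf[OF assms(1)] by (simp add: sum_negf)
qed

lemma integrable_block_ent: "integrable (PN n) (block_ent n)"
  and integral_block_ent: "integral\<^sup>L (PN n) (block_ent n) = n * H"
proof -
  have i: "integrable (PN n) (\<lambda>y. ent (K (y i)))"
    and e: "integral\<^sup>L (PN n) (\<lambda>y. ent (K (y i))) = H" if "i < n" for i
    using PN_component[OF that integrable_ent] by (simp_all add: H_def)
  show "integrable (PN n) (block_ent n)"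
    unfolding block_ent_def[abs_def] by (intro Bochner_Integration.integrable_sum i) auto
  show "integral\<^sup>L (PN n) (block_ent n) = n * H"
    unfolding block_ent_def[abs_def] by (subst Bochner_Integration.integral_sum) (auto simp: i e)
qed

text \<open>In the expanded square the mixed terms vanish by independence, and each of the
  \<open>n\<close> diagonal terms is at most \<open>(1 + C)\<^sup>2\<close>. A variance of order
  \<open>n\<close> is what makes the fluctuation of \<open>sqrt (block_var n y)\<close> cost only a
  constant.\<close>

lemma integrable_block_var: "integrable (PN n) (block_var n)"
  and integral_block_var: "integral\<^sup>L (PN n) (block_var n) = 1 + n * Vc"
  and variance_block_var: "integral\<^sup>L (PN n) (\<lambda>y. (block_var n y - (1 + n * Vc))\<^sup>2) \<le> n * (1 + C)\<^sup>2"
  and integrable_variance_block_var: "integrable (PN n) (\<lambda>y. (block_var n y - (1 + n * Vc))\<^sup>2)"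
proof -
  interpret PN: prob_space "PN n" by (rule prob_space_PN)
  have i: "integrable (PN n) (\<lambda>y. varent (K (y i)))"
    and e: "integral\<^sup>L (PN n) (\<lambda>y. varent (K (y i))) = Vc" if "i < n" for i
    using PN_component[OF that integrable_varent] by (simp_all add: Vc_def)
  show "integrable (PN n) (block_var n)"
    unfolding block_var_def[abs_def]
    by (intro Bochner_Integration.integrable_add Bochner_Integration.integrable_sum i) auto
  have int_sum: "integrable (PN n) (\<lambda>y. \<Sum>i<n. varent (K (y i)))"
    by (intro Bochner_Integration.integrable_sum i) auto
  have "integral\<^sup>L (PN n) (block_var n) = 1 + (\<Sum>i<n. integral\<^sup>L (PN n) (\<lambda>y. varent (K (y i))))"
    unfolding block_var_def[abs_def] using int_sum i
    by (simp add: Bochner_Integration.integral_sum PN.prob_space)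
  then show "integral\<^sup>L (PN n) (block_var n) = 1 + n * Vc" by (simp add: e)
  define a where "a = (\<lambda>y. varent (K y) - Vc)"
  have a_le: "\<bar>a y\<bar> \<le> 1 + C" for y
    using varent_bounds[of y] Vc_bounds c by (auto simp: a_def abs_if)
  have [measurable]: "a \<in> borel_measurable P" unfolding a_def by measurable
  have a: "integrable P a" "expectation a = 0"
    unfolding a_def using integrable_varent by (auto simp: Vc_def prob_space)
  have aa: "\<bar>a y * a y'\<bar> \<le> (1 + C)\<^sup>2" for y y'
    unfolding abs_mult power2_eq_square using C by (intro mult_mono a_le) auto
  have iaa: "integrable (PN n) (\<lambda>y. a (y i) * a (y j))" if "i < n" "j < n" for i j
    by (rule PN.integrable_const_bound[where B = "(1 + C)\<^sup>2"]) (use aa that in auto)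
  have eq: "(block_var n y - (1 + n * Vc))\<^sup>2 = (\<Sum>i<n. \<Sum>j<n. a (y i) * a (y j))" for y
  proof -
    have "block_var n y - (1 + n * Vc) = (\<Sum>i<n. a (y i))"
      by (simp add: block_var_def a_def sum_subtractf)
    then show ?thesis by (simp add: power2_eq_square sum_product)
  qed
  show "integrable (PN n) (\<lambda>y. (block_var n y - (1 + n * Vc))\<^sup>2)"
    unfolding eq by (intro Bochner_Integration.integrable_sum iaa) auto
  have "integral\<^sup>L (PN n) (\<lambda>y. (block_var n y - (1 + n * Vc))\<^sup>2)
      = (\<Sum>i<n. \<Sum>j<n. integral\<^sup>L (PN n) (\<lambda>y. a (y i) * a (y j)))"
  proof -
    have "integrable (PN n) (\<lambda>y. \<Sum>j<n. a (y i) * a (y j))" if "i < n" for i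
      using that by (intro Bochner_Integration.integrable_sum iaa) auto
    moreover have "integral\<^sup>L (PN n) (\<lambda>y. \<Sum>j<n. a (y i) * a (y j))
        = (\<Sum>j<n. integral\<^sup>L (PN n) (\<lambda>y. a (y i) * a (y j)))" if "i < n" for i
      using that by (intro Bochner_Integration.integral_sum iaa) auto
    ultimately show ?thesis
      unfolding eq by (subst Bochner_Integration.integral_sum) auto
  qed
  also have "\<dots> \<le> (\<Sum>i<n. \<Sum>j<n. if i = j then (1 + C)\<^sup>2 else 0)"
  proof (intro sum_mono)
    fix i j assume ij: "i \<in> {..<n}" "j \<in> {..<n}"
    show "integral\<^sup>L (PN n) (\<lambda>y. a (y i) * a (y j)) \<le> (if i = j then (1 + C)\<^sup>2 else 0)"
    proof (cases "i = j")
      case True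
      have "a (y i) * a (y j) \<le> (1 + C)\<^sup>2" for y using aa[of "y i" "y j"] by linarith
      then have "integral\<^sup>L (PN n) (\<lambda>y. a (y i) * a (y j)) \<le> (1 + C)\<^sup>2"
        using ij by (intro PN.integral_le_const iaa) auto
      then show ?thesis using True by simp
    next
      case False
      then show ?thesis using ij PN_uncorrelated[of i n j a] a by simp
    qed
  qed
  also have "\<dots> = n * (1 + C)\<^sup>2" by simp
  finally show "integral\<^sup>L (PN n) (\<lambda>y. (block_var n y - (1 + n * Vc))\<^sup>2) \<le> n * (1 + C)\<^sup>2" .
qed

lemma integrable_sqrt_block_var: "integrable (PN n) (\<lambda>y. sqrt (block_var n y))"
proof -
  interpret PN: prob_space "PN n" by (rule prob_space_PN)
  show ?thesis
  proof (rule PN.integrable_const_bound[where B = "sqrt (1 + n * (1 + C))"])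
    show "AE y in PN n. norm (sqrt (block_var n y)) \<le> sqrt (1 + n * (1 + C))"
      using block_var_bounds C by (auto intro!: AE_I2 simp: abs_of_nonneg order_trans[OF zero_le_one])
  qed simp
qed

text \<open>Jensen's inequality, carried out with the tangent of the square root at the mean
  \<open>m\<close>.\<close>

lemma integral_sqrt_block_var_le:
  "integral\<^sup>L (PN n) (\<lambda>y. sqrt (block_var n y)) \<le> sqrt (n * Vc) + 1"
proof -
  interpret PN: prob_space "PN n" by (rule prob_space_PN)
  define m where "m = 1 + n * Vc"
  have V0: "0 < Vc" using Vc_bounds c by linarith
  then have m: "m > 0" by (simp add: m_def add_pos_nonneg)
  have "sqrt v \<le> (v + m) / (2 * sqrt m)" if "v \<ge> 0" for v
  proof -
    have "0 \<le> (sqrt v - sqrt m)\<^sup>2" by simp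
    also have "\<dots> = v + m - sqrt v * (2 * sqrt m)" using that m by (simp add: power2_diff)
    finally show ?thesis using m by (simp add: field_simps)
  qed
  then have "integral\<^sup>L (PN n) (\<lambda>y. sqrt (block_var n y)) \<le> integral\<^sup>L (PN n) (\<lambda>y. (block_var n y + m) / (2 * sqrt m))"
    using block_var_bounds(1)[of n] integrable_block_var[of n] integrable_sqrt_block_var[of n]
    by (intro integral_mono) (auto intro: order_trans[OF zero_le_one])
  also have "\<dots> = (m + m) / (2 * sqrt m)"
    using integrable_block_var[of n] by (simp add: integral_block_var PN.prob_space m_def)
  also have "\<dots> = sqrt m" using m by (simp add: real_div_sqrt)
  also have "\<dots> \<le> sqrt (n * Vc) + sqrt 1"
    unfolding m_def using V0 sqrt_add_le_add_sqrt[of "n * Vc" 1] by (simp add: add.commute)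
  finally show ?thesis by simp
qed

text \<open>A quadratic minorant of the square root touches it at the mean
  \<open>m = r\<^sup>2\<close>. Its linear term averages to zero, and its quadratic term to at most
  \<open>n * (1 + C)\<^sup>2 / (2 * r ^ 3)\<close>, which is bounded because
  \<open>r ^ 3 \<ge> m \<ge> n * c\<close>.\<close>

lemma integral_sqrt_block_var_ge:
  "sqrt (n * Vc) - (1 + C)\<^sup>2 / c \<le> integral\<^sup>L (PN n) (\<lambda>y. sqrt (block_var n y))"
proof -
  interpret PN: prob_space "PN n" by (rule prob_space_PN)
  define m where "m = 1 + n * Vc"
  have V0: "0 < Vc" using Vc_bounds c by linarith
  then have m: "m \<ge> 1" "m > 0" by (simp_all add: m_def add_pos_nonneg)
  define r where "r = sqrt m"
  have r: "r > 0" "r \<ge> 1" "r\<^sup>2 = m" using m by (simp_all add: r_def)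
  have pt: "r + (v - m) / (2 * r) - (v - m)\<^sup>2 / (2 * r ^ 3) \<le> sqrt v" if "v \<ge> 0" for v
  proof -
    define s where "s = sqrt v"
    have s: "s \<ge> 0" "s\<^sup>2 = v" using that by (simp_all add: s_def)
    \<comment> \<open>Multiplied by \<open>2 * r ^ 3\<close> and rearranged, the minorant is exactly
      this inequality.\<close>
    have "r\<^sup>2 * (r - s)\<^sup>2 \<le> (s + r)\<^sup>2 * (r - s)\<^sup>2"
      using r s by (intro mult_right_mono power_mono) auto
    also have "\<dots> = (s\<^sup>2 - r\<^sup>2)\<^sup>2" by (simp add: power2_eq_square algebra_simps)
    finally have "2 * r ^ 4 + r\<^sup>2 * (s\<^sup>2 - r\<^sup>2) - (s\<^sup>2 - r\<^sup>2)\<^sup>2 \<le> 2 * r ^ 3 * s"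
      by (simp add: power2_eq_square power3_eq_cube power4_eq_xxxx algebra_simps)
    then have "(2 * r ^ 4 + r\<^sup>2 * (s\<^sup>2 - r\<^sup>2) - (s\<^sup>2 - r\<^sup>2)\<^sup>2) / (2 * r ^ 3) \<le> s"
      using r by (simp add: divide_simps mult.commute)
    also have "(2 * r ^ 4 + r\<^sup>2 * (s\<^sup>2 - r\<^sup>2) - (s\<^sup>2 - r\<^sup>2)\<^sup>2) / (2 * r ^ 3)
      = r + (v - m) / (2 * r) - (v - m)\<^sup>2 / (2 * r ^ 3)"
    proof -
      have "(2 * r ^ 4 + r\<^sup>2 * A - B) / (2 * r ^ 3) = r + A / (2 * r) - B / (2 * r ^ 3)" for A B
        using r(1) by (simp add: field_simps eval_nat_numeral)
      then show ?thesis by (simp add: s r)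
    qed
    finally show ?thesis by (simp add: s_def)
  qed
  have nc: "n * c \<le> m" unfolding m_def using mult_left_mono[OF Vc_bounds(1), of "real n"] by simp
  have "sqrt (n * Vc) \<le> r" unfolding r_def m_def by simp
  moreover have "n * (1 + C)\<^sup>2 / (2 * r ^ 3) \<le> (1 + C)\<^sup>2 / c"
  proof -
    have "n * c * 1 \<le> m * r" using nc r m c by (intro mult_mono) auto
    also have "\<dots> = r ^ 3" unfolding r(3)[symmetric] by (simp add: power2_eq_square power3_eq_cube)
    finally have "n * c \<le> 2 * r ^ 3" using zero_le_power[of r 3] r by linarith
    then have "n * c * (1 + C)\<^sup>2 \<le> 2 * r ^ 3 * (1 + C)\<^sup>2" by (intro mult_right_mono) auto
    then show ?thesis using c r by (simp add: divide_simps mult_ac)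
  qed
  ultimately have "sqrt (n * Vc) - (1 + C)\<^sup>2 / c \<le> r - n * (1 + C)\<^sup>2 / (2 * r ^ 3)" by linarith
  also have "\<dots> \<le> r - integral\<^sup>L (PN n) (\<lambda>y. (block_var n y - m)\<^sup>2) / (2 * r ^ 3)"
    using variance_block_var[of n] r by (simp add: m_def divide_right_mono)
  also have "\<dots> = integral\<^sup>L (PN n) (\<lambda>y. r + (block_var n y - m) / (2 * r) - (block_var n y - m)\<^sup>2 / (2 * r ^ 3))"
    using integrable_block_var[of n] integrable_variance_block_var[of n]
    by (simp add: PN.prob_space integral_block_var m_def)
  also have "\<dots> \<le> integral\<^sup>L (PN n) (\<lambda>y. sqrt (block_var n y))"
    using integrable_block_var[of n] integrable_variance_block_var[of n] integrable_sqrt_block_var[of n]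
      block_var_bounds(1)[of n]
    by (intro integral_mono pt) (auto simp: m_def intro: order_trans[OF zero_le_one])
  finally show ?thesis .
qed

abbreviation "err n \<equiv> Lindeberg_error c C n"

lemma Lindeberg_block:
  assumes "0 < n"
  shows "(\<integral>\<^sup>+x. ennreal (max 0 (t - block_info n x y)) \<partial>BP n y)
      \<le> ennreal (gauss_loss (block_var n y) (t - block_ent n y) + err n)"
    and "ennreal (gauss_loss (block_var n y) (t - block_ent n y)) \<le>
      (\<integral>\<^sup>+x. ennreal (max 0 (t - block_info n x y)) \<partial>BP n y) + ennreal (err n)"
  using Lindeberg_info[where n = n and c = c and C = C and p = "\<lambda>i. K (y i)" and t = t and d = undefined] good C c assms
  unfolding block_info_def block_var_def block_ent_def block_pmf_def by auto

lemma err_nonneg: "0 < n \<Longrightarrow> 0 \<le> err n"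
  unfolding Lindeberg_error_def using c C by (intro add_nonneg_nonneg mult_nonneg_nonneg divide_nonneg_nonneg) auto

end

section \<open>Converse\<close>

definition Xn :: "nat \<Rightarrow> (nat \<Rightarrow> nat \<times> 'y) \<Rightarrow> (nat \<Rightarrow> nat)" where
  "Xn n \<omega> = (\<lambda>i\<in>{..<n}. fst (\<omega> i))"

lemma Xn_in_blocks [simp]: "Xn n \<omega> \<in> blocks n"
  by (simp add: Xn_def)

lemma Xn_zip_block [simp]: "x \<in> blocks n \<Longrightarrow> Xn n (zip_block n x y) = x"
  by (auto simp: Xn_def zip_block_def PiE_def extensional_def restrict_def fun_eq_iff)

lemma zip_block_nth: "i < n \<Longrightarrow> zip_block n x y i = (x i, y i)"
  by (simp add: zip_block_def)

context source begin

lemma Yn_zip_block [simp]: "y \<in> space (PN n) \<Longrightarrow> Yn n (zip_block n x y) = y"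
  by (auto simp: Yn_def zip_block_def space_PiM PiE_def extensional_def restrict_def fun_eq_iff)

lemma measurable_Yn [measurable]: "Yn n \<in> JN n \<rightarrow>\<^sub>M PN n"
proof -
  have "(\<lambda>\<omega>. snd (\<omega> i)) \<in> JN n \<rightarrow>\<^sub>M P" if "i \<in> {..<n}" for i
    using measurable_component_singleton[OF that, of "\<lambda>_. joint P K"]
    by (rule measurable_compose) measurable
  then show ?thesis unfolding Yn_def[abs_def] by (rule measurable_restrict)
qed

lemma measurable_Xn_nth [measurable]: "i < n \<Longrightarrow> (\<lambda>\<omega>. fst (\<omega> i)) \<in> JN n \<rightarrow>\<^sub>M count_space UNIV"
  by (rule measurable_compose[OF measurable_component_singleton[where M = "\<lambda>_. joint P K"]]) auto

lemma measurable_JN_sum: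
  fixes f :: "nat \<Rightarrow> 'y \<Rightarrow> real"
  assumes "\<And>x. f x \<in> borel_measurable P" "i < n"
  shows "(\<lambda>\<omega>. f (fst (\<omega> i)) (snd (\<omega> i))) \<in> borel_measurable (JN n)"
proof -
  have "(\<lambda>(x, y). f x y) \<in> borel_measurable (count_space UNIV \<Otimes>\<^sub>M P)"
    by (rule measurable_pair_measure_countable1) (auto simp: assms(1))
  then have "(\<lambda>(x, y). f x y) \<in> borel_measurable (joint P K)" by measurable
  from measurable_compose[OF measurable_component_singleton[of i "{..<n}" "\<lambda>_. joint P K"] this] assms(2)
  show ?thesis by (simp add: case_prod_beta')
qed

text \<open>Almost every outcome zips side information with a block of positive conditional
  probability, so only those have to be checked.\<close>

lemma AE_QN:
  assumes "\<And>u y x. y \<in> space (PN n) \<Longrightarrow> x \<in> blocks n \<Longrightarrow> 0 < pmf (block_pmf n K y) x \<Longrightarrow> R (zip_block n x y, u)"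
    and [measurable]: "Measurable.pred (QN n) R"
  shows "AE z in QN n. R z"
proof -
  have [measurable]: "{z \<in> space (QN n). \<not> R z} \<in> sets (QN n)" by measurable
  have "emeasure (QN n) {z \<in> space (QN n). \<not> R z} = (\<integral>\<^sup>+z. indicator {z \<in> space (QN n). \<not> R z} z \<partial>QN n)"
    by (rule nn_integral_indicator[symmetric]) measurable
  also have "\<dots> = (\<integral>\<^sup>+u. \<integral>\<^sup>+y. \<integral>\<^sup>+x. indicator {z \<in> space (QN n). \<not> R z} (zip_block n x y, u)
        \<partial>BP n y \<partial>PN n \<partial>seed)"
    by (rule nn_integral_QN) measurable
  also have "\<dots> = (\<integral>\<^sup>+u. \<integral>\<^sup>+y. 0 \<partial>PN n \<partial>seed)"
  proof (intro nn_integral_cong)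
    fix u y assume "y \<in> space (PN n)"
    then have "R (zip_block n x y, u)" if "x \<in> set_pmf (block_pmf n K y)" for x
      using assms(1)[of y x u] that set_block_pmf[of n K y] by (auto simp: set_pmf_eq pmf_positive_iff)
    then have "AE x in BP n y.
        indicator {z \<in> space (QN n). \<not> R z} (zip_block n x y, u) = (0 :: ennreal)"
      by (intro AE_pmfI) auto
    then show "(\<integral>\<^sup>+x. indicator {z \<in> space (QN n). \<not> R z} (zip_block n x y, u)
        \<partial>BP n y) = 0"
      by (subst nn_integral_0_iff_AE) auto
  qed
  finally have "emeasure (QN n) {z \<in> space (QN n). \<not> R z} = 0" by simp
  then show ?thesis by (rule AE_I[OF subset_refl]) measurable
qed

lemma nn_integral_QN_Yn:
  assumes [measurable]: "f \<in> borel_measurable (PN n)"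
  shows "(\<integral>\<^sup>+z. f (Yn n (fst z)) \<partial>QN n) = (\<integral>\<^sup>+y. f y \<partial>PN n)"
proof -
  interpret U: prob_space seed by (rule prob_space_seed)
  have "(\<integral>\<^sup>+z. f (Yn n (fst z)) \<partial>QN n) =
      (\<integral>\<^sup>+u. \<integral>\<^sup>+y. \<integral>\<^sup>+x. f (Yn n (fst (zip_block n x y, u))) \<partial>BP n y \<partial>PN n \<partial>seed)"
    by (rule nn_integral_QN) measurable
  also have "\<dots> = (\<integral>\<^sup>+u. \<integral>\<^sup>+y. f y \<partial>PN n \<partial>seed)"
    by (intro nn_integral_cong) (simp add: measure_pmf.emeasure_space_1[simplified])
  finally show ?thesis using U.emeasure_space_1 by simp
qed

abbreviation "sigYn n \<equiv> vimage_algebra (space (QN n)) (\<lambda>z. Yn n (fst z)) (PN n)"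

text \<open>This is \<open>is_code_max\<close> with the joint law written through \<open>P\<close>
  and \<open>K\<close>, which lets both bounds be proved for a source alone.\<close>

definition block_code :: "nat \<Rightarrow> real \<Rightarrow> real \<Rightarrow> ((nat \<Rightarrow> nat \<times> 'y) \<times> real \<Rightarrow> bool list)
    \<Rightarrow> (bool list \<Rightarrow> (nat \<Rightarrow> 'y) \<Rightarrow> real \<Rightarrow> (nat \<Rightarrow> nat)) \<Rightarrow> bool" where
  "block_code n L eps F G \<longleftrightarrow>
     F \<in> QN n \<rightarrow>\<^sub>M count_space UNIV \<and>
     (\<lambda>z. restrict (G (F z) (Yn n (fst z)) (snd z)) {..<n}) \<in> QN n \<rightarrow>\<^sub>M PiM {..<n} (\<lambda>_. count_space UNIV) \<and>
     (\<integral>\<^sup>+z. ennreal (real (length (F z))) \<partial>QN n) \<le> ennreal L \<and>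
     (AE z in QN n. real_cond_exp (QN n) (sigYn n)
       (indicator {z \<in> space (QN n). \<exists>i<n. G (F z) (Yn n (fst z)) (snd z) i \<noteq> fst (fst z i)}) z \<le> eps)"

lemma subalgebra_sigYn: "finite_measure_subalgebra (QN n) (sigYn n)"
proof -
  interpret Q: prob_space "QN n" by (rule prob_space_QN)
  have m: "(\<lambda>z. Yn n (fst z)) \<in> QN n \<rightarrow>\<^sub>M PN n" by measurable
  have "(\<lambda>z. Yn n (fst z)) \<in> space (QN n) \<rightarrow> space (PN n)"
    by (intro Pi_I measurable_space[OF m])
  then have "subalgebra (QN n) (sigYn n)"
    unfolding subalgebra_def using measurable_sets[OF m] by (simp only: sets_vimage_algebra2) auto
  then show ?thesis by unfold_locales
qed

lemma measurable_sigYn: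
  assumes "f \<in> borel_measurable (PN n)"
  shows "(\<lambda>z. f (Yn n (fst z))) \<in> borel_measurable (sigYn n)"
proof (rule measurable_compose[OF measurable_vimage_algebra1 assms])
  have "(\<lambda>z. Yn n (fst z)) \<in> QN n \<rightarrow>\<^sub>M PN n" by measurable
  then show "(\<lambda>z. Yn n (fst z)) \<in> space (QN n) \<rightarrow> space (PN n)"
    by (intro Pi_I) (rule measurable_space)
qed

end

text \<open>Here \<open>h\<close> will be the encoder and \<open>A\<close> the set of correctly
  decoded blocks: distinct blocks are charged to distinct strings.\<close>

lemma nn_integral_inj_le:
  assumes "inj_on h A" and "\<And>x. x \<in> A \<Longrightarrow> f x \<le> w (h x)" "\<And>x. x \<in> B - A \<Longrightarrow> f x = 0" "A \<subseteq> B"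
  shows "(\<integral>\<^sup>+x. f x \<partial>count_space B) \<le> (\<integral>\<^sup>+s. w s \<partial>count_space UNIV)"
proof -
  have "(\<integral>\<^sup>+x. f x \<partial>count_space B) = (\<integral>\<^sup>+x. f x \<partial>count_space A)"
    using assms by (intro nn_integral_count_space_eq) auto
  also have "\<dots> \<le> (\<integral>\<^sup>+x. w (h x) \<partial>count_space A)"
    using assms by (intro nn_integral_mono) auto
  also have "\<dots> = (\<integral>\<^sup>+s. w s \<partial>count_space (h ` A))"
    by (rule nn_integral_bij_count_space) (rule inj_on_imp_bij_betw[OF assms(1)])
  also have "\<dots> \<le> (\<integral>\<^sup>+s. w s \<partial>count_space UNIV)"
    by (subst nn_integral_count_space_indicator) (auto intro!: nn_integral_mono simp: indicator_def)
  finally show ?thesis .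
qed

context good_source begin

text \<open>On correct decoding, \<open>t\<close> is at most \<open>S\<close> plus the hinge
  \<open>max 0 (t - S)\<close>, and \<open>S\<close> is bounded by the codeword length plus a
  change-of-measure term of mean at most 2. The error constraint bounds the mean of \<open>t\<close>
  on correct decoding from below. The final 3 is this 2 plus the slack 1 of
  \<open>gauss_loss_dual_near\<close>.\<close>

lemma converse_bound:
  assumes n: "0 < n" and eps: "0 \<le> eps" "eps \<le> 1" and L: "0 \<le> L" and code: "block_code n L eps F G"
  shows "(1 - eps) * (n * H) - fG eps * (sqrt (n * Vc) + 1) \<le> (1 + 2 / n) * L + log 2 (n + 1) + err n + 3"
proof -
  interpret Q: prob_space "QN n" by (rule prob_space_QN)
  interpret PNn: prob_space "PN n" by (rule prob_space_PN)
  interpret U: prob_space seed by (rule prob_space_seed)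
  interpret sub: finite_measure_subalgebra "QN n" "sigYn n" by (rule subalgebra_sigYn)
  define dec where "dec = (\<lambda>z. G (F z) (Yn n (fst z)) (snd z))"
  have F [measurable]: "F \<in> QN n \<rightarrow>\<^sub>M count_space UNIV"
    and dec: "(\<lambda>z. restrict (dec z) {..<n}) \<in> QN n \<rightarrow>\<^sub>M PiM {..<n} (\<lambda>_. count_space UNIV)"
    and len: "(\<integral>\<^sup>+z. ennreal (real (length (F z))) \<partial>QN n) \<le> ennreal L"
    and err: "AE z in QN n. real_cond_exp (QN n) (sigYn n)
      (indicator {z \<in> space (QN n). \<exists>i<n. dec z i \<noteq> fst (fst z i)}) z \<le> eps"
    using code unfolding block_code_def dec_def by blast+
  define Err where "Err = {z \<in> space (QN n). \<exists>i<n. dec z i \<noteq> fst (fst z i)}"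
  define Corr where "Corr = {z \<in> space (QN n). \<forall>i<n. dec z i = fst (fst z i)}"
  have dec_i: "(\<lambda>z. dec z i) \<in> QN n \<rightarrow>\<^sub>M count_space UNIV" if "i < n" for i
    using measurable_compose[OF dec measurable_component_singleton[of i]] that by simp
  have Err_sets [measurable]: "Err \<in> sets (QN n)"
  proof -
    have "Err = (\<Union>i<n. {z \<in> space (QN n). dec z i \<noteq> fst (fst z i)})" by (auto simp: Err_def)
    also have "\<dots> \<in> sets (QN n)"
    proof (rule sets.finite_UN)
      fix i assume "i \<in> {..<n}"
      then have i: "i < n" by simp
      note dec_i[OF i, measurable] measurable_compose[OF measurable_fst measurable_Xn_nth[OF i], measurable]
      have "{z \<in> space (QN n). \<not> (\<exists>k. dec z i = k \<and> fst (fst z i) = k)} \<in> sets (QN n)" by measurable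
      then show "{z \<in> space (QN n). dec z i \<noteq> fst (fst z i)} \<in> sets (QN n)" by (simp only: ex_simps simp_thms eq_commute[of "dec _ i"])
    qed simp
    finally show ?thesis .
  qed
  have Corr_eq: "Corr = space (QN n) - Err" by (auto simp: Corr_def Err_def)
  have Corr_sets [measurable]: "Corr \<in> sets (QN n)" unfolding Corr_eq by measurable
  define p where "p = (\<lambda>z :: (nat \<Rightarrow> nat \<times> 'y) \<times> real. \<Prod>i<n. pmf (K (snd (fst z i))) (fst (fst z i)))"
  define S where "S = (\<lambda>z :: (nat \<Rightarrow> nat \<times> 'y) \<times> real. \<Sum>i<n. info (K (snd (fst z i))) (fst (fst z i)))"
  have [measurable]: "p \<in> borel_measurable (QN n)"
    unfolding p_def
    by (intro borel_measurable_prod measurable_compose[OF measurable_fst] measurable_JN_sum[of "\<lambda>x y. pmf (K y) x"]) auto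
  have [measurable]: "S \<in> borel_measurable (QN n)"
    unfolding S_def
    by (intro borel_measurable_sum measurable_compose[OF measurable_fst] measurable_JN_sum[of "\<lambda>x y. info (K y) x"]) auto
  have p_zip: "p (zip_block n x y, u) = pmf (block_pmf n K y) x" if "x \<in> blocks n" for x y u
    by (simp add: p_def pmf_block_pmf[OF that] zip_block_nth)
  have S_zip: "S (zip_block n x y, u) = block_info n x y" for x y u
    by (simp add: S_def block_info_def zip_block_nth)
  have pS: "AE z in QN n. 0 < p z \<and> S z = log 2 (1 / p z)"
    by (rule AE_QN) (auto simp: p_zip S_zip block_info_eq)

  define W where "W = (\<lambda>z. string_weight n (F z))"
  have W_pos: "0 < W z" for z using n by (simp add: W_def string_weight_pos)
  have [measurable]: "W \<in> borel_measurable (QN n)" unfolding W_def by measurable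
  \<comment> \<open>The likelihood ratio of the string weight to the conditional probability, on
    correct decoding. For fixed side information and seed the probabilities cancel in its mean, and
    what remains is a sum of weights of distinct strings.\<close>
  define B where "B = (\<lambda>z. indicator Corr z * (W z / p z))"
  have p_nonneg: "0 \<le> p z" for z unfolding p_def by (intro prod_nonneg) simp
  have B_nonneg: "0 \<le> B z" for z using W_pos[of z] p_nonneg[of z] by (simp add: B_def)
  have [measurable]: "B \<in> borel_measurable (QN n)" unfolding B_def by measurable
  have B: "(\<integral>\<^sup>+z. ennreal (B z) \<partial>QN n) \<le> 1"
  proof -
    have "(\<integral>\<^sup>+z. ennreal (B z) \<partial>QN n) =
      (\<integral>\<^sup>+u. \<integral>\<^sup>+y. \<integral>\<^sup>+x. ennreal (B (zip_block n x y, u)) \<partial>BP n y \<partial>PN n \<partial>seed)"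
      by (rule nn_integral_QN) measurable
    also have "\<dots> \<le> (\<integral>\<^sup>+u. \<integral>\<^sup>+y. 1 \<partial>PN n \<partial>seed)"
    proof (intro nn_integral_mono)
      fix u y assume y: "y \<in> space (PN n)"
      define A where "A = {x \<in> blocks n. (zip_block n x y, u) \<in> Corr}"
      have "(\<integral>\<^sup>+x. ennreal (B (zip_block n x y, u)) \<partial>BP n y)
        = (\<integral>\<^sup>+x. ennreal (pmf (block_pmf n K y) x) * ennreal (B (zip_block n x y, u)) \<partial>count_space (blocks n))"
        by (rule nn_integral_pmf_count_space[OF set_block_pmf])
      also have "\<dots> \<le> (\<integral>\<^sup>+s. ennreal (string_weight n s) \<partial>count_space UNIV)"
      proof (rule nn_integral_inj_le[where h = "\<lambda>x. F (zip_block n x y, u)" and A = A])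
        show "inj_on (\<lambda>x. F (zip_block n x y, u)) A"
        proof (rule inj_onI)
          fix x x' assume *: "x \<in> A" "x' \<in> A" "F (zip_block n x y, u) = F (zip_block n x' y, u)"
          \<comment> \<open>The decoder sees only the codeword, the side information and the seed,
            and all three agree.\<close>
          then have "dec (zip_block n x y, u) = dec (zip_block n x' y, u)"
            using y by (simp add: dec_def)
          then have "x i = x' i" if "i < n" for i
            using * that by (auto simp: A_def Corr_def zip_block_nth)
          moreover have "x \<in> blocks n" "x' \<in> blocks n" using * by (auto simp: A_def)
          ultimately show "x = x'" by (intro PiE_ext[of x "{..<n}" "\<lambda>_. UNIV" x']) auto
        qed
      next
        fix x assume x: "x \<in> A"
        then have xb: "x \<in> blocks n" by (simp add: A_def)
        show "ennreal (pmf (block_pmf n K y) x) * ennreal (B (zip_block n x y, u))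
          \<le> ennreal (string_weight n (F (zip_block n x y, u)))"
          unfolding B_def p_zip[OF xb] W_def using W_pos[of "(zip_block n x y, u)"]
          by (auto simp: ennreal_mult[symmetric] W_def indicator_def intro!: ennreal_leI)
      next
        fix x assume x: "x \<in> blocks n - A"
        then show "ennreal (pmf (block_pmf n K y) x) * ennreal (B (zip_block n x y, u)) = 0"
          by (auto simp: B_def A_def)
      qed (auto simp: A_def)
      also have "\<dots> \<le> 1" by (rule nn_integral_string_weight)
      finally show "(\<integral>\<^sup>+x. ennreal (B (zip_block n x y, u)) \<partial>BP n y) \<le> 1" .
    qed
    also have "\<dots> = 1" by (simp add: PNn.emeasure_space_1 U.emeasure_space_1[simplified])
    finally show ?thesis .
  qed

  \<comment> \<open>The linear growth bound on \<open>\<tau>\<close> makes the chosen level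
    integrable over the side information.\<close>
  obtain A \<tau> where \<tau>: "\<tau> \<in> borel_measurable borel"
    "\<And>v. v \<ge> 1 \<Longrightarrow> \<bar>\<tau> v\<bar> \<le> A * v"
    "\<And>v. v \<ge> 1 \<Longrightarrow> gauss_loss v (\<tau> v) \<le> (1 - eps) * \<tau> v + sqrt v * fG (1 - eps) + 1"
    using gauss_loss_dual_near[of "1 - eps"] eps by (metis diff_ge_0_iff_ge diff_le_eq le_add_same_cancel1)
  note \<tau>(1)[measurable]
  \<comment> \<open>The dual parameter is centred at the conditional entropy. Clipping at 0 keeps
    \<open>t\<close> nonnegative; where it takes effect the hinge vanishes, since the information is
    nonnegative.\<close>
  define t where "t = (\<lambda>y. max 0 (block_ent n y + \<tau> (block_var n y)))"
  let ?t = "\<lambda>z. t (Yn n (fst z))"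
  have [measurable]: "t \<in> borel_measurable (PN n)" unfolding t_def by measurable
  have t_nonneg: "0 \<le> t y" for y by (simp add: t_def)
  have it: "integrable (PN n) t"
  proof (rule Bochner_Integration.integrable_bound)
    show "integrable (PN n) (\<lambda>y. block_ent n y + A * block_var n y)"
      using integrable_block_ent integrable_block_var by simp
    show "AE y in PN n. norm (t y) \<le> norm (block_ent n y + A * block_var n y)"
    proof (rule AE_I2)
      fix y
      have "\<bar>\<tau> (block_var n y)\<bar> \<le> A * block_var n y" using \<tau>(2) block_var_bounds(1) by blast
      then show "norm (t y) \<le> norm (block_ent n y + A * block_var n y)"
        using block_ent_nonneg[of n y] by (auto simp: t_def)
    qed
  qed simp
  define ET where "ET = integral\<^sup>L (PN n) t"
  have ET: "(\<integral>\<^sup>+z. ennreal (?t z) \<partial>QN n) = ennreal ET"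
    unfolding ET_def using t_nonneg by (subst nn_integral_QN_Yn) (auto intro!: nn_integral_eq_integral it)
  have ET0: "0 \<le> ET" unfolding ET_def using t_nonneg by (intro integral_nonneg_AE) auto
  have itQ: "integrable (QN n) ?t"
    using ET t_nonneg by (intro integrableI_bounded) auto
  have ETQ: "integral\<^sup>L (QN n) ?t = ET"
    using ET0 t_nonneg by (subst integral_eq_nn_integral) (auto simp: ET)

  \<comment> \<open>As \<open>t\<close> depends on the side information only, it can be pulled into
    the conditional expectation of the error indicator; being nonnegative, it preserves the bound by
    \<open>eps\<close>.\<close>
  have lower: "ennreal ((1 - eps) * ET) \<le> (\<integral>\<^sup>+z. ennreal (indicator Corr z * ?t z) \<partial>QN n)"
  proof -
    let ?c = "real_cond_exp (QN n) (sigYn n) (indicator Err)"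
    have tm: "?t \<in> borel_measurable (sigYn n)"
      by (rule measurable_sigYn) measurable
    have iE: "integrable (QN n) (\<lambda>z. ?t z * indicator Err z)"
      using integrable_mult_indicator[OF Err_sets itQ] by (simp add: mult.commute)
    note ce = sub.real_cond_exp_intg[OF iE tm]
    have "integral\<^sup>L (QN n) (\<lambda>z. ?t z * indicator Err z) = integral\<^sup>L (QN n) (\<lambda>z. ?t z * ?c z)"
      by (rule ce(2)[symmetric]) measurable
    also have "\<dots> \<le> integral\<^sup>L (QN n) (\<lambda>z. ?t z * eps)"
    proof (rule integral_mono_AE)
      show "integrable (QN n) (\<lambda>z. ?t z * ?c z)" by (rule ce(1)) measurable
      show "AE z in QN n. ?t z * ?c z \<le> ?t z * eps"
        using err unfolding Err_def[symmetric] by eventually_elim (auto intro: mult_left_mono t_nonneg)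
    qed (use itQ in simp)
    also have "\<dots> = ET * eps" using ETQ by simp
    finally have "integral\<^sup>L (QN n) (\<lambda>z. ?t z * indicator Err z) \<le> ET * eps" .
    then have "(1 - eps) * ET \<le> integral\<^sup>L (QN n) (\<lambda>z. ?t z - ?t z * indicator Err z)"
      using itQ iE ETQ by (simp add: algebra_simps)
    also have "\<dots> = integral\<^sup>L (QN n) (\<lambda>z. indicator Corr z * ?t z)"
      by (intro Bochner_Integration.integral_cong) (auto simp: Corr_eq indicator_def)
    finally have "(1 - eps) * ET \<le> integral\<^sup>L (QN n) (\<lambda>z. indicator Corr z * ?t z)" .
    moreover have "integrable (QN n) (\<lambda>z. indicator Corr z * ?t z)"
      using integrable_mult_indicator[OF Corr_sets itQ] by simp
    ultimately show ?thesis
      using t_nonneg by (subst nn_integral_eq_integral) (auto intro!: ennreal_leI)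
  qed

  \<comment> \<open>An integrable upper bound for the hinge loss at \<open>t\<close>: for an
    unclipped \<open>t\<close> it is the near-dual value plus the replacement error, and clipping
    only increases it. The multiple of \<open>t\<close> cancels against the lower bound at the
    end.\<close>
  define b where "b = (\<lambda>y. (1 - eps) * t y - (1 - eps) * block_ent n y + fG eps * sqrt (block_var n y) + (1 + err n))"
  have b_ge: "gauss_loss (block_var n y) (\<tau> (block_var n y)) + err n \<le> b y" for y
  proof -
    have "(1 - eps) * \<tau> (block_var n y) \<le> (1 - eps) * (t y - block_ent n y)"
      using eps by (intro mult_left_mono) (auto simp: t_def)
    then show ?thesis
      using \<tau>(3)[OF block_var_bounds(1), of n y] by (simp add: b_def fG_one_minus algebra_simps)
  qed
  have gl: "0 \<le> gauss_loss (block_var n y) u" for y u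
    using block_var_bounds(1)[of n y] by (intro gauss_loss_nonneg) linarith
  have b_nonneg: "0 \<le> b y" for y
    using b_ge[of y] gl[of y "\<tau> (block_var n y)"] err_nonneg[OF n] by linarith
  have ib: "integrable (PN n) b"
    unfolding b_def using it integrable_block_ent integrable_sqrt_block_var by simp
  have hinge: "(\<integral>\<^sup>+x. ennreal (max 0 (t y - block_info n x y)) \<partial>BP n y) \<le> ennreal (b y)" for y
  proof (cases "0 \<le> block_ent n y + \<tau> (block_var n y)")
    case True
    then have t: "t y - block_ent n y = \<tau> (block_var n y)" by (simp add: t_def)
    show ?thesis
      using Lindeberg_block(1)[where y = y and t = "t y", OF n] ennreal_leI[OF b_ge[of y]] unfolding t
      by (rule order_trans)
  next
    case False
    then have "t y = 0" by (simp add: t_def)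
    then have "max 0 (t y - block_info n x y) = 0" for x using block_info_nonneg[of n x y] by simp
    then show ?thesis by simp
  qed
  have "(\<integral>\<^sup>+z. ennreal (max 0 (?t z - S z)) \<partial>QN n) =
      (\<integral>\<^sup>+u. \<integral>\<^sup>+y. \<integral>\<^sup>+x. ennreal (max 0 (t (Yn n (fst (zip_block n x y, u))) - S (zip_block n x y, u)))
         \<partial>BP n y \<partial>PN n \<partial>seed)"
    by (rule nn_integral_QN) measurable
  also have "\<dots> \<le> (\<integral>\<^sup>+u. \<integral>\<^sup>+y. ennreal (b y) \<partial>PN n \<partial>seed)"
    using hinge by (intro nn_integral_mono) (simp add: S_zip)
  also have "\<dots> = ennreal (integral\<^sup>L (PN n) b)"
    using b_nonneg ib U.emeasure_space_1 by (simp add: nn_integral_eq_integral)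
  finally have upper: "(\<integral>\<^sup>+z. ennreal (max 0 (?t z - S z)) \<partial>QN n) \<le> ennreal (integral\<^sup>L (PN n) b)" .

  define l where "l = log 2 (real n + 1)"
  have l: "0 \<le> l" using n by (simp add: l_def)
  define k where "k = 1 + 2 / real n"
  have k: "0 \<le> k" by (simp add: k_def)
  have pt: "AE z in QN n. ennreal (indicator Corr z * ?t z) \<le>
      ennreal l + ennreal k * ennreal (real (length (F z))) + 2 * ennreal (B z) + ennreal (max 0 (?t z - S z))"
    using pS
  proof eventually_elim
    case (elim z)
    have "indicator Corr z * ?t z \<le> l + k * real (length (F z)) + 2 * B z + max 0 (?t z - S z)"
    proof (cases "z \<in> Corr")
      case True
      \<comment> \<open>From \<open>ln x \<le> x\<close> and \<open>ln 2\<close> at least one half.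
        It trades the logarithm of the likelihood ratio for the ratio itself, whose mean is
        known.\<close>
      have "log 2 (W z / p z) \<le> 2 * (W z / p z)"
      proof -
        have pos: "W z / p z > 0" using W_pos elim by simp
        note ln_2_ge_half
        then have "W z / p z \<le> (2 * (W z / p z)) * ln 2"
          using mult_left_mono[of "1 / 2" "ln 2" "2 * (W z / p z)"] pos by simp
        moreover have "ln (W z / p z) \<le> W z / p z" using ln_le_minus_one[OF pos] by linarith
        ultimately have "ln (W z / p z) \<le> (2 * (W z / p z)) * ln 2" by linarith
        then show ?thesis by (simp add: log_def divide_le_eq)
      qed
      moreover have "log 2 (W z / p z) = S z - log 2 (1 / W z)"
        using elim W_pos[of z] by (simp add: log_divide)
      moreover have "log 2 (1 / W z) \<le> l + k * real (length (F z))"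
        using log_string_weight[OF n, of "F z"] by (simp add: W_def l_def k_def)
      ultimately have "S z \<le> l + k * real (length (F z)) + 2 * B z"
        using True by (simp add: B_def)
      then show ?thesis using True by simp
    next
      case False
      then show ?thesis using l k B_nonneg[of z] by simp
    qed
    moreover define m where "m = max 0 (?t z - S z)"
    moreover have "0 \<le> m" by (simp add: m_def)
    ultimately show ?case
      unfolding m_def[symmetric] using l k B_nonneg[of z]
      by (simp add: ennreal_leI flip: ennreal_plus ennreal_mult ennreal_numeral)
  qed
  have "(\<integral>\<^sup>+z. ennreal (indicator Corr z * ?t z) \<partial>QN n) \<le>
      (\<integral>\<^sup>+z. ennreal l + ennreal k * ennreal (real (length (F z))) + 2 * ennreal (B z)
         + ennreal (max 0 (?t z - S z)) \<partial>QN n)"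
    by (rule nn_integral_mono_AE[OF pt])
  also have "\<dots> = ennreal l + ennreal k * (\<integral>\<^sup>+z. ennreal (real (length (F z))) \<partial>QN n)
       + 2 * (\<integral>\<^sup>+z. ennreal (B z) \<partial>QN n) + (\<integral>\<^sup>+z. ennreal (max 0 (?t z - S z)) \<partial>QN n)"
    by (simp add: nn_integral_add nn_integral_cmult Q.emeasure_space_1)
  also have "\<dots> \<le> ennreal l + ennreal k * ennreal L + 2 * 1 + ennreal (integral\<^sup>L (PN n) b)"
    by (intro add_mono mult_left_mono len B upper order_refl) auto
  also have "\<dots> = ennreal (l + k * L + 2 + integral\<^sup>L (PN n) b)"
    using l k L b_nonneg by (simp add: integral_nonneg_AE flip: ennreal_plus ennreal_mult ennreal_numeral)
  finally have "ennreal ((1 - eps) * ET) \<le> ennreal (l + k * L + 2 + integral\<^sup>L (PN n) b)"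
    using lower by (rule order_trans[rotated])
  moreover have "0 \<le> l + k * L + 2 + integral\<^sup>L (PN n) b"
    using l k L b_nonneg by (intro add_nonneg_nonneg mult_nonneg_nonneg integral_nonneg_AE) auto
  ultimately have main: "(1 - eps) * ET \<le> l + k * L + 2 + integral\<^sup>L (PN n) b"
    by (simp add: ennreal_le_iff)
  have "integral\<^sup>L (PN n) b = (1 - eps) * ET - (1 - eps) * (n * H)
      + fG eps * integral\<^sup>L (PN n) (\<lambda>y. sqrt (block_var n y)) + (1 + err n)"
    unfolding b_def using it integrable_block_ent[of n] integrable_sqrt_block_var[of n]
    by (simp add: PNn.prob_space integral_block_ent ET_def)
  also have "\<dots> \<le> (1 - eps) * ET - (1 - eps) * (n * H) + fG eps * (sqrt (n * Vc) + 1) + (1 + err n)"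
    by (intro add_mono mult_left_mono integral_sqrt_block_var_le fG_nonneg order_refl)
  finally show ?thesis using main unfolding l_def k_def of_nat_add of_nat_1 by argo
qed

end

section \<open>Achievability\<close>

context source begin

lemma measurable_Xn [measurable]: "Xn n \<in> JN n \<rightarrow>\<^sub>M count_space (blocks n)"
proof -
  have "Xn n -` {x} \<inter> space (JN n) \<in> sets (JN n)" if x: "x \<in> blocks n" for x
  proof -
    have "Xn n -` {x} \<inter> space (JN n) = {\<omega> \<in> space (JN n). \<forall>i\<in>{..<n}. fst (\<omega> i) = x i}"
      using x by (auto simp: Xn_def PiE_def extensional_def restrict_def fun_eq_iff)
    also have "\<dots> \<in> sets (JN n)"
    proof (rule sets.sets_Collect_finite_All)
      fix i assume "i \<in> {..<n}"
      then have [measurable]: "(\<lambda>\<omega>. fst (\<omega> i)) \<in> JN n \<rightarrow>\<^sub>M count_space UNIV"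
        by (intro measurable_Xn_nth) simp
      show "{\<omega> \<in> space (JN n). fst (\<omega> i) = x i} \<in> sets (JN n)" by measurable
    qed simp
    finally show ?thesis .
  qed
  then show ?thesis
    unfolding measurable_count_space_eq_countable[OF countable_blocks] by auto
qed

text \<open>The block takes countably many values, so measurability in the side information and the
  seed for each fixed block suffices.\<close>

lemma measurable_QN:
  assumes "\<And>x. x \<in> blocks n \<Longrightarrow> (\<lambda>(y, u). h x y u) \<in> PN n \<Otimes>\<^sub>M seed \<rightarrow>\<^sub>M R"
  shows "(\<lambda>z. h (Xn n (fst z)) (Yn n (fst z)) (snd z)) \<in> QN n \<rightarrow>\<^sub>M R"
proof (rule measurable_compose_countable'[where f = "\<lambda>x z. h x (Yn n (fst z)) (snd z)" and I = "blocks n"])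
  fix x assume "x \<in> blocks n"
  note [measurable] = assms[OF this]
  have "(\<lambda>z. (Yn n (fst z), snd z)) \<in> QN n \<rightarrow>\<^sub>M PN n \<Otimes>\<^sub>M seed" by measurable
  from measurable_compose[OF this assms[OF \<open>x \<in> blocks n\<close>]]
  show "(\<lambda>z. h x (Yn n (fst z)) (snd z)) \<in> QN n \<rightarrow>\<^sub>M R" by simp
qed (auto simp: countable_blocks)

lemma measurable_block_prob:
  assumes "\<And>x. x \<in> blocks n \<Longrightarrow> Measurable.pred (PN n) (R x)"
  shows "(\<lambda>y. measure_pmf.prob (block_pmf n K y) {x. R x y}) \<in> borel_measurable (PN n)"
proof -
  have [measurable]: "(\<lambda>y. \<integral>\<^sup>+x. indicator {y. R x y} y \<partial>BP n y) \<in> borel_measurable (PN n)"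
    by (rule measurable_block_integral) (use assms in measurable)
  have "(\<lambda>y. enn2real (\<integral>\<^sup>+x. indicator {y. R x y} y \<partial>BP n y)) \<in> borel_measurable (PN n)"
    by measurable
  moreover have "(\<integral>\<^sup>+x. indicator {y. R x y} y \<partial>BP n y)
      = emeasure (BP n y) {x. R x y}" for y
  proof -
    have "(\<integral>\<^sup>+x. indicator {y. R x y} y \<partial>BP n y)
        = (\<integral>\<^sup>+x. indicator {x. R x y} x \<partial>BP n y)"
      by (rule nn_integral_cong) (simp add: indicator_def)
    then show ?thesis by simp
  qed
  ultimately show ?thesis by (simp add: measure_def)
qed

text \<open>The adjunction in \<open>quantile\<close> turns sublevel sets of the quantile into
  conditions on conditional probabilities, which are measurable in \<open>y\<close>.\<close>

lemma measurable_np_test: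
  assumes S [measurable]: "\<And>x. x \<in> blocks n \<Longrightarrow> S x \<in> borel_measurable (PN n)"
    and a: "0 < a" "a < 1" and S0: "\<And>x y. 0 \<le> S x y" and x: "x \<in> blocks n"
  shows "Measurable.pred (PN n \<Otimes>\<^sub>M seed) (\<lambda>(y, u). np_test (block_pmf n K y) (\<lambda>x. S x y) a x u)"
proof -
  let ?q = "\<lambda>y. quantile (block_pmf n K y) (\<lambda>x. S x y) a"
  have "{y \<in> space (PN n). ?q y \<le> t} \<in> sets (PN n)" for t
  proof -
    have [measurable]: "(\<lambda>y. measure_pmf.prob (block_pmf n K y) {x. S x y \<le> t}) \<in> borel_measurable (PN n)"
      by (rule measurable_block_prob) measurable
    have "{y \<in> space (PN n). ?q y \<le> t} =
        {y \<in> space (PN n). a \<le> measure_pmf.prob (block_pmf n K y) {x. S x y \<le> t}}"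
      using quantile(3)[OF a, where S = "\<lambda>x. S x _"] S0 by auto
    also have "\<dots> \<in> sets (PN n)" by measurable
    finally show ?thesis .
  qed
  then have [measurable]: "?q \<in> borel_measurable (PN n)"
    by (simp only: borel_measurable_iff_le) blast
  have [measurable]: "(\<lambda>y. measure_pmf.prob (block_pmf n K y) {x. S x y < ?q y}) \<in> borel_measurable (PN n)"
    by (rule measurable_block_prob) measurable
  have [measurable]: "(\<lambda>y. measure_pmf.prob (block_pmf n K y) {x. S x y = ?q y}) \<in> borel_measurable (PN n)"
  proof (rule measurable_block_prob)
    fix x' assume "x' \<in> blocks n"
    note S[OF this, measurable]
    show "Measurable.pred (PN n) (\<lambda>y. S x' y = ?q y)"
      unfolding pred_def by (rule borel_measurable_eq) measurable
  qed
  note S[OF x, measurable]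
  show ?thesis unfolding np_test_def using x by measurable
qed

end

context good_source begin

text \<open>Any measurable test of conditional power \<open>1 - eps\<close> gives a code: an
  accepted block is sent as its probability rank, a rejected one as the empty string. The test is a
  parameter because the extreme values of \<open>eps\<close> use trivial tests instead of
  quantiles.\<close>

lemma achievability_aux:
  fixes n :: nat and Tr :: "(nat \<Rightarrow> 'y) \<Rightarrow> (nat \<Rightarrow> nat) \<Rightarrow> real \<Rightarrow> bool"
  assumes n: "0 < n" and eps: "0 \<le> eps" "eps \<le> 1"
    and Tr: "\<And>x. x \<in> blocks n \<Longrightarrow> Measurable.pred (PN n \<Otimes>\<^sub>M seed) (\<lambda>(y, u). Tr y x u)"
    and power: "\<And>y. y \<in> space (PN n) \<Longrightarrow>
      (\<integral>\<^sup>+x. (\<integral>\<^sup>+u. indicator {u. Tr y x u} u \<partial>seed) \<partial>BP n y) = ennreal (1 - eps)"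
    and cost: "\<And>y. y \<in> space (PN n) \<Longrightarrow>
      (\<integral>\<^sup>+x. (\<integral>\<^sup>+u. ennreal (block_info n x y) * indicator {u. Tr y x u} u \<partial>seed) \<partial>BP n y)
       \<le> ennreal (D y)"
    and D: "integrable (PN n) D" "\<And>y. 0 \<le> D y"
  shows "\<exists>F G. block_code n (1 + integral\<^sup>L (PN n) D) eps F G"
proof -
  interpret Q: prob_space "QN n" by (rule prob_space_QN)
  interpret PNn: prob_space "PN n" by (rule prob_space_PN)
  interpret U: prob_space seed by (rule prob_space_seed)
  interpret sub: finite_measure_subalgebra "QN n" "sigYn n" by (rule subalgebra_sigYn)
  let ?w = "\<lambda>y x u. ennreal (block_info n x y) * indicator {u. Tr y x u} u"
  note Tr[measurable]
  define p where "p = (\<lambda>y. pmf (block_pmf n K y))"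
  have [measurable]: "(\<lambda>y. p y x) \<in> borel_measurable (PN n)" for x
    unfolding p_def by measurable
  \<comment> \<open>\<open>prob_rank\<close> orders natural numbers, so blocks are numbered first.
    For positive \<open>n\<close> there are infinitely many, and the numbering is a
    bijection.\<close>
  define e where "e = from_nat_into (blocks n)"
  define e' where "e' = to_nat_on (blocks n)"
  have inf: "infinite (blocks n)"
  proof
    assume fin: "finite (blocks n)"
    have "inj (\<lambda>k::nat. \<lambda>i\<in>{..<n}. k)"
      using n by (auto simp: inj_def fun_eq_iff restrict_def split: if_splits)
    moreover have "range (\<lambda>k::nat. \<lambda>i\<in>{..<n}. k) \<subseteq> blocks n"
      by (auto split: if_splits)
    ultimately show False using fin finite_subset finite_imageD infinite_UNIV_nat by blast
  qed
  have "e k \<in> blocks n" for k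
    unfolding e_def using inf by (intro from_nat_into) (metis finite.emptyI)
  moreover have "e' (e k) = k" for k
    unfolding e_def e'_def by (rule to_nat_on_from_nat_into_infinite[OF countable_blocks inf])
  ultimately have e: "e k \<in> blocks n" "e' (e k) = k" for k by auto
  have e': "e (e' x) = x" if "x \<in> blocks n" for x
    unfolding e_def e'_def using countable_blocks that by (rule from_nat_into_to_nat_on)
  define r where "r = (\<lambda>y x. prob_rank (\<lambda>k. p y (e k)) (e' x))"
  have sum_le: "sum (\<lambda>k. p y (e k)) B \<le> 1" if "finite B" for B y
  proof -
    have "inj_on e B" using e(2) by (metis inj_onI)
    then have "sum (\<lambda>k. p y (e k)) B = sum (p y) (e ` B)" by (simp add: sum.reindex)
    also have "\<dots> = measure_pmf.prob (block_pmf n K y) (e ` B)"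
      unfolding p_def using that by (simp add: measure_measure_pmf_finite)
    finally show ?thesis by simp
  qed
  have r_inj: "x = x'" if "x \<in> blocks n" "x' \<in> blocks n" "0 < p y x" "0 < p y x'" "r y x = r y x'" for y x x'
  proof -
    have "e' x = e' x'"
    proof (rule prob_rank_inj[of "\<lambda>k. p y (e k)"])
      show "0 < p y (e (e' x))" "0 < p y (e (e' x'))" using that(1-4) by (simp_all only: e')
      show "prob_rank (\<lambda>k. p y (e k)) (e' x) = prob_rank (\<lambda>k. p y (e k)) (e' x')"
        using that(5) by (simp add: r_def)
    qed (rule sum_le)
    then show ?thesis using that e' by metis
  qed
  \<comment> \<open>The index \<open>r + 1\<close> gives
    \<open>2 ^ length \<le> r + 2 \<le> 2 * (r + 1) \<le> 2 / p\<close>; the factor 2 is the extra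
    bit.\<close>
  have r_le: "real (length (bits (r y x + 1))) \<le> 1 + block_info n x y" if "x \<in> blocks n" "0 < p y x" for y x
  proof -
    have "(real (r y x) + 1) * p y x \<le> 1"
      using prob_rank_bound(2)[of "\<lambda>k. p y (e k)" "e' x", OF sum_le] that by (simp add: r_def e' add.commute)
    moreover have "real (2 ^ length (bits (r y x + 1))) \<le> real (r y x + 1 + 1)"
      using length_bits[of "r y x + 1"] by (intro of_nat_mono) simp
    ultimately have "real (r y x) + 1 \<le> 1 / p y x" "2 ^ length (bits (r y x + 1)) \<le> real (r y x) + 2"
      using that by (simp_all add: pos_le_divide_eq)
    then have "2 ^ length (bits (r y x + 1)) \<le> 2 * (1 / p y x)" by linarith
    then have "log 2 (2 ^ length (bits (r y x + 1))) \<le> log 2 (2 * (1 / p y x))"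
      by (subst log_le_cancel_iff) (use that in auto)
    also have "\<dots> = 1 + log 2 (1 / p y x)" using that by (subst log_mult) auto
    also have "log 2 (1 / p y x) = block_info n x y"
      using block_info_eq[of x n y] that by (simp add: p_def)
    finally show ?thesis by (simp add: log_nat_power)
  qed
  have r_meas [measurable]: "(\<lambda>y. r y x) \<in> PN n \<rightarrow>\<^sub>M count_space UNIV" for x
    unfolding r_def prob_rank_def
  proof (rule measurable_card)
    fix j
    have "{y \<in> space (PN n). j \<in> {j. p y (e (e' x)) < p y (e j) \<or> p y (e j) = p y (e (e' x)) \<and> j < e' x}}
      = {y \<in> space (PN n). p y (e (e' x)) < p y (e j) \<or>
          \<not> p y (e j) < p y (e (e' x)) \<and> j < e' x}" by auto
    also have "\<dots> \<in> sets (PN n)" by measurable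
    finally show "{y \<in> space (PN n). j \<in> {j. p y (e (e' x)) < p y (e j) \<or> p y (e j) = p y (e (e' x)) \<and> j < e' x}}
      \<in> sets (PN n)" .
  qed

  \<comment> \<open>Ranks are injective only among blocks of positive conditional probability, and
    the remaining ones almost surely do not occur.\<close>
  define T where "T = (\<lambda>y x u. 0 < p y x \<and> Tr y x u)"
  have T_meas [measurable]: "Measurable.pred (PN n \<Otimes>\<^sub>M seed) (\<lambda>(y, u). T y x u)" if "x \<in> blocks n" for x
    unfolding T_def using that by measurable
  \<comment> \<open>The shift by 1 reserves the empty string, the code of 0, for rejection.\<close>
  define enc where "enc = (\<lambda>x y u. if T y x u then bits (r y x + 1) else [])"
  define F where "F = (\<lambda>z. enc (Xn n (fst z)) (Yn n (fst z)) (snd z))"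
  define G where "G = (\<lambda>s y (u::real). if s = [] then (\<lambda>_. 0) else
    (THE x. x \<in> blocks n \<and> 0 < p y x \<and> bits (r y x + 1) = s))"
  define Tz where "Tz = (\<lambda>z. T (Yn n (fst z)) (Xn n (fst z)) (snd z))"
  have Tz [measurable]: "Measurable.pred (QN n) Tz"
    unfolding Tz_def by (rule measurable_QN[where h = "\<lambda>x y u. T y x u"]) (rule T_meas)
  have dec: "G (F z) (Yn n (fst z)) (snd z) = (if Tz z then Xn n (fst z) else (\<lambda>_. 0))" for z
  proof (cases "Tz z")
    case True
    let ?x = "Xn n (fst z)" and ?y = "Yn n (fst z)"
    have F: "F z = bits (r ?y ?x + 1)" "F z \<noteq> []"
      using True by (auto simp: F_def enc_def Tz_def bits_eq_Nil_iff)
    have "(THE x. x \<in> blocks n \<and> 0 < p ?y x \<and> bits (r ?y x + 1) = F z) = ?x"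
    proof (rule the_equality)
      have px: "0 < p ?y ?x" using True by (simp add: Tz_def T_def)
      then show "?x \<in> blocks n \<and> 0 < p ?y ?x \<and> bits (r ?y ?x + 1) = F z"
        by (simp only: F(1) Xn_in_blocks simp_thms)
      show "x = ?x" if x: "x \<in> blocks n \<and> 0 < p ?y x \<and> bits (r ?y x + 1) = F z" for x
      proof (rule r_inj[of x ?x ?y])
        have "bits (r ?y x + 1) = bits (r ?y ?x + 1)" using x by (simp only: F(1))
        then show "r ?y x = r ?y ?x" by (simp only: bits_inject add_right_cancel)
      qed (use x px in simp_all)
    qed
    then show ?thesis using True F by (simp add: G_def)
  qed (simp add: F_def enc_def Tz_def G_def)
  have "F \<in> QN n \<rightarrow>\<^sub>M count_space UNIV"
    unfolding F_def
  proof (rule measurable_QN)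
    fix x assume "x \<in> blocks n"
    note T_meas[OF this, measurable]
    have "(\<lambda>y. bits (r y x + 1)) \<in> PN n \<rightarrow>\<^sub>M count_space UNIV"
      by (rule measurable_compose[OF r_meas]) simp
    from measurable_compose[OF measurable_fst this]
    have [measurable]: "(\<lambda>(y, u). bits (r y x + 1)) \<in> PN n \<Otimes>\<^sub>M seed \<rightarrow>\<^sub>M count_space UNIV"
      by (simp add: case_prod_beta')
    have "(\<lambda>z. if (case z of (y, u) \<Rightarrow> T y x u) then (case z of (y, u) \<Rightarrow> bits (r y x + 1)) else [])
      \<in> PN n \<Otimes>\<^sub>M seed \<rightarrow>\<^sub>M count_space UNIV"
      by measurable
    then show "(\<lambda>(y, u). enc x y u) \<in> PN n \<Otimes>\<^sub>M seed \<rightarrow>\<^sub>M count_space UNIV"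
      by (simp add: enc_def case_prod_beta')
  qed
  moreover have "(\<lambda>z. restrict (G (F z) (Yn n (fst z)) (snd z)) {..<n}) \<in> QN n \<rightarrow>\<^sub>M PiM {..<n} (\<lambda>_. count_space UNIV)"
  proof (rule measurable_restrict)
    fix i assume "i \<in> {..<n}"
    then have [measurable]: "(\<lambda>z. fst (fst z i)) \<in> QN n \<rightarrow>\<^sub>M count_space UNIV"
      by (intro measurable_compose[OF measurable_fst measurable_Xn_nth]) simp
    have "(\<lambda>z. if Tz z then fst (fst z i) else 0) \<in> QN n \<rightarrow>\<^sub>M count_space UNIV" by measurable
    moreover have "G (F z) (Yn n (fst z)) (snd z) i = (if Tz z then fst (fst z i) else 0)" for z
      using \<open>i \<in> {..<n}\<close> by (simp add: dec Xn_def)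
    ultimately show "(\<lambda>z. G (F z) (Yn n (fst z)) (snd z) i) \<in> QN n \<rightarrow>\<^sub>M count_space UNIV" by simp
  qed
  moreover have "(\<integral>\<^sup>+z. ennreal (real (length (F z))) \<partial>QN n) \<le> ennreal (1 + integral\<^sup>L (PN n) D)"
  proof -
    note \<open>F \<in> QN n \<rightarrow>\<^sub>M count_space UNIV\<close>[measurable]
    have "(\<integral>\<^sup>+z. ennreal (real (length (F z))) \<partial>QN n) =
      (\<integral>\<^sup>+y. \<integral>\<^sup>+x. \<integral>\<^sup>+u. ennreal (real (length (F (zip_block n x y, u)))) \<partial>seed \<partial>BP n y \<partial>PN n)"
      by (rule nn_integral_QN) measurable
    also have "\<dots> \<le> (\<integral>\<^sup>+y. \<integral>\<^sup>+x. \<integral>\<^sup>+u. 1 + ?w y x u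
        \<partial>seed \<partial>BP n y \<partial>PN n)"
    proof (rule nn_integral_mono, rule nn_integral_mono_AE, rule AE_pmfI, rule nn_integral_mono)
      fix y x u assume y: "y \<in> space (PN n)" and "x \<in> set_pmf (block_pmf n K y)"
      then have x: "x \<in> blocks n" by (blast dest: subsetD[OF set_block_pmf])
      have "real (length (enc x y u)) \<le> 1 + block_info n x y * indicator {u. Tr y x u} u"
        using r_le[OF x, of y] block_info_nonneg[of n x y] by (auto simp: enc_def T_def)
      then have "ennreal (real (length (enc x y u))) \<le> ennreal (1 + block_info n x y * indicator {u. Tr y x u} u)"
        by (rule ennreal_leI)
      also have "\<dots> = 1 + ?w y x u"
        using block_info_nonneg[of n x y] by (auto simp: indicator_def)
      finally show "ennreal (real (length (F (zip_block n x y, u)))) \<le> 1 + ?w y x u"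
        using x y by (simp add: F_def)
    qed
    also have "\<dots> \<le> (\<integral>\<^sup>+y. 1 + ennreal (D y) \<partial>PN n)"
    proof (intro nn_integral_mono)
      fix y assume y: "y \<in> space (PN n)"
      have "(\<integral>\<^sup>+x. \<integral>\<^sup>+u. 1 + ?w y x u
        \<partial>seed \<partial>BP n y)
        = (\<integral>\<^sup>+x. 1 + (\<integral>\<^sup>+u. ?w y x u
        \<partial>seed) \<partial>BP n y)"
      proof (rule nn_integral_cong_AE, rule AE_pmfI)
        fix x assume "x \<in> set_pmf (block_pmf n K y)"
        then have x: "x \<in> blocks n" by (blast dest: subsetD[OF set_block_pmf])
        have [measurable]: "Measurable.pred seed (\<lambda>u. Tr y x u)"
          using measurable_compose[OF measurable_Pair1'[OF y] Tr[OF x]] by simp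
        show "(\<integral>\<^sup>+u. 1 + ?w y x u \<partial>seed)
           = 1 + (\<integral>\<^sup>+u. ?w y x u \<partial>seed)"
          by (subst nn_integral_add) (auto simp: U.emeasure_space_1[simplified])
      qed
      also have "\<dots> = 1 + (\<integral>\<^sup>+x. (\<integral>\<^sup>+u. ?w y x u
        \<partial>seed) \<partial>BP n y)"
        by (simp add: nn_integral_add)
      also have "\<dots> \<le> 1 + ennreal (D y)" by (intro add_left_mono cost y)
      finally show "(\<integral>\<^sup>+x. \<integral>\<^sup>+u. 1 + ?w y x u
        \<partial>seed \<partial>BP n y) \<le> 1 + ennreal (D y)" .
    qed
    also have "\<dots> = 1 + ennreal (integral\<^sup>L (PN n) D)"
      using D by (subst nn_integral_add) (auto simp: PNn.emeasure_space_1 nn_integral_eq_integral)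
    also have "\<dots> = ennreal (1 + integral\<^sup>L (PN n) D)"
      using D by (simp add: integral_nonneg_AE)
    finally show ?thesis .
  qed
  moreover have "AE z in QN n. real_cond_exp (QN n) (sigYn n)
      (indicator {z \<in> space (QN n). \<exists>i<n. G (F z) (Yn n (fst z)) (snd z) i \<noteq> fst (fst z i)}) z \<le> eps"
  proof -
    let ?E = "{z \<in> space (QN n). \<exists>i<n. G (F z) (Yn n (fst z)) (snd z) i \<noteq> fst (fst z i)}"
    \<comment> \<open>Every error is a rejection, but the default zero block may be a correct guess.
      The conditional probability is therefore computed for rejection and passed on to the error by
      monotonicity.\<close>
    let ?N = "{z \<in> space (QN n). \<not> Tz z}"
    have N_sets [measurable]: "?N \<in> sets (QN n)" by measurable
    have E_eq: "?E = (\<Union>i<n. {z \<in> space (QN n). \<not> Tz z \<and> fst (fst z i) \<noteq> 0})"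
      by (auto simp: dec Xn_def)
    have E_sets [measurable]: "?E \<in> sets (QN n)"
      unfolding E_eq
    proof (rule sets.finite_UN)
      fix i assume "i \<in> {..<n}"
      then have [measurable]: "(\<lambda>z. fst (fst z i)) \<in> QN n \<rightarrow>\<^sub>M count_space UNIV"
        by (intro measurable_compose[OF measurable_fst measurable_Xn_nth]) simp
      show "{z \<in> space (QN n). \<not> Tz z \<and> fst (fst z i) \<noteq> 0} \<in> sets (QN n)" by measurable
    qed simp
    have le: "indicator ?E z \<le> (indicator ?N z :: real)" for z
      using E_eq by (auto simp: indicator_def)
    have fin: "emeasure (QN n) A < \<infinity>" for A
      using Q.emeasure_finite[of A] by (simp only: infinity_ennreal_def less_top)
    note iE = integrable_real_indicator[OF E_sets fin] and iN = integrable_real_indicator[OF N_sets fin]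
    have miss: "(\<integral>\<^sup>+x. (\<integral>\<^sup>+u. indicator ?N (zip_block n x y, u) \<partial>seed) \<partial>BP n y) = ennreal eps"
      if y: "y \<in> space (PN n)" for y
    proof -
      let ?t = "\<lambda>x. \<integral>\<^sup>+u. indicator {u. Tr y x u} u \<partial>seed"
      let ?m = "\<lambda>x. \<integral>\<^sup>+u. indicator ?N (zip_block n x y, u) \<partial>seed"
      have sp: "(zip_block n x y, u) \<in> space (QN n)" for x u
        using measurable_space[OF measurable_zip_block' y] by (simp add: space_pair_measure)
      have "(\<integral>\<^sup>+x. ?t x \<partial>BP n y) + (\<integral>\<^sup>+x. ?m x \<partial>BP n y)
        = (\<integral>\<^sup>+x. ?t x + ?m x \<partial>BP n y)"
        by (rule nn_integral_add[symmetric]) auto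
      also have "\<dots> = (\<integral>\<^sup>+x. 1 \<partial>BP n y)"
      proof (rule nn_integral_cong_AE, rule AE_pmfI)
        fix x assume xs: "x \<in> set_pmf (block_pmf n K y)"
        then have x: "x \<in> blocks n" by (blast dest: subsetD[OF set_block_pmf])
        have px: "0 < p y x" using xs by (simp add: p_def pmf_positive)
        have [measurable]: "Measurable.pred seed (\<lambda>u. Tr y x u)"
          using measurable_compose[OF measurable_Pair1'[OF y] Tr[OF x]] by simp
        have eq: "indicator ?N (zip_block n x y, u) = (indicator {u. \<not> Tr y x u} u :: ennreal)" for u
          using sp px x y by (auto simp: indicator_def Tz_def T_def)
        have "?t x + ?m x = (\<integral>\<^sup>+u. indicator {u. Tr y x u} u + indicator {u. \<not> Tr y x u} u \<partial>seed)"
          unfolding eq by (rule nn_integral_add[symmetric]) measurable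
        also have "\<dots> = (\<integral>\<^sup>+u. 1 \<partial>seed)"
          by (intro nn_integral_cong) (auto simp: indicator_def)
        finally show "?t x + ?m x = 1" using U.emeasure_space_1 by simp
      qed
      finally have "ennreal (1 - eps) + (\<integral>\<^sup>+x. ?m x \<partial>BP n y) = ennreal (1 - eps) + ennreal eps"
        using eps by (simp add: power[OF y] flip: ennreal_plus)
      then show ?thesis by (simp add: ennreal_add_left_cancel)
    qed
    have "AE z in QN n. real_cond_exp (QN n) (sigYn n) (indicator ?N) z = eps"
    proof (rule sub.real_cond_exp_charact)
      fix A assume A: "A \<in> sets (sigYn n)"
      have "(\<lambda>z. Yn n (fst z)) \<in> QN n \<rightarrow>\<^sub>M PN n" by measurable
      then have "(\<lambda>z. Yn n (fst z)) \<in> space (QN n) \<rightarrow> space (PN n)"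
        by (intro Pi_I) (rule measurable_space)
      then obtain B where B [measurable]: "B \<in> sets (PN n)" and A_eq: "A = (\<lambda>z. Yn n (fst z)) -` B \<inter> space (QN n)"
        using A by (auto simp: sets_vimage_algebra2)
      have A_meas [measurable]: "A \<in> sets (QN n)" unfolding A_eq by measurable
      have "emeasure (QN n) (A \<inter> ?N) = (\<integral>\<^sup>+z. indicator (A \<inter> ?N) z \<partial>QN n)"
        by (rule nn_integral_indicator[symmetric]) measurable
      also have "\<dots> = (\<integral>\<^sup>+z. indicator B (Yn n (fst z)) * indicator ?N z \<partial>QN n)"
        by (intro nn_integral_cong) (auto simp: A_eq indicator_def)
      also have "\<dots> = (\<integral>\<^sup>+y. \<integral>\<^sup>+x. \<integral>\<^sup>+u. indicator B (Yn n (fst (zip_block n x y, u))) * indicator ?N (zip_block n x y, u)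
         \<partial>seed \<partial>BP n y \<partial>PN n)"
        by (rule nn_integral_QN) measurable
      also have "\<dots> = (\<integral>\<^sup>+y. indicator B y * ennreal eps \<partial>PN n)"
      proof (rule nn_integral_cong)
        fix y assume y: "y \<in> space (PN n)"
        have "(\<integral>\<^sup>+x. \<integral>\<^sup>+u. indicator B (Yn n (fst (zip_block n x y, u))) * indicator ?N (zip_block n x y, u)
         \<partial>seed \<partial>BP n y)
          = (\<integral>\<^sup>+x. indicator B y * (\<integral>\<^sup>+u. indicator ?N (zip_block n x y, u) \<partial>seed) \<partial>BP n y)"
          using y by (cases "y \<in> B") auto
        also have "\<dots> = indicator B y * ennreal eps"
          by (subst nn_integral_cmult) (auto simp: miss[OF y])
        finally show "(\<integral>\<^sup>+x. \<integral>\<^sup>+u. indicator B (Yn n (fst (zip_block n x y, u))) * indicator ?N (zip_block n x y, u)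
         \<partial>seed \<partial>BP n y) = indicator B y * ennreal eps" .
      qed
      also have "\<dots> = (\<integral>\<^sup>+z. indicator B (Yn n (fst z)) * ennreal eps \<partial>QN n)"
        by (rule nn_integral_QN_Yn[symmetric]) measurable
      also have "\<dots> = (\<integral>\<^sup>+z. indicator A z * ennreal eps \<partial>QN n)"
        by (intro nn_integral_cong) (auto simp: A_eq indicator_def)
      also have "\<dots> = emeasure (QN n) A * ennreal eps"
        by (subst nn_integral_multc, measurable) (simp only: nn_integral_indicator[OF A_meas])
      finally have "measure (QN n) (A \<inter> ?N) = measure (QN n) A * eps"
        using eps by (simp add: measure_def enn2real_mult)
      moreover have "(\<integral>z. indicator A z *\<^sub>R (indicator ?N z :: real) \<partial>QN n) = measure (QN n) (A \<inter> ?N)"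
      proof -
        have "(\<lambda>z. indicator A z *\<^sub>R (indicator ?N z :: real)) = indicator (A \<inter> ?N)"
          by (auto simp: indicator_def)
        moreover have "A \<inter> ?N \<inter> space (QN n) = A \<inter> ?N" by blast
        ultimately show ?thesis by (simp only: Bochner_Integration.integral_indicator)
      qed
      moreover have "A \<inter> space (QN n) = A" unfolding A_eq by blast
      ultimately show "(\<integral>z\<in>A. (indicator ?N z :: real) \<partial>QN n) = (\<integral>z\<in>A. eps \<partial>QN n)"
        by (simp add: set_lebesgue_integral_def)
    qed (rule iN, simp_all)
    moreover have "AE z in QN n. real_cond_exp (QN n) (sigYn n) (indicator ?E) z
        \<le> real_cond_exp (QN n) (sigYn n) (indicator ?N) z"
      by (rule sub.real_cond_exp_mono[OF AE_I2 iE iN]) (rule le)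
    ultimately show ?thesis by eventually_elim simp
  qed
  ultimately show ?thesis unfolding block_code_def by blast
qed

text \<open>The cost of the test that accepts everything, for \<open>eps = 0\<close>. Each
  coordinate of the block has its own marginal law, so linearity suffices.\<close>

lemma nn_integral_block_info:
  "(\<integral>\<^sup>+x. ennreal (block_info n x y) \<partial>BP n y) = ennreal (block_ent n y)"
proof -
  have "(\<integral>\<^sup>+x. ennreal (block_info n x y) \<partial>BP n y)
     = (\<Sum>i<n. \<integral>\<^sup>+x. ennreal (info (K (y i)) (x i)) \<partial>BP n y)"
    unfolding block_info_def by (simp add: info_nonneg nn_integral_sum flip: sum_ennreal)
  also have "\<dots> = (\<Sum>i<n. ennreal (ent (K (y i))))"
  proof (rule sum.cong)
    fix i assume i: "i \<in> {..<n}"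
    have "(\<integral>\<^sup>+x. ennreal (info (K (y i)) (x i)) \<partial>BP n y)
       = (\<integral>\<^sup>+x. ennreal (info (K (y i)) x) \<partial>map_pmf (\<lambda>x. x i) (block_pmf n K y))"
      by simp
    also have "map_pmf (\<lambda>x. x i) (block_pmf n K y) = K (y i)"
      unfolding block_pmf_def using i by (subst Pi_pmf_component) auto
    also have "(\<integral>\<^sup>+x. ennreal (info (K (y i)) x) \<partial>K (y i)) = ennreal (ent (K (y i)))"
      by (rule good_pmf_nn_integral_info[OF good])
    finally show "(\<integral>\<^sup>+x. ennreal (info (K (y i)) (x i)) \<partial>BP n y) = ennreal (ent (K (y i)))" .
  qed simp
  also have "\<dots> = ennreal (block_ent n y)" unfolding block_ent_def by (simp add: sum_ennreal ent_nonneg)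
  finally show ?thesis .
qed

text \<open>For given side information the cost of the threshold test is \<open>s * q\<close> minus
  the hinge loss at the quantile \<open>q\<close>. Replacing this loss by the Gaussian one and
  applying \<open>gauss_loss_dual\<close> bounds the cost by \<open>D\<close>. The final 1 is the
  extra bit, and \<open>(1 + C)\<^sup>2 / c\<close> comes from averaging the square root of the
  variance.\<close>

lemma achievability:
  fixes n :: nat
  assumes n: "0 < n" and eps: "0 \<le> eps" "eps \<le> 1"
  obtains F G L where "block_code n L eps F G"
    "0 < L" "L \<le> (1 - eps) * (n * H) - fG eps * sqrt (n * Vc) + (1 + C)\<^sup>2 / c + err n + 1"
proof -
  interpret PNn: prob_space "PN n" by (rule prob_space_PN)
  interpret U: prob_space seed by (rule prob_space_seed)
  define s where "s = 1 - eps"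
  define D where "D = (\<lambda>y. (1 - eps) * block_ent n y - fG eps * sqrt (block_var n y) + err n)"
  have U1: "(\<integral>\<^sup>+u. a \<partial>seed) = a" for a :: ennreal using U.emeasure_space_1 by simp
  \<comment> \<open>Quantiles need a level strictly between 0 and 1; at the two endpoints accepting
    everything or nothing has the right power.\<close>
  define Tr where "Tr = (\<lambda>y x u. if eps = 0 then True else if eps = 1 then False
     else np_test (block_pmf n K y) (\<lambda>x. block_info n x y) s x u)"
  have power: "(\<integral>\<^sup>+x. (\<integral>\<^sup>+u. indicator {u. Tr y x u} u \<partial>seed) \<partial>BP n y) = ennreal (1 - eps)" (is ?A)
    and cost: "(\<integral>\<^sup>+x. (\<integral>\<^sup>+u. ennreal (block_info n x y) * indicator {u. Tr y x u} u \<partial>seed) \<partial>BP n y)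
       \<le> ennreal (D y)" (is ?B) and D_nonneg: "0 \<le> D y" (is ?C) for y
  proof -
    consider "eps = 0" | "eps = 1" | "0 < s" "s < 1" "eps \<noteq> 0" "eps \<noteq> 1" using eps by (fastforce simp: s_def)
    then have "?A \<and> ?B \<and> ?C"
    proof cases
      case 1
      have "block_ent n y \<le> D y" using 1 err_nonneg[OF n] by (simp add: D_def fG_def)
      then show ?thesis
        using 1 block_ent_nonneg[of n y] U1 by (simp add: Tr_def nn_integral_block_info ennreal_leI)
    next
      case 2
      then show ?thesis using err_nonneg[OF n] by (simp add: Tr_def D_def fG_def)
    next
      case 3
      define q where "q = quantile (block_pmf n K y) (\<lambda>x. block_info n x y) s"
      define u where "u = q - block_ent n y"
      note T = np_test[OF 3(1,2), where S = "\<lambda>x. block_info n x y" and p = "block_pmf n K y",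
          OF block_info_nonneg, folded q_def]
      let ?c = "\<integral>\<^sup>+x. (\<integral>\<^sup>+u. ennreal (block_info n x y) * indicator {u. Tr y x u} u \<partial>seed) \<partial>BP n y"
      let ?h = "\<integral>\<^sup>+x. ennreal (max 0 (q - block_info n x y)) \<partial>BP n y"
      \<comment> \<open>The right-hand side is finite, hence so are cost and hinge loss, and the
        identity may be rearranged in the reals.\<close>
      have sum: "?c + ?h = ennreal (s * q)" using T(2) 3 by (simp add: Tr_def)
      then have "?c + ?h < \<infinity>" by simp
      then have "?c < \<infinity>" "?h < \<infinity>" by (auto simp: ennreal_add_eq_top less_top)
      define c' where "c' = enn2real ?c"
      define h' where "h' = enn2real ?h"
      have c': "?c = ennreal c'" "0 \<le> c'" and h': "?h = ennreal h'" "0 \<le> h'"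
        unfolding c'_def h'_def using \<open>?c < \<infinity>\<close> \<open>?h < \<infinity>\<close> by simp_all
      have q0: "0 \<le> q" unfolding q_def by (intro quantile(4) 3 block_info_nonneg)
      have ch: "c' + h' = s * q"
        using sum c' h' 3 q0 by (simp flip: ennreal_plus)
      have "ennreal (gauss_loss (block_var n y) u) \<le> ennreal (h' + err n)"
        using Lindeberg_block(2)[OF n, where t = q and y = y] h' err_nonneg[OF n] unfolding u_def
        by (simp flip: ennreal_plus)
      then have "gauss_loss (block_var n y) u \<le> h' + err n"
        using h' err_nonneg[OF n] by (subst (asm) ennreal_le_iff) auto
      moreover have "s * u + sqrt (block_var n y) * fG s \<le> gauss_loss (block_var n y) u"
        using block_var_bounds(1)[of n y] 3 by (intro gauss_loss_dual) auto
      ultimately have "c' \<le> D y"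
        using ch unfolding D_def u_def s_def fG_one_minus by (simp add: algebra_simps)
      then show ?thesis using c' T(1) 3 by (simp add: Tr_def s_def ennreal_leI)
    qed
    then show ?A ?B ?C by auto
  qed
  have meas: "Measurable.pred (PN n \<Otimes>\<^sub>M seed) (\<lambda>(y, u). Tr y x u)" if "x \<in> blocks n" for x
  proof (cases "eps = 0 \<or> eps = 1")
    case False
    have "Measurable.pred (PN n \<Otimes>\<^sub>M seed) (\<lambda>(y, u). np_test (block_pmf n K y) (\<lambda>x. block_info n x y) s x u)"
      using False eps that by (intro measurable_np_test block_info_nonneg) (auto simp: s_def)
    then show ?thesis using False by (simp add: Tr_def)
  next
    case True
    then have "(\<lambda>(y, u). Tr y x u) = (\<lambda>_. eps = 0)" by (auto simp: Tr_def fun_eq_iff)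
    then show ?thesis by (simp only: measurable_const) measurable
  qed
  have iD: "integrable (PN n) D"
    unfolding D_def using integrable_block_ent integrable_sqrt_block_var by simp
  have "integral\<^sup>L (PN n) D = (1 - eps) * (n * H) - fG eps * integral\<^sup>L (PN n) (\<lambda>y. sqrt (block_var n y)) + err n"
    unfolding D_def using integrable_block_ent[of n] integrable_sqrt_block_var[of n]
    by (simp add: PNn.prob_space integral_block_ent)
  also have "\<dots> \<le> (1 - eps) * (n * H) - fG eps * (sqrt (n * Vc) - (1 + C)\<^sup>2 / c) + err n"
    by (intro add_mono diff_mono mult_left_mono integral_sqrt_block_var_ge fG_nonneg order_refl)
  also have "\<dots> \<le> (1 - eps) * (n * H) - fG eps * sqrt (n * Vc) + (1 + C)\<^sup>2 / c + err n"
    using mult_right_mono[OF fG_le_1[of eps], of "(1 + C)\<^sup>2 / c"] c by (simp add: algebra_simps)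
  finally have D_le: "integral\<^sup>L (PN n) D \<le> (1 - eps) * (n * H) - fG eps * sqrt (n * Vc) + (1 + C)\<^sup>2 / c + err n" .
  have D0: "0 \<le> integral\<^sup>L (PN n) D" by (intro integral_nonneg_AE) (simp add: D_nonneg)
  from achievability_aux[OF n eps meas power cost iD D_nonneg]
  obtain F G where "block_code n (1 + integral\<^sup>L (PN n) D) eps F G" by blast
  then show thesis by (rule that) (use D_le D0 in auto)
qed

end

section \<open>Disintegration\<close>

locale disintegration = prob_space M for M :: "'a measure" +
  fixes X :: "'a \<Rightarrow> nat" and Y :: "'a \<Rightarrow> 'y" and N :: "'y measure" and K :: "'y \<Rightarrow> nat pmf"
  assumes X [measurable]: "X \<in> M \<rightarrow>\<^sub>M count_space UNIV" and Y [measurable]: "Y \<in> M \<rightarrow>\<^sub>M N"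
    and K: "\<And>x. (\<lambda>y. pmf (K y) x) \<in> borel_measurable (distr M N Y)"
    and PXY_eq: "PXY M X Y N = joint (distr M N Y) K"
begin

sublocale S: source "distr M N Y" K
  by (rule source.intro[OF prob_space_distr[OF Y]]) (simp add: source_axioms_def K[unfolded measurable_distr_eq1])

lemma nn_integral_XY:
  assumes f [measurable]: "f \<in> borel_measurable (count_space UNIV \<Otimes>\<^sub>M N)"
  shows "(\<integral>\<^sup>+\<omega>. f (X \<omega>, Y \<omega>) \<partial>M) = (\<integral>\<^sup>+y. \<integral>\<^sup>+x. f (x, y) \<partial>K y \<partial>distr M N Y)"
proof -
  have "(\<integral>\<^sup>+\<omega>. f (X \<omega>, Y \<omega>) \<partial>M) = (\<integral>\<^sup>+\<omega>. f \<omega> \<partial>PXY M X Y N)"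
    unfolding PXY_def by (subst nn_integral_distr) auto
  also have "\<dots> = (\<integral>\<^sup>+y. \<integral>\<^sup>+x. f (x, y) \<partial>K y \<partial>distr M N Y)"
    unfolding PXY_eq by (rule S.nn_integral_joint) measurable
  finally show ?thesis .
qed

lemma measurable_kernel_integral:
  assumes f: "f \<in> borel_measurable (count_space UNIV \<Otimes>\<^sub>M N)"
  shows "(\<lambda>y. \<integral>\<^sup>+x. f (x, y) \<partial>K y) \<in> borel_measurable N"
proof (rule borel_measurable_nn_integral_pmf[of UNIV])
  show "(\<lambda>y. pmf (K y) x) \<in> borel_measurable N" for x using K[of x] by simp
  note f[measurable]
  show "(\<lambda>y. f (x, y)) \<in> borel_measurable N" for x by measurable
qed auto

lemma subalgebra_sigY: "finite_measure_subalgebra M (sigY M Y N)"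
proof -
  have "Y \<in> space M \<rightarrow> space N" by (intro Pi_I measurable_space[OF Y])
  then have "subalgebra M (sigY M Y N)"
    unfolding subalgebra_def sigY_def using measurable_sets[OF Y] by (simp only: sets_vimage_algebra2) auto
  then show ?thesis by unfold_locales
qed

text \<open>Equality with a function of the pair is asked only almost everywhere, because
  \<open>iota\<close> and \<open>calH\<close> are built from versions of conditional
  expectations.\<close>

lemma nn_cond_exp_XY:
  assumes f [measurable]: "f \<in> borel_measurable (count_space UNIV \<Otimes>\<^sub>M N)"
    and g [measurable]: "g \<in> borel_measurable M" and eq: "AE \<omega> in M. g \<omega> = f (X \<omega>, Y \<omega>)"
  shows "AE \<omega> in M. nn_cond_exp M (sigY M Y N) g \<omega> = (\<integral>\<^sup>+x. f (x, Y \<omega>) \<partial>K (Y \<omega>))"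
proof -
  interpret sub: finite_measure_subalgebra M "sigY M Y N" by (rule subalgebra_sigY)
  note [measurable] = measurable_kernel_integral[OF f]
  have "AE \<omega> in M. (\<integral>\<^sup>+x. f (x, Y \<omega>) \<partial>K (Y \<omega>)) = nn_cond_exp M (sigY M Y N) g \<omega>"
  proof (rule sub.nn_cond_exp_charact)
    fix A assume A: "A \<in> sets (sigY M Y N)"
    have "Y \<in> space M \<rightarrow> space N" by (intro Pi_I measurable_space[OF Y])
    then obtain B where B [measurable]: "B \<in> sets N" and A_eq: "A = Y -` B \<inter> space M"
      using A by (auto simp: sigY_def sets_vimage_algebra2)
    have "(\<integral>\<^sup>+\<omega>\<in>A. g \<omega> \<partial>M) = (\<integral>\<^sup>+\<omega>. f (X \<omega>, Y \<omega>) * indicator B (Y \<omega>) \<partial>M)"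
      using eq by (intro nn_integral_cong_AE) (auto elim!: eventually_mono simp: A_eq indicator_def)
    also have "\<dots> = (\<integral>\<^sup>+y. \<integral>\<^sup>+x. f (x, y) * indicator B y \<partial>K y \<partial>distr M N Y)"
      using nn_integral_XY[of "\<lambda>(x, y). f (x, y) * indicator B y"] by simp
    also have "\<dots> = (\<integral>\<^sup>+y. (\<integral>\<^sup>+x. f (x, y) \<partial>K y) * indicator B y \<partial>distr M N Y)"
      by (simp add: nn_integral_multc)
    also have "\<dots> = (\<integral>\<^sup>+\<omega>. (\<integral>\<^sup>+x. f (x, Y \<omega>) \<partial>K (Y \<omega>)) * indicator B (Y \<omega>) \<partial>M)"
      by (subst nn_integral_distr) auto
    also have "\<dots> = (\<integral>\<^sup>+\<omega>\<in>A. (\<integral>\<^sup>+x. f (x, Y \<omega>) \<partial>K (Y \<omega>)) \<partial>M)"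
      by (intro nn_integral_cong) (auto simp: A_eq indicator_def)
    finally show "(\<integral>\<^sup>+\<omega>\<in>A. g \<omega> \<partial>M) = (\<integral>\<^sup>+\<omega>\<in>A. (\<integral>\<^sup>+x. f (x, Y \<omega>) \<partial>K (Y \<omega>)) \<partial>M)" .
  next
    have "Y \<in> sigY M Y N \<rightarrow>\<^sub>M N"
      unfolding sigY_def by (rule measurable_vimage_algebra1) (intro Pi_I measurable_space[OF Y])
    then show "(\<lambda>\<omega>. \<integral>\<^sup>+x. f (x, Y \<omega>) \<partial>K (Y \<omega>)) \<in> borel_measurable (sigY M Y N)"
      by (rule measurable_compose) measurable
  qed measurable
  then show ?thesis by eventually_elim simp
qed

lemma real_cond_exp_XY:
  assumes f [measurable]: "f \<in> borel_measurable (count_space UNIV \<Otimes>\<^sub>M N)" and f0: "\<And>z. 0 \<le> f z"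
    and g [measurable]: "g \<in> borel_measurable M" and eq: "AE \<omega> in M. g \<omega> = f (X \<omega>, Y \<omega>)"
  shows "AE \<omega> in M. real_cond_exp M (sigY M Y N) g \<omega> = enn2real (\<integral>\<^sup>+x. ennreal (f (x, Y \<omega>)) \<partial>K (Y \<omega>))"
proof -
  have "AE \<omega> in M. nn_cond_exp M (sigY M Y N) (\<lambda>\<omega>. ennreal (g \<omega>)) \<omega> = (\<integral>\<^sup>+x. ennreal (f (x, Y \<omega>)) \<partial>K (Y \<omega>))"
    using eq by (intro nn_cond_exp_XY) (auto elim!: eventually_mono)
  moreover have "AE \<omega> in M. nn_cond_exp M (sigY M Y N) (\<lambda>\<omega>. ennreal (- g \<omega>)) \<omega> = (\<integral>\<^sup>+x. 0 \<partial>K (Y \<omega>))"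
    using eq f0 by (intro nn_cond_exp_XY[of "\<lambda>_. 0"]) (auto elim!: eventually_mono simp: ennreal_neg)
  ultimately show ?thesis unfolding real_cond_exp_def by eventually_elim simp
qed

lemma measurable_XY_fun:
  fixes f :: "nat \<Rightarrow> 'y \<Rightarrow> 'b :: topological_space"
  assumes "\<And>x. f x \<in> borel_measurable N"
  shows "(\<lambda>(x, y). f x y) \<in> borel_measurable (count_space UNIV \<Otimes>\<^sub>M N)"
  by (rule measurable_pair_measure_countable1) (auto simp: assms)

lemma ent_eq_nn_integral: "ent (K y) = enn2real (\<integral>\<^sup>+x. ennreal (info (K y) x) \<partial>K y)"
  unfolding ent_def by (rule integral_eq_nn_integral) (auto simp: info_nonneg)

lemma varent_eq_nn_integral:
  "varent (K y) = enn2real (\<integral>\<^sup>+x. ennreal ((info (K y) x - ent (K y))\<^sup>2) \<partial>K y)"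
  unfolding varent_def by (rule integral_eq_nn_integral) auto

lemma measurable_ent_N [measurable]: "(\<lambda>y. ent (K y)) \<in> borel_measurable N"
proof -
  have [measurable]: "(\<lambda>y. \<integral>\<^sup>+x. ennreal (info (K y) x) \<partial>K y) \<in> borel_measurable N"
    using measurable_kernel_integral[OF measurable_XY_fun[of "\<lambda>x y. ennreal (info (K y) x)"]] by simp
  show ?thesis unfolding ent_eq_nn_integral by measurable
qed

text \<open>Countably many exceptional sets are merged into one, since \<open>iota\<close> evaluates
  the conditional probability at the random value of \<open>X\<close>.\<close>

lemma condP_eq: "AE \<omega> in M. \<forall>x. condP M X Y N x \<omega> = pmf (K (Y \<omega>)) x"
  unfolding AE_all_countable
proof
  fix x
  have "AE \<omega> in M. condP M X Y N x \<omega> =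
      enn2real (\<integral>\<^sup>+x'. ennreal (case (x', Y \<omega>) of (x', y) \<Rightarrow> indicator {x} x') \<partial>K (Y \<omega>))"
    unfolding condP_def
    by (rule real_cond_exp_XY) (auto intro!: measurable_XY_fun AE_I2 simp: indicator_def)
  then show "AE \<omega> in M. condP M X Y N x \<omega> = pmf (K (Y \<omega>)) x"
  proof eventually_elim
    case (elim \<omega>)
    have "(\<integral>\<^sup>+x'. ennreal (case (x', Y \<omega>) of (x', y) \<Rightarrow> indicator {x} x') \<partial>K (Y \<omega>))
      = (\<integral>\<^sup>+x'. indicator {x} x' \<partial>K (Y \<omega>))"
      by (intro nn_integral_cong) (auto simp: indicator_def)
    also have "\<dots> = ennreal (pmf (K (Y \<omega>)) x)" by (simp add: emeasure_pmf_single)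
    finally show ?case using elim by simp
  qed
qed

lemma iota_eq: "AE \<omega> in M. iota M X Y N \<omega> = info (K (Y \<omega>)) (X \<omega>)"
  using condP_eq by eventually_elim (simp add: iota_def info_def)

context
  assumes iota [measurable]: "iota M X Y N \<in> borel_measurable M"
begin

lemma calH_eq: "AE \<omega> in M. calH M X Y N \<omega> = ent (K (Y \<omega>))"
proof -
  have "AE \<omega> in M. calH M X Y N \<omega> =
      enn2real (\<integral>\<^sup>+x. ennreal (case (x, Y \<omega>) of (x, y) \<Rightarrow> info (K y) x) \<partial>K (Y \<omega>))"
    unfolding calH_def using iota_eq
    by (intro real_cond_exp_XY measurable_XY_fun) (auto simp: info_nonneg)
  then show ?thesis by eventually_elim (simp add: ent_eq_nn_integral)
qed

lemma calV_eq:
  "AE \<omega> in M. calV M X Y N \<omega> = (\<integral>\<^sup>+x. ennreal ((info (K (Y \<omega>)) x - ent (K (Y \<omega>)))\<^sup>2) \<partial>K (Y \<omega>))"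
proof -
  have [measurable]: "calH M X Y N \<in> borel_measurable M" unfolding calH_def by measurable
  have "AE \<omega> in M. calV M X Y N \<omega> =
      (\<integral>\<^sup>+x. (case (x, Y \<omega>) of (x, y) \<Rightarrow> ennreal ((info (K y) x - ent (K y))\<^sup>2)) \<partial>K (Y \<omega>))"
    unfolding calV_def
  proof (intro nn_cond_exp_XY measurable_XY_fun)
    show "AE \<omega> in M. ennreal ((iota M X Y N \<omega> - calH M X Y N \<omega>)\<^sup>2) =
      (case (X \<omega>, Y \<omega>) of (x, y) \<Rightarrow> ennreal ((info (K y) x - ent (K y))\<^sup>2))"
      using iota_eq calH_eq by eventually_elim simp
  qed measurable
  then show ?thesis by simp
qed

lemma calT_eq:
  "AE \<omega> in M. calT M X Y N \<omega> = (\<integral>\<^sup>+x. ennreal (\<bar>info (K (Y \<omega>)) x - ent (K (Y \<omega>))\<bar> ^ 3) \<partial>K (Y \<omega>))"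
proof -
  have [measurable]: "calH M X Y N \<in> borel_measurable M" unfolding calH_def by measurable
  have "AE \<omega> in M. calT M X Y N \<omega> =
      (\<integral>\<^sup>+x. (case (x, Y \<omega>) of (x, y) \<Rightarrow> ennreal (\<bar>info (K y) x - ent (K y)\<bar> ^ 3)) \<partial>K (Y \<omega>))"
    unfolding calT_def
  proof (intro nn_cond_exp_XY measurable_XY_fun)
    show "AE \<omega> in M. ennreal (\<bar>iota M X Y N \<omega> - calH M X Y N \<omega>\<bar> ^ 3) =
      (case (X \<omega>, Y \<omega>) of (x, y) \<Rightarrow> ennreal (\<bar>info (K y) x - ent (K y)\<bar> ^ 3))"
      using iota_eq calH_eq by eventually_elim simp
  qed measurable
  then show ?thesis by simp
qed

text \<open>Integrability of \<open>iota\<close> makes the conditional entropy finite almost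
  everywhere; the other two conditions are the hypotheses read under the law of
  \<open>Y\<close>.\<close>

lemma AE_good_pmf:
  assumes int: "integrable M (iota M X Y N)"
    and V: "AE \<omega> in M. ennreal c \<le> calV M X Y N \<omega>" and T: "AE \<omega> in M. calT M X Y N \<omega> \<le> ennreal C"
    and C: "0 \<le> C"
  shows "AE y in distr M N Y. good_pmf c C (K y)"
proof -
  let ?I = "\<lambda>y. \<integral>\<^sup>+x. ennreal (info (K y) x) \<partial>K y"
  let ?V = "\<lambda>y. \<integral>\<^sup>+x. ennreal ((info (K y) x - ent (K y))\<^sup>2) \<partial>K y"
  let ?T = "\<lambda>y. \<integral>\<^sup>+x. ennreal (\<bar>info (K y) x - ent (K y)\<bar> ^ 3) \<partial>K y"
  have [measurable]: "?I \<in> borel_measurable N"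
    using measurable_kernel_integral[OF measurable_XY_fun[of "\<lambda>x y. ennreal (info (K y) x)"]] by simp
  have [measurable]: "?V \<in> borel_measurable N"
    using measurable_kernel_integral[OF measurable_XY_fun[of "\<lambda>x y. ennreal ((info (K y) x - ent (K y))\<^sup>2)"]] by simp
  have [measurable]: "?T \<in> borel_measurable N"
    using measurable_kernel_integral[OF measurable_XY_fun[of "\<lambda>x y. ennreal (\<bar>info (K y) x - ent (K y)\<bar> ^ 3)"]] by simp
  have "(\<integral>\<^sup>+y. ?I y \<partial>distr M N Y) = (\<integral>\<^sup>+\<omega>. ennreal (info (K (Y \<omega>)) (X \<omega>)) \<partial>M)"
    using nn_integral_XY[OF measurable_XY_fun[of "\<lambda>x y. ennreal (info (K y) x)"]] by simp
  also have "\<dots> = (\<integral>\<^sup>+\<omega>. ennreal (norm (iota M X Y N \<omega>)) \<partial>M)"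
    using iota_eq by (intro nn_integral_cong_AE) (auto elim!: eventually_mono simp: info_nonneg)
  also have "\<dots> < \<infinity>" using int by (simp add: integrable_iff_bounded)
  finally have "AE y in distr M N Y. ?I y \<noteq> \<infinity>" by (intro nn_integral_PInf_AE) auto
  moreover have "AE y in distr M N Y. ennreal c \<le> ?V y"
    using V calV_eq by (subst AE_distr_iff) (auto elim!: eventually_elim2)
  moreover have "AE y in distr M N Y. ?T y \<le> ennreal C"
    using T calT_eq by (subst AE_distr_iff) (auto elim!: eventually_elim2)
  ultimately show ?thesis
  proof eventually_elim
    case (elim y)
    \<comment> \<open>\<open>varent\<close> is a Bochner integral and would be 0 without
      integrability; the third moment excludes this and carries the lower bound over.\<close>
    have "integrable (measure_pmf (K y)) (\<lambda>x. (info (K y) x - ent (K y))\<^sup>2)"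
      by (rule cube_moment(2)[OF elim(3) C])
    then have "?V y = ennreal (varent (K y))"
      unfolding varent_def by (intro nn_integral_eq_integral) auto
    then have "c \<le> varent (K y)" using elim(2) varent_nonneg[of "K y"] by simp
    moreover have "integrable (measure_pmf (K y)) (info (K y))"
      using elim(1) by (intro integrableI_bounded) (auto simp: info_nonneg less_top)
    ultimately show "good_pmf c C (K y)" using elim(3) by (simp add: good_pmf_def)
  qed
qed

lemma integrable_ent:
  assumes "integrable M (iota M X Y N)"
  shows "integrable (distr M N Y) (\<lambda>y. ent (K y))"
proof -
  interpret sub: finite_measure_subalgebra M "sigY M Y N" by (rule subalgebra_sigY)
  have "integrable M (calH M X Y N)" unfolding calH_def by (rule sub.real_cond_exp_int(1)[OF assms])
  then have "integrable M (\<lambda>\<omega>. ent (K (Y \<omega>)))"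
    using calH_eq by (subst integrable_cong_AE[symmetric]) auto
  then show ?thesis by (subst integrable_distr_eq) auto
qed

lemma condH_eq: "condH M X Y N = integral\<^sup>L (distr M N Y) (\<lambda>y. ent (K y))"
proof -
  have [measurable]: "calH M X Y N \<in> borel_measurable M" unfolding calH_def by measurable
  have "condH M X Y N = (\<integral>\<omega>. ent (K (Y \<omega>)) \<partial>M)"
    unfolding condH_def using calH_eq by (intro integral_cong_AE) auto
  then show ?thesis by (subst integral_distr) auto
qed

lemma condVc_eq:
  assumes "\<And>y. good_pmf c C (K y)" "0 \<le> C"
  shows "condVc M X Y N = integral\<^sup>L (distr M N Y) (\<lambda>y. varent (K y))"
proof -
  let ?V = "\<lambda>y. \<integral>\<^sup>+x. ennreal ((info (K y) x - ent (K y))\<^sup>2) \<partial>K y"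
  have V: "?V y = ennreal (varent (K y))" for y by (rule good_pmf_nn_integral_square[OF assms])
  have [measurable]: "?V \<in> borel_measurable N"
    using measurable_kernel_integral[OF measurable_XY_fun[of "\<lambda>x y. ennreal ((info (K y) x - ent (K y))\<^sup>2)"]] by simp
  have [measurable]: "(\<lambda>y. varent (K y)) \<in> borel_measurable N"
    unfolding varent_eq_nn_integral by measurable
  have "(\<integral>\<^sup>+\<omega>. calV M X Y N \<omega> \<partial>M) = (\<integral>\<^sup>+\<omega>. ennreal (varent (K (Y \<omega>))) \<partial>M)"
    using calV_eq by (intro nn_integral_cong_AE) (simp add: V)
  also have "\<dots> = (\<integral>\<^sup>+y. ennreal (varent (K y)) \<partial>distr M N Y)"
    by (subst nn_integral_distr) auto
  finally show ?thesis
    unfolding condVc_def by (subst integral_eq_nn_integral) (auto simp: varent_nonneg)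
qed

end

end

text \<open>The joint law sees the kernel only through integrals over \<open>y\<close>, so a change
  on a null set is invisible.\<close>

lemma disintegration_modify:
  assumes "disintegration M X Y N K"
    and K': "\<And>x. (\<lambda>y. pmf (K' y) x) \<in> borel_measurable N"
    and eq: "AE y in distr M N Y. K' y = K y"
  shows "disintegration M X Y N K'"
proof -
  interpret disintegration M X Y N K by fact
  have K'm: "(\<lambda>y. pmf (K' y) x) \<in> borel_measurable (distr M N Y)" for x using K'[of x] by simp
  interpret S': source "distr M N Y" K'
    by (rule source.intro[OF prob_space_distr[OF Y]]) (simp add: source_axioms_def K')
  have "joint (distr M N Y) K = joint (distr M N Y) K'"
  proof (rule measure_eqI)
    fix A assume A: "A \<in> sets (joint (distr M N Y) K)"
    then have [measurable]: "A \<in> sets (count_space UNIV \<Otimes>\<^sub>M distr M N Y)" by (simp add: S.sets_joint)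
    have "emeasure (joint (distr M N Y) K) A = (\<integral>\<^sup>+\<omega>. indicator A \<omega> \<partial>joint (distr M N Y) K)"
      using A by simp
    also have "\<dots> = (\<integral>\<^sup>+y. \<integral>\<^sup>+x. indicator A (x, y) \<partial>K y \<partial>distr M N Y)"
      by (rule S.nn_integral_joint) measurable
    also have "\<dots> = (\<integral>\<^sup>+y. \<integral>\<^sup>+x. indicator A (x, y) \<partial>K' y \<partial>distr M N Y)"
      using eq by (intro nn_integral_cong_AE) (auto elim!: eventually_mono)
    also have "\<dots> = (\<integral>\<^sup>+\<omega>. indicator A \<omega> \<partial>joint (distr M N Y) K')"
      by (rule S'.nn_integral_joint[symmetric]) measurable
    also have "\<dots> = emeasure (joint (distr M N Y) K') A"
      using A by (intro nn_integral_indicator) (simp add: S.sets_joint S'.sets_joint)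
    finally show "emeasure (joint (distr M N Y) K) A = emeasure (joint (distr M N Y) K') A" .
  qed (simp add: S.sets_joint S'.sets_joint)
  then show ?thesis
    using PXY_eq X Y K'm by (intro disintegration.intro prob_space_axioms) (simp add: disintegration_axioms_def)
qed

text \<open>Since \<^term>\<open>X\<close> is discrete, a regular conditional distribution given \<^term>\<open>Y\<close> exists for an
  arbitrary measurable space of values of \<^term>\<open>Y\<close>: take one Radon-Nikodym derivative per value of \<^term>\<open>X\<close>.\<close>
lemma disintegration_exists:
  assumes "prob_space M" and X [measurable]: "X \<in> M \<rightarrow>\<^sub>M count_space UNIV" and Y [measurable]: "Y \<in> M \<rightarrow>\<^sub>M N"
  obtains K where "disintegration M X Y N K"
proof -
  interpret prob_space M by fact
  define P where "P = distr M N Y"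
  interpret P: prob_space P unfolding P_def by (rule prob_space_distr[OF Y])
  have sP [measurable_cong, simp]: "sets P = sets N" and spP: "space P = space N" by (simp_all add: P_def)
  \<comment> \<open>The part of the law of \<open>Y\<close> that falls on the event where
    \<open>X\<close> equals \<open>x\<close>.\<close>
  define \<nu> where "\<nu> = (\<lambda>x. distr (density M (indicator (X -` {x} \<inter> space M))) N Y)"
  define q where "q = (\<lambda>x. RN_deriv P (\<nu> x))"
  have [measurable]: "X -` {x} \<inter> space M \<in> sets M" for x by (rule measurable_sets[OF X]) simp
  have \<nu>: "emeasure (\<nu> x) B = emeasure M {\<omega> \<in> space M. X \<omega> = x \<and> Y \<omega> \<in> B}" if [measurable]: "B \<in> sets N" for x B
  proof -
    have "emeasure (\<nu> x) B = emeasure (density M (indicator (X -` {x} \<inter> space M))) (Y -` B \<inter> space M)"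
      unfolding \<nu>_def by (subst emeasure_distr) auto
    also have "\<dots> = (\<integral>\<^sup>+\<omega>. indicator (X -` {x} \<inter> space M) \<omega> * indicator (Y -` B \<inter> space M) \<omega> \<partial>M)"
      by (subst emeasure_density) auto
    also have "\<dots> = (\<integral>\<^sup>+\<omega>. indicator {\<omega> \<in> space M. X \<omega> = x \<and> Y \<omega> \<in> B} \<omega> \<partial>M)"
      by (intro nn_integral_cong) (auto simp: indicator_def)
    finally show ?thesis by simp
  qed
  have [measurable]: "q x \<in> borel_measurable N" for x
    using borel_measurable_RN_deriv[of P "\<nu> x"] by (simp add: q_def)
  have q: "(\<integral>\<^sup>+y. q x y * indicator B y \<partial>P) = emeasure M {\<omega> \<in> space M. X \<omega> = x \<and> Y \<omega> \<in> B}"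
    if [measurable]: "B \<in> sets N" for x B
  proof -
    have "absolutely_continuous P (\<nu> x)"
      unfolding absolutely_continuous_def
    proof
      fix B assume "B \<in> null_sets P"
      then have B: "B \<in> sets N" "emeasure P B = 0" by auto
      have "emeasure (\<nu> x) B \<le> emeasure M (Y -` B \<inter> space M)"
        unfolding \<nu>[OF B(1)] using B(1) by (intro emeasure_mono) auto
      also have "\<dots> = 0" using B by (simp add: P_def emeasure_distr)
      finally show "B \<in> null_sets (\<nu> x)" using B(1) by (auto simp: \<nu>_def intro!: null_setsI)
    qed
    then have "density P (q x) = \<nu> x"
      unfolding q_def by (rule P.density_RN_deriv) (simp add: \<nu>_def)
    then have "emeasure (\<nu> x) B = emeasure (density P (q x)) B" by simp
    also have "\<dots> = (\<integral>\<^sup>+y. q x y * indicator B y \<partial>P)" by (rule emeasure_density) auto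
    finally show ?thesis using \<nu>[OF that] by simp
  qed
  \<comment> \<open>The set may depend on \<open>x\<close>, so that this also covers the sections of
    an arbitrary measurable set of pairs.\<close>
  have q_sum: "(\<integral>\<^sup>+y. (\<Sum>x. q x y * indicator (B x) y) \<partial>P) = emeasure M {\<omega> \<in> space M. Y \<omega> \<in> B (X \<omega>)}"
    if [measurable]: "\<And>x. B x \<in> sets N" for B
  proof -
    have "(\<integral>\<^sup>+y. (\<Sum>x. q x y * indicator (B x) y) \<partial>P) = (\<Sum>x. \<integral>\<^sup>+y. q x y * indicator (B x) y \<partial>P)"
      by (rule nn_integral_suminf) measurable
    also have "\<dots> = (\<Sum>x. emeasure M {\<omega> \<in> space M. X \<omega> = x \<and> Y \<omega> \<in> B x})"
      by (simp add: q)
    also have "\<dots> = emeasure M (\<Union>x. {\<omega> \<in> space M. X \<omega> = x \<and> Y \<omega> \<in> B x})"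
      by (intro suminf_emeasure) (auto simp: disjoint_family_on_def)
    also have "(\<Union>x. {\<omega> \<in> space M. X \<omega> = x \<and> Y \<omega> \<in> B x}) = {\<omega> \<in> space M. Y \<omega> \<in> B (X \<omega>)}" by auto
    finally show ?thesis .
  qed
  \<comment> \<open>Summed over \<open>x\<close>, the derivatives form a density of the law of
    \<open>Y\<close> with respect to itself, and densities are unique.\<close>
  have one: "AE y in P. (\<Sum>x. q x y) = 1"
  proof (rule P.density_unique_finite_measure)
    fix B assume "B \<in> sets P"
    then have [measurable]: "B \<in> sets N" by simp
    have "(\<integral>\<^sup>+y. (\<Sum>x. q x y) * indicator B y \<partial>P) = (\<integral>\<^sup>+y. (\<Sum>x. q x y * indicator B y) \<partial>P)"
      by simp
    also have "\<dots> = emeasure M (Y -` B \<inter> space M)"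
      using q_sum[of "\<lambda>_. B"] by (simp add: vimage_def Int_def conj_commute)
    also have "\<dots> = (\<integral>\<^sup>+y. 1 * indicator B y \<partial>P)"
      by (simp add: P_def emeasure_distr)
    finally show "(\<integral>\<^sup>+y. (\<Sum>x. q x y) * indicator B y \<partial>P) = (\<integral>\<^sup>+y. 1 * indicator B y \<partial>P)" .
  qed auto
  \<comment> \<open>A fixed point mass is the default on the null set where the derivatives do not
    add up to 1; this set is measurable, which keeps \<open>K\<close> measurable.\<close>
  define K where "K = (\<lambda>y. if (\<Sum>x. q x y) = 1 then embed_pmf (\<lambda>x. enn2real (q x y)) else return_pmf 0)"
  have fin: "q x y = ennreal (enn2real (q x y))" if "(\<Sum>x. q x y) = 1" for x y
  proof -
    have "q x y \<le> (\<Sum>x. q x y)" using sum_le_suminf[of "\<lambda>x. q x y" "{x}"] by simp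
    then show ?thesis using that by (metis enn2real_positive_iff ennreal_enn2real ennreal_one_less_top order_le_less_trans)
  qed
  have pmf_K: "pmf (K y) x = (if (\<Sum>x. q x y) = 1 then enn2real (q x y) else indicator {0} x)" for x y
  proof (cases "(\<Sum>x. q x y) = 1")
    case True
    have "(\<integral>\<^sup>+x. ennreal (enn2real (q x y)) \<partial>count_space UNIV) = 1"
      using True fin[OF True] by (simp add: nn_integral_count_space_nat)
    then show ?thesis using True by (simp add: K_def pmf_embed_pmf)
  qed (auto simp: K_def indicator_def)
  have K: "(\<lambda>y. pmf (K y) x) \<in> borel_measurable N" for x
    unfolding pmf_K by measurable
  interpret S: source P K
    by (rule source.intro[OF P.prob_space_axioms]) (simp add: source_axioms_def K measurable_cong_sets[OF sP refl])
  have sJ: "sets (joint P K) = sets (count_space UNIV \<Otimes>\<^sub>M N)"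
    unfolding S.sets_joint by (rule sets_pair_measure_cong[OF refl sP])
  have "PXY M X Y N = joint P K"
  proof (rule measure_eqI)
    show "sets (PXY M X Y N) = sets (joint P K)"
      by (simp add: PXY_def sJ)
    fix A assume A: "A \<in> sets (PXY M X Y N)"
    then have A_meas [measurable]: "A \<in> sets (count_space UNIV \<Otimes>\<^sub>M N)" by (simp add: PXY_def)
    have B: "Pair x -` A \<in> sets N" for x by (rule sets_Pair1[OF A_meas])
    have "A \<in> sets (joint P K)" using A_meas by (simp add: sJ)
    then have "emeasure (joint P K) A = (\<integral>\<^sup>+\<omega>. indicator A \<omega> \<partial>joint P K)" by simp
    also have "\<dots> = (\<integral>\<^sup>+y. \<integral>\<^sup>+x. indicator A (x, y) \<partial>K y \<partial>P)"
      by (rule S.nn_integral_joint) measurable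
    also have "\<dots> = (\<integral>\<^sup>+y. (\<Sum>x. q x y * indicator (Pair x -` A) y) \<partial>P)"
      using one
    proof (intro nn_integral_cong_AE, eventually_elim)
      fix y assume y: "(\<Sum>x. q x y) = 1"
      have "(\<integral>\<^sup>+x. indicator A (x, y) \<partial>K y) = (\<Sum>x. ennreal (pmf (K y) x) * indicator A (x, y))"
        by (simp add: nn_integral_measure_pmf nn_integral_count_space_nat)
      also have "\<dots> = (\<Sum>x. q x y * indicator (Pair x -` A) y)"
        using fin[OF y] y by (intro suminf_cong) (simp add: pmf_K indicator_def)
      finally show "(\<integral>\<^sup>+x. indicator A (x, y) \<partial>K y) = (\<Sum>x. q x y * indicator (Pair x -` A) y)" .
    qed
    also have "\<dots> = emeasure M {\<omega> \<in> space M. Y \<omega> \<in> Pair (X \<omega>) -` A}"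
      by (rule q_sum[OF B])
    also have "\<dots> = emeasure (PXY M X Y N) A"
      unfolding PXY_def by (subst emeasure_distr) (auto intro!: arg_cong[where f = "emeasure M"])
    finally show "emeasure (PXY M X Y N) A = emeasure (joint P K) A" by simp
  qed
  then have "disintegration M X Y N K"
    using X Y K by (intro disintegration.intro prob_space_axioms) (simp add: disintegration_axioms_def P_def)
  then show thesis by (rule that)
qed

section \<open>Assembly of the two bounds for the given pair\<close>

locale good_disintegration = disintegration M X Y N K + good_source "distr M N Y" K c C
  for M :: "'a measure" and X and Y :: "'a \<Rightarrow> 'y" and N K c C
begin

lemma is_code_max_iff:
  "is_code_max M X Y N n L eps F G \<longleftrightarrow> S.block_code n L eps F G"
proof -
  have "sets (PiM {..<n} (\<lambda>_. N)) = sets (S.PN n)" by (rule sets_PiM_cong) auto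
  then have "vimage_algebra (space (S.QN n)) (\<lambda>z. Yn n (fst z)) (PiM {..<n} (\<lambda>_. N)) = S.sigYn n"
    unfolding vimage_algebra_def by simp
  then show ?thesis
    unfolding is_code_max_def S.block_code_def Qn_def PXY_eq Let_def by simp
qed

lemma Lstar_max_bounds:
  assumes n: "0 < n" and eps: "0 \<le> eps" "eps \<le> 1"
  shows "\<bar>Lstar_max M X Y N n eps - (n * (1 - eps) * H - sqrt (n * Vc) * fG eps)\<bar>
    \<le> 2 * H + (1 + C)\<^sup>2 / c + log 2 (n + 1) + err n + 4"
proof -
  define R where "R = n * (1 - eps) * H - sqrt (n * Vc) * fG eps"
  define A where "A = {L. L > 0 \<and> (\<exists>F G. is_code_max M X Y N n L eps F G)}"
  have l: "0 \<le> log 2 (real n + 1)" by simp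
  have Cc: "0 \<le> (1 + C)\<^sup>2 / c" using c by simp
  obtain F G L0 where "S.block_code n L0 eps F G"
      and L0: "0 < L0" "L0 \<le> (1 - eps) * (n * H) - fG eps * sqrt (n * Vc) + (1 + C)\<^sup>2 / c + err n + 1"
    by (rule achievability[OF n eps]) (rule that)
  then have "is_code_max M X Y N n L0 eps F G" by (simp add: is_code_max_iff)
  then have L0A: "L0 \<in> A" using L0(1) by (auto simp: A_def)
  have "bdd_below A" by (rule bdd_belowI[of _ 0]) (auto simp: A_def)
  then have "Inf A \<le> L0" by (rule cInf_lower[OF L0A])
  then have upper: "Inf A \<le> R + ((1 + C)\<^sup>2 / c + err n + 1)"
    using L0(2) by (simp add: R_def mult_ac)
  have "R - (2 * H + log 2 (n + 1) + err n + 4) \<le> L" if L: "L \<in> A" for L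
  proof -
    obtain F G where L_pos: "0 < L" and code: "is_code_max M X Y N n L eps F G"
      using L by (auto simp: A_def)
    have main: "(1 - eps) * (n * H) - fG eps * (sqrt (n * Vc) + 1) \<le> (1 + 2 / n) * L + log 2 (n + 1) + err n + 3"
      using converse_bound[OF n eps less_imp_le[OF L_pos] code[unfolded is_code_max_iff]]
      by (simp only: of_nat_add of_nat_1)
    show ?thesis
    \<comment> \<open>The factor \<open>1 + 2 / n\<close> of the converse is harmless: if
      \<open>L\<close> is below \<open>n * H\<close> it costs at most \<open>2 * H\<close>, and
      otherwise \<open>L\<close> already exceeds the main term.\<close>
    proof (cases "n * H \<le> L")
      case True
      have "(1 - eps) * (n * H) \<le> 1 * (n * H)"
        using eps H_nonneg by (intro mult_right_mono) auto
      moreover have "0 \<le> sqrt (n * Vc) * fG eps"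
        using Vc_bounds c fG_nonneg by (intro mult_nonneg_nonneg) auto
      ultimately have "R \<le> L" using True unfolding R_def by (simp add: mult_ac)
      then show ?thesis using l H_nonneg err_nonneg[OF n] unfolding of_nat_add of_nat_1 by linarith
    next
      case False
      then have "2 / n * L \<le> 2 * H" using n by (simp add: field_simps)
      moreover have "(1 - eps) * (n * H) - fG eps * (sqrt (n * Vc) + 1) = R - fG eps"
        by (simp add: R_def algebra_simps)
      ultimately show ?thesis using main fG_le_1[of eps] by (simp add: distrib_right)
    qed
  qed
  then have lower: "R - (2 * H + log 2 (n + 1) + err n + 4) \<le> Inf A"
    using L0A by (intro cInf_greatest) auto
  show ?thesis
    using upper lower l Cc H_nonneg unfolding Lstar_max_def A_def[symmetric] R_def[symmetric] of_nat_add of_nat_1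
    by linarith
qed

lemma Lstar_max_expansion:
  assumes eps: "0 \<le> eps" "eps \<le> 1"
  shows "(\<lambda>n. Lstar_max M X Y N n eps - (real n * (1 - eps) * H - sqrt (real n * Vc) * fG eps))
    \<in> O(\<lambda>n. ln (real n))"
proof (rule bigoI[where c = "2 * H + (1 + C)\<^sup>2 / c + 2 * (C + (1 + C)\<^sup>2) / min 1 c + 9"])
  show "eventually (\<lambda>n. norm (Lstar_max M X Y N n eps - (real n * (1 - eps) * H - sqrt (real n * Vc) * fG eps))
      \<le> (2 * H + (1 + C)\<^sup>2 / c + 2 * (C + (1 + C)\<^sup>2) / min 1 c + 9) * norm (ln (real n))) at_top"
    \<comment> \<open>From \<open>n = 3\<close> on, \<open>ln n\<close> is at least 1 and absorbs
      all constants. The 9 collects 4 from the bounds, 4 from \<open>log 2 (n + 1)\<close> and 1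
      from the replacement error.\<close>
    using eventually_ge_at_top[of 3]
  proof eventually_elim
    case (elim n)
    then have n: "0 < n" by simp
    have "exp 1 \<le> real n" using exp_le elim by linarith
    then have ln: "1 \<le> ln (real n)" using n by (simp add: ln_ge_iff)
    have log: "log 2 (real n + 1) \<le> 4 * ln (real n)"
    proof -
      have "real n + 1 \<le> real n ^ 2"
      proof -
        have "3 * real n \<le> real n * real n" using elim by (intro mult_right_mono) auto
        then show ?thesis using n unfolding power2_eq_square by linarith
      qed
      then have "ln (real n + 1) \<le> ln (real n ^ 2)" using n by (subst ln_le_cancel_iff) auto
      then have 1: "ln (real n + 1) \<le> 2 * ln (real n)" using n by (simp add: ln_realpow)
      note ln_2_ge_half
      then have "2 * ln (real n) * 1 \<le> 2 * ln (real n) * (2 * ln 2)"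
        using ln by (intro mult_left_mono) auto
      then have "ln (real n + 1) \<le> 4 * ln (real n) * ln 2" using 1 by (simp add: mult_ac)
      then show ?thesis by (simp add: log_def pos_divide_le_eq)
    qed
    define B where "B = (C + (1 + C)\<^sup>2) / min 1 c"
    have B: "0 \<le> B" using C c by (simp add: B_def)
    have err: "err n \<le> (1 + 2 * B) * ln (real n)"
    proof -
      have "err n = 1 + B + B * ln (real n)"
        by (simp add: Lindeberg_error_def B_def distrib_left)
      also have "\<dots> \<le> 1 * ln (real n) + B * ln (real n) + B * ln (real n)"
        using ln mult_left_mono[OF ln B] by simp
      finally show ?thesis by (simp add: algebra_simps)
    qed
    define D where "D = 2 * H + (1 + C)\<^sup>2 / c + 4"
    have "0 \<le> D" using H_nonneg c by (simp add: D_def)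
    then have D: "D \<le> D * ln (real n)" using mult_left_mono[OF ln] by simp
    have "\<bar>Lstar_max M X Y N n eps - (n * (1 - eps) * H - sqrt (n * Vc) * fG eps)\<bar> \<le> D + log 2 (real n + 1) + err n"
      using Lstar_max_bounds[OF n eps] by (simp add: D_def add_ac)
    also have "\<dots> \<le> D * ln (real n) + 4 * ln (real n) + (1 + 2 * B) * ln (real n)"
      using D log err by linarith
    also have "\<dots> = (2 * H + (1 + C)\<^sup>2 / c + 2 * (C + (1 + C)\<^sup>2) / min 1 c + 9) * norm (ln (real n))"
      using ln by (simp add: D_def B_def algebra_simps)
    finally show ?case by simp
  qed
qed

end

theorem theorem1:
  fixes M :: "'a measure" and N :: "'y measure"
    and X :: "'a \<Rightarrow> nat" and Y :: "'a \<Rightarrow> 'y"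
  assumes "prob_space M"
    and "X \<in> M \<rightarrow>\<^sub>M count_space UNIV"
    and "\<forall>\<omega>\<in>space M. X \<omega> \<ge> 1"
    and "Y \<in> M \<rightarrow>\<^sub>M N"
    and "integrable M (iota M X Y N)"
    and "\<exists>c>0. AE \<omega> in M. calV M X Y N \<omega> \<ge> ennreal c"
    and "\<exists>C. AE \<omega> in M. calT M X Y N \<omega> \<le> ennreal C"
    and "0 \<le> eps" and "eps \<le> 1"
  shows "(\<lambda>n. Lstar_max M X Y N n eps
            - (real n * (1 - eps) * condH M X Y N
               - sqrt (real n * condVc M X Y N) * fG eps))
         \<in> O(\<lambda>n. ln (real n))"
proof -
  obtain c where c: "c > 0" and V: "AE \<omega> in M. ennreal c \<le> calV M X Y N \<omega>" using assms(6) by blast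
  obtain C0 where C0: "AE \<omega> in M. calT M X Y N \<omega> \<le> ennreal C0" using assms(7) by blast
  define C where "C = max C0 0"
  have le: "ennreal C0 \<le> ennreal C" by (intro ennreal_leI) (simp add: C_def)
  have T: "AE \<omega> in M. calT M X Y N \<omega> \<le> ennreal C"
    using C0 by eventually_elim (rule order_trans[OF _ le])
  have C: "0 \<le> C" by (simp add: C_def)
  note iota = borel_measurable_integrable[OF assms(5)]
  obtain K0 where K0: "disintegration M X Y N K0"
    using disintegration_exists[OF assms(1,2,4)] by blast
  interpret D0: disintegration M X Y N K0 by (rule K0)
  have good: "AE y in distr M N Y. good_pmf c C (K0 y)"
    by (rule D0.AE_good_pmf[OF iota assms(5) V T C])
  then obtain Z where Z: "{y \<in> space (distr M N Y). \<not> good_pmf c C (K0 y)} \<subseteq> Z"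
      "Z \<in> sets N" "emeasure (distr M N Y) Z = 0"
    by (auto elim!: AE_E)
  \<comment> \<open>A property that holds almost everywhere under a probability measure holds
    somewhere; this supplies a default kernel value.\<close>
  have "\<exists>y0. good_pmf c C (K0 y0)"
  proof (rule ccontr)
    assume "\<nexists>y0. good_pmf c C (K0 y0)"
    then have "AE y in distr M N Y. False" using good by simp
    then show False by (simp add: D0.S.AE_False)
  qed
  then obtain y0 where y0: "good_pmf c C (K0 y0)" by blast
  \<comment> \<open>On the null set and outside the space the kernel is frozen at a good value, so
    that the result is good at every \<open>y\<close> and still measurable.\<close>
  define K where "K = (\<lambda>y. if y \<in> space N - Z then K0 y else K0 y0)"
  have K_good: "good_pmf c C (K y)" for y using Z(1) y0 by (auto simp: K_def)
  have K_meas: "(\<lambda>y. pmf (K y) x) \<in> borel_measurable N" for x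
  proof -
    have "(\<lambda>y. if y \<in> space N - Z then pmf (K0 y) x else pmf (K0 y0) x) \<in> borel_measurable N"
      using Z(2) by measurable
    then show ?thesis by (simp add: K_def if_distrib[where f = "\<lambda>p. pmf p x"] cong: if_cong)
  qed
  have "AE y in distr M N Y. y \<notin> Z" using Z by (intro AE_not_in) (auto simp: null_sets_def)
  then have "AE y in distr M N Y. K y = K0 y"
    using AE_space by eventually_elim (simp add: K_def)
  then have "disintegration M X Y N K" by (rule disintegration_modify[OF K0 K_meas])
  then interpret D: disintegration M X Y N K .
  interpret good_disintegration M X Y N K c C
    by unfold_locales (use c C K_good D.integrable_ent[OF iota assms(5)] in auto)
  show ?thesis
    using Lstar_max_expansion[OF assms(8,9)]
    unfolding H_def Vc_def D.condH_eq[OF iota] D.condVc_eq[OF iota K_good C] .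
qed

end
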